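(* Let $n>2$. With the notation of the context, the following hold. (1) $\mathcal{M}$ is an irreducible algebraic variety. (2) $\mathcal{M}=\bigcup_{s\in\mathbb{R}}\mathcal{M}_s$, where $\mathcal{M}_s=\{X\in\mathcal{M}\mid \mathrm{trace}(X)=s\}$. Moreover $\mathcal{M}$ is the straight cylinder over $\mathcal{M}_0$ having the line $\mathrm{Scal}$ as element. (3) Orbits of matrices in $\mathcal{M}$ are classified by the spectrum, or equivalently by the unique diagonal-ordered matrix in the orbit: two matrices in $\mathcal{M}$ lie in the same orbit if and only if they have the same spectrum, and each orbit of a matrix in $\mathcal{M}$ contains exactly one diagonal-ordered matrix. (4) $\mathcal{MH}$ has the following structure. (4.1) Locally, $\mathcal{MH}$ is a smooth fibration over the plane $\Pi$ with the fiber being an orbit of a diagonal matrix from $\mathcal{MH}$ (in the sense specified in the context). The orbit of each matrix in $\mathcal{MH}$ orthogonally intersects the plane $\mathrm{Dg}$ of diagonal matrices. (4.2) The orbit of each matrix in $\mathcal{MH}$ is a smooth, compact, algebraic, connected surface of dimension $\dim \mathrm{SO}(n)-1=\frac{n(n-1)}{2}-1$. It lies on a sphere in a hyperplane orthogonal to the line $\mathrm{Scal}$ of scalar matrices. (5) The map $\mathrm{DO}:\Pi\times \mathrm{SO}(n)\to\mathcal{M}$, $$\mathrm{DO}\big((\lambda,\mu_1,\ldots,\mu_{n-2}),g\big)=g\,\mathrm{diag}(\lambda,\lambda,\mu_1,\ldots,\mu_{n-2})\,g^{*},$$ is a surjective polynomial map of algebraic surfaces (where the domain has dimension one more than the ima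ge).
   Context: $\mathrm{Sym}(n)$ is the space of real symmetric $n\times n$ matrices. $\mathcal{M}=\{X\in\mathrm{Sym}(n)\mid \mathrm{discr}(X)=0\}$, where $\mathrm{discr}(X)$ is the discriminant of the characteristic polynomial of $X$; thus $\mathcal{M}$ is the set of symmetric matrices with a multiple eigenvalue. $\mathcal{MH}\subset\mathcal{M}$ is the set of matrices in $\mathrm{Sym}(n)$ with exactly $n-1$ different eigenvalues. $\mathrm{Dg}$ is the space of diagonal $n\times n$ matrices, and $\mathrm{Scal}=\{cE\mid c\in\mathbb{R}\}$ is the line of scalar matrices ($E$ the identity matrix). $\Pi\subset\mathrm{Dg}$ is the $(n-1)$-dimensional plane of all matrices $\mathrm{diag}(\lambda,\lambda,\mu_1,\ldots,\mu_{n-2})$, identified with $\mathbb{R}^{n-1}$ via $(\lambda,\mu_1,\ldots,\mu_{n-2})\mapsto \mathrm{diag}(\lambda,\lambda,\mu_1,\ldots,\mu_{n-2})$. The orbit of $A\in\mathrm{Sym}(n)$ is $\mathrm{Orbit}(A)=\{gAg^{*}\mid g\in \mathrm{SO}(n)\}$, where $g^{*}$ is the transpose. The spectrum of a matrix in $\mathrm{Sym}(n)$ is the multiset of its eigenvalues (with multiplicities). A diagonal-ordered matrix is a diagonal matrix $D$ with $D_{1,1}\le\cdots\le D_{n,n}$. All metric notions (orthogonality, sphere, isometry, straight cylinder) refer to the inner product $\langle X,Y\rangle=\sum_{i,j}x_{i,j}y_{i,j}$ on $n\times n$ matrices. "$\mathcal{M}$ is the straight cylinder over $\mathcal{M}_0$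 having the line $\mathrm{Scal}$ as element" means: $\mathcal{M}_0$ lies in a hyperplane orthogonal to $\mathrm{Scal}$ and $\mathcal{M}=\{X+cE\mid X\in\mathcal{M}_0,\ c\in\mathbb{R}\}$. An orbit orthogonally intersects $\mathrm{Dg}$ if at each intersection point the tangent space of the orbit is orthogonal to $\mathrm{Dg}$. Algebraic sets are common zero sets of real polynomials in the coordinates; an algebraic set is irreducible if it is not the union of two algebraic subsets both different from it. A map is polynomial if each coordinate of the image is a polynomial in the coordinates of the argument. The local fibration statement in (4.1) means: for every $M\in\mathcal{MH}$ there are $g\in\mathrm{SO}(n)$ and $D_0\in\Pi\cap\mathcal{MH}$ with $gMg^{*}=D_0$ (the map $X\mapsto gXg^{*}$ is an isometry of $\mathrm{Sym}(n)$ preserving $\mathcal{MH}$), an open neighbourhood $U$ of $D_0$ in the smooth manifold $\mathcal{MH}$, and a smooth locally trivial fibration $\pi:U\to \Pi\cap U$ such that $\pi(D)=D$ and $\pi^{-1}(D)=U\cap\mathrm{Orbit}(D)$ for every $D\in\Pi\cap U$. *)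

theory Defs
  imports "Subresultants.Resultant_Prelim" "HOL-Analysis.Analysis"
begin

no_notation Matrix.vec_index (infixl \<open>$\<close> 100)
no_notation Matrix.scalar_prod (infix \<open>\<bullet>\<close> 70)

section \<open>Symmetric matrices, spectra and orbits\<close>

text \<open>The index type \<open>'n\<close> is a finite linear order with \<open>n\<close> elements, i.e. a copy of
  \<open>{1 < \<dots> < n}\<close>. The inner product of \<^typ>\<open>real^'n^'n\<close> is the entrywise one.\<close>

type_synonym 'n sqmat = "real^'n^'n"

definition Sym :: "'n::finite sqmat set" where
  "Sym = {X. Finite_Cartesian_Product.transpose X = X}"

definition Dg :: "'n::finite sqmat set" where
  "Dg = {X. \<forall>i j. i \<noteq> j \<longrightarrow> X $ i $ j = 0}"

definition Scal :: "'n::finite sqmat set" where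
  "Scal = {c *\<^sub>R Finite_Cartesian_Product.mat 1 | c. True}"

definition SO :: "'n::finite sqmat set" where
  "SO = {g. rotation_matrix g}"

definition conj_by :: "'n::finite sqmat \<Rightarrow> 'n sqmat \<Rightarrow> 'n sqmat" where
  "conj_by g X = g ** X ** Finite_Cartesian_Product.transpose g"

definition Orbit :: "'n::finite sqmat \<Rightarrow> 'n sqmat set" where
  "Orbit A = {conj_by g A | g. g \<in> SO}"

definition charpoly :: "'n::finite sqmat \<Rightarrow> real poly" where
  "charpoly X = Determinants.det
     (\<chi> i j. if i = j then [:- (X $ i $ j), 1:] else [:- (X $ i $ j):])"

definition discriminant :: "'a::field poly \<Rightarrow> 'a" where
  "discriminant p =
     (- 1) ^ (degree p * (degree p - 1) div 2) * resultant p (pderiv p) / lead_coeff p"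

definition eigenvalues :: "'n::finite sqmat \<Rightarrow> real set" where
  "eigenvalues X = {c. \<exists>v. v \<noteq> 0 \<and> X *v v = c *\<^sub>R v}"

text \<open>All complex eigenvalues of a real symmetric matrix are real, so the real roots of the
  characteristic polynomial, with multiplicities, form the whole spectrum.\<close>

definition spectrum :: "'n::finite sqmat \<Rightarrow> real multiset" where
  "spectrum X = proots (charpoly X)"

definition MM :: "'n::finite sqmat set" where
  "MM = {X \<in> Sym. discriminant (charpoly X) = 0}"

definition MH :: "'n::finite sqmat set" where
  "MH = {X \<in> Sym. card (eigenvalues X) = CARD('n) - 1}"

definition MM_level :: "real \<Rightarrow> 'n::finite sqmat set" where
  "MM_level s = {X \<in> MM. Determinants.trace X = s}"

definition diagonal_ordered :: "'n::{finite,linorder} sqmat \<Rightarrow> bool" where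
  "diagonal_ordered D \<longleftrightarrow> D \<in> Dg \<and> (\<forall>i j. i \<le> j \<longrightarrow> D $ i $ i \<le> D $ j $ j)"

text \<open>\<open>card {k. k < i}\<close> is the position of \<open>i\<close>, counted from \<open>0\<close>, in the order of \<open>'n\<close>.\<close>

definition diag_list :: "real list \<Rightarrow> 'n::{finite,linorder} sqmat" where
  "diag_list xs = (\<chi> i j. if i = j then xs ! card {k. k < i} else 0)"

definition Pi_plane :: "'n::{finite,linorder} sqmat set" where
  "Pi_plane = {diag_list (l # l # ms) | l ms. length ms = CARD('n) - 2}"

text \<open>The identification of \<open>\<real>\<^sup>n\<^sup>-\<^sup>1\<close> with the plane \<^const>\<open>Pi_plane\<close>: the coordinates
  \<open>(\<lambda>, \<mu>)\<close> have \<open>\<mu>\<close> in \<open>\<real>\<^sup>n\<^sup>-\<^sup>2\<close>, whose ordered index type \<open>'m\<close> has \<open>n - 2\<close> elements.\<close>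

type_synonym 'm plane_coords = "real \<times> (real^'m)"

definition diag_coords :: "'m::{finite,linorder} plane_coords \<Rightarrow> 'n::{finite,linorder} sqmat" where
  "diag_coords = (\<lambda>(l, m). diag_list (l # l # map (\<lambda>k. m $ k) (sorted_list_of_set UNIV)))"

lemma range_diag_coords:
  assumes "CARD('n::{finite,linorder}) = CARD('m::{finite,linorder}) + 2"
  shows "range (diag_coords :: 'm plane_coords \<Rightarrow> 'n sqmat) = Pi_plane"
proof -
  define xs :: "'m list" where "xs = sorted_list_of_set UNIV"
  have xs: "set xs = UNIV" "distinct xs" "length xs = CARD('m)"
    by (simp_all add: xs_def)
  have "\<exists>m :: (real, 'm) vec. ms = map (\<lambda>k. m $ k) xs" if "length ms = CARD('m)" for ms
  proof -
    define m :: "(real, 'm) vec" where "m = (\<chi> k. the (map_of (zip xs ms) k))"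
    have "map (\<lambda>k. m $ k) xs = ms"
      by (rule nth_equalityI) (use that xs in \<open>auto simp: m_def map_of_zip_nth\<close>)
    then show ?thesis by metis
  qed
  then have "{map (\<lambda>k. m $ k) xs | m :: (real, 'm) vec. True} = {ms. length ms = CARD('n) - 2}"
    using assms xs(3) by auto
  then have "(\<exists>m :: (real, 'm) vec. ms = map (\<lambda>k. m $ k) xs) \<longleftrightarrow> length ms = CARD('n) - 2" for ms
    by (simp add: set_eq_iff)
  then show ?thesis
    unfolding diag_coords_def Pi_plane_def image_def xs_def [symmetric] by (simp, metis)
qed

definition DO ::
  "'m::{finite,linorder} plane_coords \<times> 'n::{finite,linorder} sqmat \<Rightarrow> 'n sqmat" where
  "DO = (\<lambda>(p, g). conj_by g (diag_coords p))"

text \<open>Hyperplanes of \<^const>\<open>Sym\<close>, not of the space of all matrices.\<close>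

definition hyperplane_orth_Scal :: "'n::finite sqmat set \<Rightarrow> bool" where
  "hyperplane_orth_Scal H \<longleftrightarrow> (\<exists>N \<in> Scal - {0}. \<exists>s. H = {X \<in> Sym. inner N X = s})"

definition straight_cylinder_Scal :: "'n::finite sqmat set \<Rightarrow> 'n sqmat set \<Rightarrow> bool" where
  "straight_cylinder_Scal S B \<longleftrightarrow>
     (\<exists>H. hyperplane_orth_Scal H \<and> B \<subseteq> H) \<and> S = {X + Y | X Y. X \<in> B \<and> Y \<in> Scal}"

section \<open>Algebraic sets\<close>

definition algebraic_set :: "'a::euclidean_space set \<Rightarrow> bool" where
  "algebraic_set S \<longleftrightarrow>
     (\<exists>P. (\<forall>p \<in> P. real_polynomial_function p) \<and> S = {x. \<forall>p \<in> P. p x = 0})"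

definition irreducible_algebraic_set :: "'a::euclidean_space set \<Rightarrow> bool" where
  "irreducible_algebraic_set S \<longleftrightarrow> algebraic_set S \<and>
     \<not> (\<exists>A B. algebraic_set A \<and> algebraic_set B \<and> A \<noteq> S \<and> B \<noteq> S \<and> S = A \<union> B)"

section \<open>Smooth submanifolds of Euclidean spaces\<close>

text \<open>\<open>Ck_on k f S\<close> is only used for open \<open>S\<close>, where it says that \<open>f\<close> is \<open>k\<close> times
  continuously differentiable on \<open>S\<close>.\<close>

fun Ck_on :: "nat \<Rightarrow> ('a::euclidean_space \<Rightarrow> 'b::euclidean_space) \<Rightarrow> 'a set \<Rightarrow> bool" where
  "Ck_on 0 f S \<longleftrightarrow> continuous_on S f"
| "Ck_on (Suc k) f S \<longleftrightarrow> (\<forall>x \<in> S. f differentiable (at x)) \<and>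
     (\<forall>v. Ck_on k (\<lambda>x. frechet_derivative f (at x) v) S)"

definition smooth_on_open :: "('a::euclidean_space \<Rightarrow> 'b::euclidean_space) \<Rightarrow> 'a set \<Rightarrow> bool" where
  "smooth_on_open f S \<longleftrightarrow> open S \<and> (\<forall>k. Ck_on k f S)"

text \<open>Maps on an arbitrary subset are smooth if they locally extend to smooth maps on open sets
  of the ambient space; on submanifolds this is smoothness in charts.\<close>

definition smooth_map_on :: "('a::euclidean_space \<Rightarrow> 'b::euclidean_space) \<Rightarrow> 'a set \<Rightarrow> bool" where
  "smooth_map_on f S \<longleftrightarrow>
     (\<forall>p \<in> S. \<exists>W F. p \<in> W \<and> smooth_on_open F W \<and> (\<forall>x \<in> W \<inter> S. F x = f x))"

definition diffeomorphism_between ::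
  "('a::euclidean_space \<Rightarrow> 'b::euclidean_space) \<Rightarrow> 'a set \<Rightarrow> 'b set \<Rightarrow> bool" where
  "diffeomorphism_between f S T \<longleftrightarrow>
     bij_betw f S T \<and> smooth_map_on f S \<and> smooth_map_on (inv_into S f) T"

definition smooth_submanifold :: "nat \<Rightarrow> 'a::euclidean_space set \<Rightarrow> bool" where
  "smooth_submanifold d S \<longleftrightarrow>
     (\<forall>p \<in> S. \<exists>W W' (\<phi> :: 'a \<Rightarrow> 'a) L. open W \<and> p \<in> W \<and> open W' \<and> diffeomorphism_between \<phi> W W' \<and>
        subspace L \<and> dim L = d \<and> \<phi> ` (W \<inter> S) = W' \<inter> L)"

text \<open>Velocities at \<open>p\<close> of smooth curves in \<open>S\<close> through \<open>p\<close>.\<close>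

definition tangent_space :: "'a::euclidean_space set \<Rightarrow> 'a \<Rightarrow> 'a set" where
  "tangent_space S p = {v. \<exists>\<gamma> e. e > 0 \<and> smooth_on_open \<gamma> {- e <..< e :: real} \<and>
     \<gamma> ` {- e <..< e} \<subseteq> S \<and> \<gamma> 0 = p \<and> (\<gamma> has_vector_derivative v) (at 0)}"

text \<open>Since each typical fibre is diffeomorphic to an actual fibre of \<open>\<pi>\<close>, it is no restriction
  to look for the typical fibre \<open>F\<close> in the ambient space of \<open>E\<close>.\<close>

definition smooth_fibration ::
  "('a::euclidean_space \<Rightarrow> 'b::euclidean_space) \<Rightarrow> 'a set \<Rightarrow> 'b set \<Rightarrow> bool" where
  "smooth_fibration \<pi> E B \<longleftrightarrow>
     (\<exists>d. smooth_submanifold d E) \<and> (\<exists>d. smooth_submanifold d B) \<and>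
     smooth_map_on \<pi> E \<and> \<pi> ` E = B \<and>
     (\<forall>b \<in> B. \<exists>V (F :: 'a set) \<phi>. openin (top_of_set B) V \<and> b \<in> V \<and>
        (\<exists>d. smooth_submanifold d F) \<and>
        diffeomorphism_between \<phi> {x \<in> E. \<pi> x \<in> V} (V \<times> F) \<and>
        (\<forall>x \<in> E. \<pi> x \<in> V \<longrightarrow> fst (\<phi> x) = \<pi> x))"

text \<open>The dimension of a nonempty real algebraic set (singular points allowed): the largest
  dimension of a smooth submanifold contained in it.\<close>

definition surface_dim :: "'a::euclidean_space set \<Rightarrow> nat" where
  "surface_dim S = (GREATEST d. \<exists>N. N \<noteq> {} \<and> N \<subseteq> S \<and> smooth_submanifold d N)"

end

theory Submission
  imports Defs "Subresultants.Subresultant_Gcd" "HOL-Computational_Algebra.Field_as_Ring"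
begin

no_notation Matrix.vec_index (infixl \<open>$\<close> 100)
no_notation Matrix.scalar_prod (infix \<open>\<bullet>\<close> 70)

text \<open>Three ideas carry the proof. First, a matrix maximizing \<open>\<Sum>\<^sub>i i Y\<^sub>i\<^sub>i\<close> on a compact subset of an
  orbit that is closed under plane rotations is diagonal-ordered. This gives diagonalization by \<open>SO(n)\<close>,
  the classification of orbits by the spectrum and, since two complementary clopen parts of an
  orbit would both contain its only diagonal-ordered matrix, the connectedness of orbits.

  Second, near a diagonal matrix in \<open>\<Pi> \<inter> \<M>\<H>\<close> one chart of the space of matrices, built from the
  Cayley transform and smoothly invertible by the inverse function theorem, flattens \<open>\<M>\<H>\<close> and the
  orbit at the same time and splits \<open>\<M>\<H>\<close> as a product of a piece of \<open>\<Pi>\<close> and a piece of the orbit.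

  Third, \<open>\<M>\<close> is the image of a vector space under a polynomial map, hence irreducible, and it is
  covered by finitely many polynomial images of spaces of dimension \<open>n (n + 1) / 2 - 2\<close>, which
  bounds the dimension of any submanifold inside it, even at singular points.\<close>

section \<open>Smooth functions\<close>

text \<open>Submanifolds are defined by diffeomorphisms of the ambient space, here all n by n
  matrices. Each parametrization is therefore completed by a summand or factor in complementary
  directions, symmetric for \<open>SO\<close> and skew for \<open>MH\<close>. It then maps between
  spaces of equal dimension, as the inverse function theorem requires. The Cayley transform
  parametrizes rotations because its smoothness reduces to that of one matrix inverse.

  Rotating in the plane of a double eigenvalue does not move the matrix. Hence the skew matrices of
  the chart omit the (1, 2) entry, and an off-diagonal entry of the leading block takes its place.
  That entry and the difference of the first two diagonal entries are the two conditions that cut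
  \<open>MH\<close> out of \<open>Sym\<close> locally.

  A multiple eigenvalue is described by eigenvectors in arbitrary hyperplanes. This works when a
  rotation is replaced by a singular matrix, and it yields eigenvectors with a prescribed zero
  coordinate, which drive the chart and the covering of \<open>MM\<close> alike.\<close>

lemma Ck_on_cong:
  assumes "open S" "\<And>x. x \<in> S \<Longrightarrow> f x = g x" "Ck_on k f S"
  shows "Ck_on k g S"
  using assms(2,3)
proof (induction k arbitrary: f g)
  case 0
  then show ?case
    using continuous_on_cong[of S S f g] by auto
next
  case (Suc k)
  have D: "(g has_derivative frechet_derivative f (at x)) (at x)" if "x \<in> S" for x
  proof -
    have "(f has_derivative frechet_derivative f (at x)) (at x)"
      using Suc.prems(2) that frechet_derivative_works by auto
    then show ?thesis
      using has_derivative_transform_within_open[of f _ x UNIV S g] assms(1) Suc.prems(1) that by blast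
  qed
  then have eq: "frechet_derivative f (at x) = frechet_derivative g (at x)" if "x \<in> S" for x
    using that frechet_derivative_at by blast
  have "Ck_on k (\<lambda>x. frechet_derivative g (at x) v) S" for v
    by (rule Suc.IH[of "\<lambda>x. frechet_derivative f (at x) v"]) (use eq Suc.prems in auto)
  with D show ?case
    by (auto simp: differentiable_def)
qed

text \<open>\<open>Ck_on\<close> speaks of \<open>frechet_derivative\<close>, a choice operator. As
  derivatives are unique, one known in closed form may replace it.\<close>

lemma Ck_on_SucI:
  assumes "open S" "\<And>x. x \<in> S \<Longrightarrow> (f has_derivative f' x) (at x)"
    and "\<And>v. Ck_on k (\<lambda>x. f' x v) S"
  shows "Ck_on (Suc k) f S"
proof -
  have "f' x = frechet_derivative f (at x)" if "x \<in> S" for x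
    using assms(2)[OF that] frechet_derivative_at by blast
  then have "Ck_on k (\<lambda>x. frechet_derivative f (at x) v) S" for v
    by (intro Ck_on_cong[OF assms(1) _ assms(3)[of v]]) auto
  then show ?thesis
    using assms(2) by (auto simp: differentiable_def)
qed

lemma Ck_on_Suc_has_derivative:
  assumes "Ck_on (Suc k) f S" "x \<in> S"
  shows "(f has_derivative frechet_derivative f (at x)) (at x)"
  using assms frechet_derivative_works by auto

lemma Ck_on_SucD: "Ck_on (Suc k) f S \<Longrightarrow> Ck_on k f S"
proof (induction k arbitrary: f)
  case 0
  then show ?case
    by (simp add: differentiable_imp_continuous_on differentiable_at_imp_differentiable_on)
next
  case (Suc k)
  have "Ck_on k (\<lambda>x. frechet_derivative f (at x) v) S" for v
    using Suc.IH[of "\<lambda>x. frechet_derivative f (at x) v"] Suc.prems by simp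
  then show ?case using Suc.prems by simp
qed

lemma Ck_on_subset: "Ck_on k f S \<Longrightarrow> T \<subseteq> S \<Longrightarrow> Ck_on k f T"
  by (induction k arbitrary: f) (auto intro: continuous_on_subset)

lemma Ck_on_const: "open S \<Longrightarrow> Ck_on k (\<lambda>x. c) S"
proof (induction k arbitrary: c)
  case (Suc k)
  show ?case
    by (rule Ck_on_SucI[OF Suc.prems has_derivative_const]) (rule Suc.IH[OF Suc.prems])
qed simp

lemma Ck_on_linear_compose:
  assumes "bounded_linear h" "open S"
  shows "Ck_on k f S \<Longrightarrow> Ck_on k (\<lambda>x. h (f x)) S"
proof (induction k arbitrary: f)
  case 0
  then show ?case
    using assms(1) by (simp add: bounded_linear.continuous_on)
next
  case (Suc k)
  show ?case
  proof (rule Ck_on_SucI[OF assms(2)])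
    show "((\<lambda>x. h (f x)) has_derivative (\<lambda>v. h (frechet_derivative f (at x) v))) (at x)"
      if "x \<in> S" for x
      using bounded_linear.has_derivative[OF assms(1) Ck_on_Suc_has_derivative[OF Suc.prems that]] .
    show "Ck_on k (\<lambda>x. h (frechet_derivative f (at x) v)) S" for v
      using Suc.IH Suc.prems by simp
  qed
qed

lemma Ck_on_id: "open S \<Longrightarrow> Ck_on k (\<lambda>x. x) S"
proof (cases k)
  case (Suc k)
  assume "open S"
  then show ?thesis
    unfolding Suc by (intro Ck_on_SucI[OF _ has_derivative_ident] Ck_on_const)
qed simp

lemma Ck_on_bounded_linear: "bounded_linear h \<Longrightarrow> open S \<Longrightarrow> Ck_on k h S"
  using Ck_on_linear_compose[OF _ _ Ck_on_id] by blast

lemma Ck_on_add: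
  assumes "open S"
  shows "Ck_on k f S \<Longrightarrow> Ck_on k g S \<Longrightarrow> Ck_on k (\<lambda>x. f x + g x) S"
proof (induction k arbitrary: f g)
  case 0
  then show ?case by (simp add: continuous_on_add)
next
  case (Suc k)
  show ?case
  proof (rule Ck_on_SucI[OF assms])
    show "((\<lambda>x. f x + g x) has_derivative
        (\<lambda>v. frechet_derivative f (at x) v + frechet_derivative g (at x) v)) (at x)"
      if "x \<in> S" for x
      using has_derivative_add Ck_on_Suc_has_derivative[OF Suc.prems(1) that]
        Ck_on_Suc_has_derivative[OF Suc.prems(2) that] by blast
    show "Ck_on k (\<lambda>x. frechet_derivative f (at x) v + frechet_derivative g (at x) v) S" for v
      using Suc by simp
  qed
qed

lemma Ck_on_sum:
  assumes "open S" "\<And>i. i \<in> I \<Longrightarrow> Ck_on k (f i) S"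
  shows "Ck_on k (\<lambda>x. \<Sum>i\<in>I. f i x) S"
  using assms(2)
proof (induction I rule: infinite_finite_induct)
  case (insert i I)
  then show ?case
    using Ck_on_add[OF assms(1), of k "f i" "\<lambda>x. \<Sum>i\<in>I. f i x"] by simp
qed (simp_all add: Ck_on_const assms(1))

lemma Ck_on_bilinear:
  assumes h: "bounded_bilinear h" and S: "open S"
  shows "Ck_on k f S \<Longrightarrow> Ck_on k g S \<Longrightarrow> Ck_on k (\<lambda>x. h (f x) (g x)) S"
proof (induction k arbitrary: f g)
  case 0
  then show ?case using h by (simp add: bounded_bilinear.continuous_on)
next
  case (Suc k)
  show ?case
  proof (rule Ck_on_SucI[OF S])
    show "((\<lambda>x. h (f x) (g x)) has_derivative
        (\<lambda>v. h (f x) (frechet_derivative g (at x) v) + h (frechet_derivative f (at x) v) (g x))) (at x)"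
      if "x \<in> S" for x
      using bounded_bilinear.FDERIV[OF h] Ck_on_Suc_has_derivative[OF Suc.prems(1) that]
        Ck_on_Suc_has_derivative[OF Suc.prems(2) that] by blast
    show "Ck_on k (\<lambda>x. h (f x) (frechet_derivative g (at x) v) + h (frechet_derivative f (at x) v) (g x)) S" for v
      using Suc.prems by (intro Ck_on_add[OF S] Suc.IH Ck_on_SucD[OF Suc.prems(1)] Ck_on_SucD[OF Suc.prems(2)]) auto
  qed
qed

lemma linear_basis_expansion:
  fixes f :: "'a::euclidean_space \<Rightarrow> 'b::real_vector"
  assumes "linear f"
  shows "f u = (\<Sum>b\<in>Basis. (u \<bullet> b) *\<^sub>R f b)"
  using linear_sum[OF assms, of "\<lambda>b. (u \<bullet> b) *\<^sub>R b" Basis] linear_scale[OF assms]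
  by (simp add: euclidean_representation)

lemma Ck_on_compose:
  fixes f :: "'a::euclidean_space \<Rightarrow> 'b::euclidean_space" and g :: "'b \<Rightarrow> 'c::euclidean_space"
  assumes S: "open S" and T: "open T" and sub: "f ` S \<subseteq> T"
  shows "Ck_on k f S \<Longrightarrow> Ck_on k g T \<Longrightarrow> Ck_on k (\<lambda>x. g (f x)) S"
proof (induction k arbitrary: g)
  case 0
  then show ?case using continuous_on_compose2[of T g S f] sub by simp
next
  case (Suc k)
  let ?Df = "\<lambda>x. frechet_derivative f (at x)" and ?Dg = "\<lambda>y. frechet_derivative g (at y)"
  have Dg: "(g has_derivative ?Dg (f x)) (at (f x))" if "x \<in> S" for x
    using Ck_on_Suc_has_derivative[OF Suc.prems(2)] sub that by blast
  show ?case
  proof (rule Ck_on_SucI[OF S])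
    \<comment> \<open>The direction \<open>?Df x v\<close> moves with \<open>x\<close>, but
      \<open>Ck_on\<close> only controls derivatives in fixed directions. Expanding over
      \<open>Basis\<close> leaves coefficients and fixed directions.\<close>
    show "((\<lambda>x. g (f x)) has_derivative (\<lambda>v. \<Sum>b\<in>Basis. (?Df x v \<bullet> b) *\<^sub>R ?Dg (f x) b)) (at x)"
      if "x \<in> S" for x
    proof -
      have "((\<lambda>x. g (f x)) has_derivative (\<lambda>v. ?Dg (f x) (?Df x v))) (at x)"
        using has_derivative_compose[OF Ck_on_Suc_has_derivative[OF Suc.prems(1) that]] Dg[OF that] by blast
      then show ?thesis
        using linear_basis_expansion[OF has_derivative_linear[OF Dg[OF that]]]
        by (metis (no_types, lifting) ext)
    qed
    show "Ck_on k (\<lambda>x. \<Sum>b\<in>Basis. (?Df x v \<bullet> b) *\<^sub>R ?Dg (f x) b) S" for v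
    proof (intro Ck_on_sum[OF S] Ck_on_bilinear[OF bounded_bilinear_scaleR S])
      fix b :: 'b
      show "Ck_on k (\<lambda>x. ?Df x v \<bullet> b) S"
        by (rule Ck_on_linear_compose[OF bounded_linear_inner_left S]) (use Suc.prems in simp)
      show "Ck_on k (\<lambda>x. ?Dg (f x) b) S"
        by (rule Suc.IH) (use Suc.prems in \<open>auto intro: Ck_on_SucD\<close>)
    qed
  qed
qed

section \<open>Closure properties of smooth maps on open sets\<close>

lemma smooth_on_open_compose:
  assumes "smooth_on_open f S" "smooth_on_open g T" "f ` S \<subseteq> T"
  shows "smooth_on_open (\<lambda>x. g (f x)) S"
  using assms Ck_on_compose[of S T f] unfolding smooth_on_open_def by blast

lemma smooth_on_open_subset:
  "smooth_on_open f S \<Longrightarrow> open T \<Longrightarrow> T \<subseteq> S \<Longrightarrow> smooth_on_open f T"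
  unfolding smooth_on_open_def using Ck_on_subset by blast

lemma smooth_on_open_linear_compose:
  "bounded_linear h \<Longrightarrow> smooth_on_open f S \<Longrightarrow> smooth_on_open (\<lambda>x. h (f x)) S"
  unfolding smooth_on_open_def using Ck_on_linear_compose by blast

lemma smooth_on_open_linear: "bounded_linear h \<Longrightarrow> open S \<Longrightarrow> smooth_on_open h S"
  unfolding smooth_on_open_def using Ck_on_bounded_linear by blast

lemma smooth_on_open_const: "open S \<Longrightarrow> smooth_on_open (\<lambda>x. c) S"
  unfolding smooth_on_open_def using Ck_on_const by blast

lemma smooth_on_open_add:
  "smooth_on_open f S \<Longrightarrow> smooth_on_open g S \<Longrightarrow> smooth_on_open (\<lambda>x. f x + g x) S"
  unfolding smooth_on_open_def using Ck_on_add by blast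

lemma smooth_on_open_bilinear:
  "bounded_bilinear h \<Longrightarrow> smooth_on_open f S \<Longrightarrow> smooth_on_open g S
    \<Longrightarrow> smooth_on_open (\<lambda>x. h (f x) (g x)) S"
  unfolding smooth_on_open_def using Ck_on_bilinear by blast

lemma smooth_on_open_Pair:
  fixes f :: "'a::euclidean_space \<Rightarrow> 'b::euclidean_space" and g :: "'a \<Rightarrow> 'c::euclidean_space"
  assumes "smooth_on_open f S" "smooth_on_open g S"
  shows "smooth_on_open (\<lambda>x. (f x, g x)) S"
proof -
  have "bounded_linear (\<lambda>u :: 'b. (u, 0 :: 'c))" "bounded_linear (\<lambda>u :: 'c. (0 :: 'b, u))"
    by (intro bounded_linear_Pair bounded_linear_ident bounded_linear_zero)+
  then have "smooth_on_open (\<lambda>x. (f x, 0 :: 'c)) S" "smooth_on_open (\<lambda>x. (0 :: 'b, g x)) S"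
    using smooth_on_open_linear_compose assms by blast+
  then show ?thesis
    using smooth_on_open_add by fastforce
qed

lemma smooth_on_open_has_derivative:
  "smooth_on_open f S \<Longrightarrow> x \<in> S \<Longrightarrow> (f has_derivative frechet_derivative f (at x)) (at x)"
  unfolding smooth_on_open_def using Ck_on_Suc_has_derivative by blast

lemma smooth_on_open_continuous_on: "smooth_on_open f S \<Longrightarrow> continuous_on S f"
  unfolding smooth_on_open_def by (metis Ck_on.simps(1))

lemma smooth_on_open_frechet_derivative:
  "smooth_on_open f S \<Longrightarrow> smooth_on_open (\<lambda>x. frechet_derivative f (at x) v) S"
  unfolding smooth_on_open_def by (metis Ck_on.simps(2))

lemma smooth_map_on_if_smooth_on_open: "smooth_on_open F W \<Longrightarrow> S \<subseteq> W \<Longrightarrow> smooth_map_on F S"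
  unfolding smooth_map_on_def by blast

text \<open>The error r(y) (g(y) - g(x)) is a term of order |y - x| times a term tending to 0.
  Continuity of \<open>g\<close> thus suffices, so products can be differentiated whose second
  factor is not known to be differentiable.\<close>

lemma has_derivative_mult_vanishing:
  fixes r :: "'a::real_normed_vector \<Rightarrow> real" and g :: "'a \<Rightarrow> 'b::real_normed_vector"
  assumes r: "(r has_derivative r') (at x)" "r x = 0" and g: "isCont g x"
  shows "((\<lambda>y. r y *\<^sub>R g y) has_derivative (\<lambda>v. r' v *\<^sub>R g x)) (at x)"
proof -
  have r'lin: "bounded_linear r'" using r(1) has_derivative_bounded_linear by blast
  then obtain K where K: "\<And>v. norm (r' v) \<le> norm v * K" using bounded_linear.bounded by blast
  have "((\<lambda>y. r y *\<^sub>R g x) has_derivative (\<lambda>v. r' v *\<^sub>R g x)) (at x)"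
    using has_derivative_scaleR_left[OF r(1)] .
  moreover have "((\<lambda>y. r y *\<^sub>R (g y - g x)) has_derivative (\<lambda>v. 0)) (at x)"
  proof -
    have 1: "((\<lambda>y. (r y - r x - r' (y - x)) /\<^sub>R norm (y - x)) \<longlongrightarrow> 0) (at x)"
      using r(1) by (simp add: has_derivative_at_within)
    have lim: "((\<lambda>y. norm ((r y - r x - r' (y - x)) /\<^sub>R norm (y - x)) + K) \<longlongrightarrow> 0 + K) (at x)"
      using tendsto_norm_zero[OF 1] by (intro tendsto_intros)
    have g0: "((\<lambda>y. norm (g y - g x)) \<longlongrightarrow> 0) (at x)"
      using g by (metis LIM_zero isCont_def tendsto_norm_zero)
    have prod: "((\<lambda>y. (norm ((r y - r x - r' (y - x)) /\<^sub>R norm (y - x)) + K) * norm (g y - g x)) \<longlongrightarrow> 0) (at x)"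
      using tendsto_mult[OF lim g0] by simp
    have "((\<lambda>y. (r y *\<^sub>R (g y - g x)) /\<^sub>R norm (y - x)) \<longlongrightarrow> 0) (at x)"
    proof (rule Lim_null_comparison[OF _ prod])
      show "\<forall>\<^sub>F y in at x. norm (inverse (norm (y - x)) *\<^sub>R r y *\<^sub>R (g y - g x))
          \<le> (norm ((r y - r x - r' (y - x)) /\<^sub>R norm (y - x)) + K) * norm (g y - g x)"
        unfolding eventually_at
      proof (intro exI[of _ 1] conjI ballI impI)
        fix y assume y: "y \<noteq> x \<and> dist y x < 1"
        let ?n = "norm (y - x)"
        have n: "?n > 0" using y by simp
        have "\<bar>r y\<bar> \<le> \<bar>r y - r x - r' (y - x)\<bar> + \<bar>r' (y - x)\<bar>" using r(2) by linarith
        also have "\<bar>r' (y - x)\<bar> \<le> ?n * K" using K[of "y - x"] by simp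
        finally have le: "\<bar>r y\<bar> \<le> \<bar>r y - r x - r' (y - x)\<bar> + ?n * K" by simp
        have "\<bar>r y\<bar> / ?n \<le> (\<bar>r y - r x - r' (y - x)\<bar> + ?n * K) / ?n"
          by (rule divide_right_mono[OF le]) simp
        also have "\<dots> = \<bar>r y - r x - r' (y - x)\<bar> / ?n + K" using n by (simp add: add_divide_distrib)
        finally have "\<bar>r y\<bar> / ?n \<le> \<bar>r y - r x - r' (y - x)\<bar> / ?n + K" .
        then have "\<bar>r y\<bar> / ?n * norm (g y - g x) \<le> (\<bar>r y - r x - r' (y - x)\<bar> / ?n + K) * norm (g y - g x)"
          by (intro mult_right_mono) auto
        then show "norm (inverse ?n *\<^sub>R r y *\<^sub>R (g y - g x))
          \<le> (norm ((r y - r x - r' (y - x)) /\<^sub>R ?n) + K) * norm (g y - g x)"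
          by (simp add: divide_inverse mult_ac abs_mult)
      qed simp
    qed
    then show ?thesis
      by (simp add: has_derivative_at_within r(2))
  qed
  ultimately have "((\<lambda>y. r y *\<^sub>R g x + r y *\<^sub>R (g y - g x)) has_derivative (\<lambda>v. r' v *\<^sub>R g x + 0)) (at x)"
    by (rule has_derivative_add)
  then show ?thesis by (simp add: algebra_simps)
qed

text \<open>Inversion is smooth because the derivative of the inverses \<open>N\<close> is \<open>- N \<circ> M' \<circ> N\<close>.\<close>

locale inverse_family =
  fixes M N :: "'a::euclidean_space \<Rightarrow> 'b::euclidean_space \<Rightarrow> 'b" and S :: "'a set"
  assumes S: "open S"
    and M_linear: "\<And>x. x \<in> S \<Longrightarrow> linear (M x)"
    and MN: "\<And>x w. x \<in> S \<Longrightarrow> M x (N x w) = w"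
    and NM: "\<And>x w. x \<in> S \<Longrightarrow> N x (M x w) = w"
begin

lemma N_linear:
  assumes x: "x \<in> S"
  shows "linear (N x)"
proof (rule linearI)
  fix u v and c :: real
  have "M x (N x u + N x v) = u + v" "M x (c *\<^sub>R N x u) = c *\<^sub>R u"
    using linear_add[OF M_linear[OF x]] linear_scale[OF M_linear[OF x]] MN[OF x] by simp_all
  then show "N x (u + v) = N x u + N x v" "N x (c *\<^sub>R u) = c *\<^sub>R N x u"
    using NM[OF x] by metis+
qed

text \<open>For \<open>y\<close> near \<open>x\<close> the operators \<open>M y\<close> are bounded
  below uniformly. Applied to N y w - N x w, whose image w - M y (N x w) tends to 0, this bound
  gives the limit.\<close>

lemma N_continuous:
  assumes M: "\<And>v. continuous_on S (\<lambda>x. M x v)" and x: "x \<in> S"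
  shows "isCont (\<lambda>x. N x w) x"
proof -
  obtain C where C: "C > 0" "\<And>u. norm (N x u) \<le> C * norm u"
    using linear_bounded_pos[OF N_linear[OF x]] by blast
  have Mc: "((\<lambda>y. M y v) \<longlongrightarrow> M x v) (at x)" for v
    using M[of v] x S by (metis at_within_open continuous_on_def)
  have "((\<lambda>y. \<Sum>b\<in>Basis. norm (M y b - M x b)) \<longlongrightarrow> (\<Sum>b\<in>(Basis::'b set). 0)) (at x)"
    by (intro tendsto_sum tendsto_norm_zero LIM_zero Mc)
  then have "((\<lambda>y. \<Sum>b\<in>Basis. norm (M y b - M x b)) \<longlongrightarrow> 0) (at x)" by simp
  \<comment> \<open>This closeness lets \<open>M y\<close> deviate from \<open>M x\<close> by at
    most half of the lower bound 1 / C, so the bound 1 / (2 C) remains.\<close>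
  then have "\<forall>\<^sub>F y in at x. (\<Sum>b\<in>Basis. norm (M y b - M x b)) < 1 / (2 * C)"
    using C(1) by (auto dest!: order_tendstoD(2)[of _ _ _ "1 / (2 * C)"])
  moreover have "\<forall>\<^sub>F y in at x. y \<in> S"
    using S x eventually_at_topological by blast
  ultimately have bound: "\<forall>\<^sub>F y in at x. norm (N y w - N x w) \<le> 2 * C * norm (w - M y (N x w))"
  proof eventually_elim
    case (elim y)
    have key: "norm u \<le> 2 * C * norm (M y u)" for u
    proof -
      have lin: "linear (\<lambda>u. M y u - M x u)"
        using linear_compose_sub[OF M_linear[OF elim(2)] M_linear[OF x]] .
      have "norm (M y u - M x u) \<le> (\<Sum>b\<in>Basis. norm ((u \<bullet> b) *\<^sub>R (M y b - M x b)))"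
        by (subst linear_basis_expansion[OF lin]) (rule norm_sum)
      also have "\<dots> \<le> (\<Sum>b\<in>Basis. norm u * norm (M y b - M x b))"
        by (intro sum_mono) (simp add: Basis_le_norm mult_right_mono)
      also have "\<dots> \<le> norm u * (1 / (2 * C))"
        unfolding sum_distrib_left[symmetric] by (intro mult_left_mono) (use elim in auto)
      finally have "C * norm (M y u - M x u) \<le> norm u / 2"
        using C(1) by (simp add: field_simps)
      moreover have "norm u \<le> C * norm (M x u)" using C(2)[of "M x u"] NM[OF x] by simp
      moreover have "C * norm (M x u) \<le> C * (norm (M y u) + norm (M y u - M x u))"
        using C(1) norm_triangle_ineq4[of "M y u" "M y u - M x u"] by (intro mult_left_mono) auto
      ultimately show ?thesis by (simp add: algebra_simps)
    qed
    have "M y (N y w - N x w) = w - M y (N x w)"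
      using linear_diff[OF M_linear[OF elim(2)]] MN[OF elim(2)] by simp
    then show ?case using key[of "N y w - N x w"] by simp
  qed
  have "((\<lambda>y. 2 * C * norm (w - M y (N x w))) \<longlongrightarrow> 2 * C * norm (w - M x (N x w))) (at x)"
    by (intro tendsto_intros Mc)
  then have "((\<lambda>y. 2 * C * norm (w - M y (N x w))) \<longlongrightarrow> 0) (at x)"
    using MN[OF x] by simp
  then have "((\<lambda>y. N y w - N x w) \<longlongrightarrow> 0) (at x)"
    using bound by (rule Lim_null_comparison[rotated])
  then show ?thesis unfolding isCont_def by (rule LIM_zero_cancel)
qed

text \<open>N y w = N x w + N y (w - M y (N x w)), and the argument of the last \<open>N y\<close>
  vanishes at y = x. The product rule at a zero applies to each of its coordinates, although only
  continuity of \<open>N\<close> is known.\<close>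

lemma N_has_derivative:
  assumes M: "\<And>v. continuous_on S (\<lambda>x. M x v)" and x: "x \<in> S"
    and D: "((\<lambda>y. M y (N x w)) has_derivative D) (at x)"
  shows "((\<lambda>y. N y w) has_derivative (\<lambda>h. - N x (D h))) (at x)"
proof -
  let ?r = "\<lambda>y. w - M y (N x w)"
  have r: "(?r has_derivative (\<lambda>h. - D h)) (at x)"
    using has_derivative_diff[OF has_derivative_const D] by simp
  have "((\<lambda>y. (?r y \<bullet> b) *\<^sub>R N y b) has_derivative (\<lambda>h. (- D h \<bullet> b) *\<^sub>R N x b)) (at x)" for b
    by (rule has_derivative_mult_vanishing)
      (use has_derivative_inner_left[OF r] MN[OF x] N_continuous[OF M x] in auto)
  then have "((\<lambda>y. \<Sum>b\<in>Basis. (?r y \<bullet> b) *\<^sub>R N y b) has_derivative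
      (\<lambda>h. \<Sum>b\<in>Basis. (- D h \<bullet> b) *\<^sub>R N x b)) (at x)"
    by (intro has_derivative_sum)
  then have "((\<lambda>y. N x w + (\<Sum>b\<in>Basis. (?r y \<bullet> b) *\<^sub>R N y b)) has_derivative
      (\<lambda>h. 0 + (\<Sum>b\<in>Basis. (- D h \<bullet> b) *\<^sub>R N x b))) (at x)"
    by (intro has_derivative_add has_derivative_const)
  moreover have "(\<Sum>b\<in>Basis. (- D h \<bullet> b) *\<^sub>R N x b) = - N x (D h)" for h
    using linear_basis_expansion[OF N_linear[OF x], of "- D h"] linear_neg[OF N_linear[OF x]] by simp
  ultimately have D': "((\<lambda>y. N x w + (\<Sum>b\<in>Basis. (?r y \<bullet> b) *\<^sub>R N y b)) has_derivative
      (\<lambda>h. - N x (D h))) (at x)" by simp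
  have eq: "N x w + (\<Sum>b\<in>Basis. (?r y \<bullet> b) *\<^sub>R N y b) = N y w" if "y \<in> S" for y
    using linear_basis_expansion[OF N_linear[OF that], of "?r y"]
      linear_diff[OF N_linear[OF that], of w] NM[OF that] by (simp add: algebra_simps)
  show ?thesis
    by (rule has_derivative_transform_within_open[OF D' S x]) (use eq in auto)
qed

text \<open>The derivative of \<open>N\<close> is built from \<open>N\<close> and the derivative of
  \<open>M\<close>, so the order of smoothness grows by induction.\<close>

lemma N_Ck_on: "(\<And>v. Ck_on k (\<lambda>x. M x v) S) \<Longrightarrow> Ck_on k (\<lambda>x. N x w) S"
proof (induction k arbitrary: w)
  case 0
  then show ?case
    using N_continuous by (simp add: continuous_at_imp_continuous_on)
next
  case (Suc k)
  have Mk: "Ck_on k (\<lambda>x. M x v) S" for v using Suc.prems by (rule Ck_on_SucD)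
  have Nk: "Ck_on k (\<lambda>x. N x v) S" for v by (rule Suc.IH[OF Mk])
  have cont: "continuous_on S (\<lambda>x. M x v)" for v
    using Suc.prems[of v] by (metis Ck_on_Suc_has_derivative continuous_at_imp_continuous_on has_derivative_continuous)
  let ?D = "\<lambda>x v. frechet_derivative (\<lambda>y. M y v) (at x)"
  have DM: "((\<lambda>y. M y v) has_derivative ?D x v) (at x)" if "x \<in> S" for x v
    using Ck_on_Suc_has_derivative[OF Suc.prems that] .
  \<comment> \<open>The derivative - N x (D (N x w) h) has moving arguments in both places; a double
    expansion over \<open>Basis\<close> leaves fixed vectors \<open>b\<close> and
    \<open>c\<close>.\<close>
  let ?E = "\<lambda>x h. \<Sum>b\<in>Basis. \<Sum>c\<in>Basis. (N x w \<bullet> b) *\<^sub>R (?D x b h \<bullet> c) *\<^sub>R (- N x c)"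
  have E: "?E x h = - N x (?D x (N x w) h)" if x: "x \<in> S" for x h
  proof -
    let ?u = "N x w"
    have "((\<lambda>y. \<Sum>b\<in>Basis. (?u \<bullet> b) *\<^sub>R M y b) has_derivative
        (\<lambda>h. \<Sum>b\<in>Basis. (?u \<bullet> b) *\<^sub>R ?D x b h)) (at x)"
      by (intro has_derivative_sum has_derivative_scaleR_right DM[OF x])
    then have "((\<lambda>y. M y ?u) has_derivative (\<lambda>h. \<Sum>b\<in>Basis. (?u \<bullet> b) *\<^sub>R ?D x b h)) (at x)"
      by (rule has_derivative_transform_within_open[OF _ S x])
        (use linear_basis_expansion[OF M_linear, of _ ?u] in auto)
    from fun_cong[OF frechet_derivative_at[OF this], of h]
    have D_eq: "?D x ?u h = (\<Sum>b\<in>Basis. (?u \<bullet> b) *\<^sub>R ?D x b h)"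
      by (rule sym)
    have "N x (?D x ?u h) = (\<Sum>b\<in>Basis. (?u \<bullet> b) *\<^sub>R N x (?D x b h))"
      unfolding D_eq linear_sum[OF N_linear[OF x]] linear_scale[OF N_linear[OF x]] ..
    also have "\<dots> = (\<Sum>b\<in>Basis. \<Sum>c\<in>Basis. (?u \<bullet> b) *\<^sub>R (?D x b h \<bullet> c) *\<^sub>R N x c)"
    proof -
      have NE: "N x (?D x b h) = (\<Sum>c\<in>Basis. (?D x b h \<bullet> c) *\<^sub>R N x c)" for b
        by (rule linear_basis_expansion[OF N_linear[OF x]])
      show ?thesis unfolding NE scaleR_sum_right ..
    qed
    finally show ?thesis by (simp add: sum_negf)
  qed
  show ?case
  proof (rule Ck_on_SucI[OF S])
    show "((\<lambda>y. N y w) has_derivative ?E x) (at x)" if "x \<in> S" for x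
      unfolding E[OF that] by (rule N_has_derivative[OF cont that DM[OF that]])
    show "Ck_on k (\<lambda>x. ?E x h) S" for h
    proof (intro Ck_on_sum[OF S] Ck_on_bilinear[OF bounded_bilinear_scaleR S])
      fix b c :: 'b
      show "Ck_on k (\<lambda>x. N x w \<bullet> b) S"
        by (rule Ck_on_linear_compose[OF bounded_linear_inner_left S Nk])
      show "Ck_on k (\<lambda>x. ?D x b h \<bullet> c) S"
        by (rule Ck_on_linear_compose[OF bounded_linear_inner_left S]) (use Suc.prems in simp)
      show "Ck_on k (\<lambda>x. - N x c) S"
        by (rule Ck_on_linear_compose[OF bounded_linear_minus[OF bounded_linear_ident] S Nk])
    qed
  qed
qed

end

section \<open>Submanifolds\<close>

text \<open>The inverse function theorem gives a differentiable inverse whose derivative at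
  \<open>y\<close> is the inverse of the derivative of \<open>f\<close> at \<open>g y\<close>. If
  \<open>g\<close> has order k, so has that derivative by \<open>inverse_family\<close>, and
  \<open>g\<close> has order k + 1.\<close>

lemma smooth_local_inverse:
  fixes f :: "'a::euclidean_space \<Rightarrow> 'a"
  assumes f: "smooth_on_open f U" and x0: "x0 \<in> U" and inj: "inj (frechet_derivative f (at x0))"
  obtains U' V g where "open U'" "U' \<subseteq> U" "x0 \<in> U'" "open V" "homeomorphism U' V f g"
    "smooth_on_open g V"
proof -
  define D where "D x = frechet_derivative f (at x)" for x
  have U: "open U" using f by (simp add: smooth_on_open_def)
  have der: "(f has_derivative D x) (at x)" if "x \<in> U" for x
    using smooth_on_open_has_derivative[OF f that] by (simp add: D_def)
  have bl: "bounded_linear (D x)" if "x \<in> U" for x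
    using der[OF that] has_derivative_bounded_linear by blast
  define f' where "f' x = Blinfun (D x)" for x
  have f': "blinfun_apply (f' x) = D x" if "x \<in> U" for x
    using bl[OF that] by (simp add: f'_def bounded_linear_Blinfun_apply)
  have cont: "continuous_on U f'"
  proof (rule continuous_on_blinfun_componentwise)
    fix i :: 'a
    have "continuous_on U (\<lambda>x. D x i)"
      unfolding D_def by (rule smooth_on_open_continuous_on[OF smooth_on_open_frechet_derivative[OF f]])
    then show "continuous_on U (\<lambda>x. blinfun_apply (f' x) i)"
      using f' by (simp cong: continuous_on_cong)
  qed
  have lin0: "linear (D x0)" using bl[OF x0] bounded_linear.linear by blast
  obtain h where h: "linear h" "h \<circ> D x0 = id"
    using linear_injective_left_inverse[OF lin0] inj unfolding D_def by blast
  have comp: "Blinfun h o\<^sub>L f' x0 = id_blinfun"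
    using h f'[OF x0] linear_conv_bounded_linear[of h]
    by (intro blinfun_eqI) (simp add: bounded_linear_Blinfun_apply fun_eq_iff)
  have der': "(f has_derivative blinfun_apply (f' x)) (at x)" if "x \<in> U" for x
    using der f' that by simp
  obtain U' V and g :: "'a \<Rightarrow> 'a" and g' :: "'a \<Rightarrow> 'a \<Rightarrow> 'a" where *: "open U'" "U' \<subseteq> U" "x0 \<in> U'" "open V" "f x0 \<in> V"
      "homeomorphism U' V f g"
    and g: "\<And>y. y \<in> V \<Longrightarrow> (g has_derivative (g' y)) (at y)"
    and g': "\<And>y. y \<in> V \<Longrightarrow> g' y = inv_into UNIV (blinfun_apply (f' (g y)))"
    and bij: "\<And>y. y \<in> V \<Longrightarrow> bij (blinfun_apply (f' (g y)))"
  proof (rule inverse_function_theorem[OF U der' cont x0 comp], goal_cases)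
    case (2 U' V g g')
    show ?case by (rule 2(1)[of U' V g g']) (use 2 in auto)
  qed
  have gV: "g y \<in> U'" if "y \<in> V" for y
    using that *(6) by (auto simp: homeomorphism_def)
  then have gU: "g y \<in> U" if "y \<in> V" for y using that *(2) by blast
  have "D (g y) (g' y w) = w" "g' y (D (g y) w) = w" "linear (D (g y))" if "y \<in> V" for y w
    using g'[OF that] bij[OF that] f'[OF gU[OF that]] bl[OF gU[OF that]]
    by (simp_all add: bij_is_inj bij_is_surj surj_f_inv_f linear_conv_bounded_linear)
  then interpret inverse_family "\<lambda>y. D (g y)" g' V
    using *(4) by (intro inverse_family.intro)
  have "Ck_on k g V" for k
  proof (induction k)
    case 0
    then show ?case using *(6) by (simp add: homeomorphism_def)
  next
    case (Suc k)
    show ?case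
    proof (rule Ck_on_SucI[OF *(4) g])
      show "Ck_on k (\<lambda>x. g' x v) V" for v
      proof (rule N_Ck_on)
        show "Ck_on k (\<lambda>x. D (g x) v) V" for v
          using Ck_on_compose[OF *(4) U _ Suc.IH, of "\<lambda>x. D x v"] gU
            smooth_on_open_frechet_derivative[OF f, of v]
          unfolding D_def smooth_on_open_def by blast
      qed
    qed
  qed
  then have "smooth_on_open g V" using *(4) by (simp add: smooth_on_open_def)
  with * show ?thesis using that by blast
qed

section \<open>Smooth maps on subsets, diffeomorphisms and charts\<close>

lemma smooth_map_on_cong:
  "smooth_map_on f S \<Longrightarrow> (\<And>x. x \<in> S \<Longrightarrow> f x = g x) \<Longrightarrow> smooth_map_on g S"
  unfolding smooth_map_on_def by (metis Int_iff)

lemma smooth_map_on_subset: "smooth_map_on f S \<Longrightarrow> T \<subseteq> S \<Longrightarrow> smooth_map_on f T"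
  unfolding smooth_map_on_def by (meson Int_iff subsetD)

lemma smooth_map_on_imp_continuous_on: "smooth_map_on f S \<Longrightarrow> continuous_on S f"
  unfolding continuous_on_eq_continuous_within
proof
  fix x assume f: "smooth_map_on f S" and x: "x \<in> S"
  then obtain W F where W: "x \<in> W" "smooth_on_open F W" "\<forall>y \<in> W \<inter> S. F y = f y"
    unfolding smooth_map_on_def by blast
  have W': "open W" using W(2) by (simp add: smooth_on_open_def)
  have "isCont F x" using W(1,2) W' smooth_on_open_continuous_on continuous_on_eq_continuous_at by blast
  then have "(F \<longlongrightarrow> f x) (at x within S)"
    using W(1,3) x by (metis IntI continuous_within continuous_at_imp_continuous_at_within)
  moreover have "\<forall>\<^sub>F y in at x within S. F y = f y"
    using W(1,3) W' unfolding eventually_at_topological by blast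
  ultimately have "(f \<longlongrightarrow> f x) (at x within S)"
    using tendsto_cong by blast
  then show "continuous (at x within S) f" by (simp add: continuous_within)
qed

lemma diffeomorphism_betweenI:
  assumes "\<And>x. x \<in> S \<Longrightarrow> f x \<in> T \<and> g (f x) = x" "\<And>y. y \<in> T \<Longrightarrow> g y \<in> S \<and> f (g y) = y"
    and "smooth_map_on f S" "smooth_map_on g T"
  shows "diffeomorphism_between f S T"
proof -
  have b: "bij_betw f S T"
    using assms(1,2) by (intro bij_betw_byWitness[where f' = g]) auto
  have "g y = inv_into S f y" if "y \<in> T" for y
    using assms(2)[OF that] b by (metis bij_betw_inv_into_left)
  then show ?thesis
    using b assms(3) smooth_map_on_cong[OF assms(4)] by (simp add: diffeomorphism_between_def)
qed

lemma diffeomorphism_betweenE: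
  assumes "diffeomorphism_between f S T"
  obtains g where "\<And>x. x \<in> S \<Longrightarrow> f x \<in> T \<and> g (f x) = x" "\<And>y. y \<in> T \<Longrightarrow> g y \<in> S \<and> f (g y) = y"
    "smooth_map_on f S" "smooth_map_on g T"
proof (rule that[of "inv_into S f"])
  have b: "bij_betw f S T" using assms by (simp add: diffeomorphism_between_def)
  show "f x \<in> T \<and> inv_into S f (f x) = x" if "x \<in> S" for x
    using b that by (metis bij_betwE bij_betw_inv_into_left)
  show "inv_into S f y \<in> S \<and> f (inv_into S f y) = y" if "y \<in> T" for y
    using b that by (metis bij_betw_def f_inv_into_f inv_into_into)
qed (use assms in \<open>auto simp: diffeomorphism_between_def\<close>)

definition submanifold_at :: "nat \<Rightarrow> 'a::euclidean_space set \<Rightarrow> 'a \<Rightarrow> bool" where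
  "submanifold_at d S p \<longleftrightarrow>
     (\<exists>W W' (\<phi> :: 'a \<Rightarrow> 'a) L. open W \<and> p \<in> W \<and> open W' \<and> diffeomorphism_between \<phi> W W' \<and>
        subspace L \<and> dim L = d \<and> \<phi> ` (W \<inter> S) = W' \<inter> L)"

lemma smooth_submanifold_iff: "smooth_submanifold d S \<longleftrightarrow> (\<forall>p \<in> S. submanifold_at d S p)"
  by (simp add: smooth_submanifold_def submanifold_at_def)

lemma submanifold_atE:
  fixes S :: "'a::euclidean_space set"
  assumes "submanifold_at d S p"
  obtains W W' and \<phi> :: "'a \<Rightarrow> 'a" and L where "open W" "p \<in> W" "open W'" "diffeomorphism_between \<phi> W W'"
    "subspace L" "dim L = d" "\<phi> ` (W \<inter> S) = W' \<inter> L"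
proof -
  from assms[unfolded submanifold_at_def] show ?thesis
    by (elim exE conjE) (rule that)
qed

lemma submanifold_atI:
  fixes S :: "'a::euclidean_space set" and \<phi> :: "'a \<Rightarrow> 'a"
  assumes "open W" "p \<in> W" "open W'" "diffeomorphism_between \<phi> W W'"
    "subspace L" "dim L = d" "\<phi> ` (W \<inter> S) = W' \<inter> L"
  shows "submanifold_at d S p"
  using assms unfolding submanifold_at_def by blast

text \<open>Submanifold charts flatten the set, whereas the maps constructed below parametrize it.
  The inverse of such a parametrization, translated so that \<open>z0\<close> becomes the origin, is
  a flattening chart.\<close>

lemma submanifold_at_chart:
  fixes \<Psi> :: "'a::euclidean_space \<Rightarrow> 'a"
  assumes \<Psi>: "smooth_on_open \<Psi> U" and z0: "z0 \<in> U" and inj: "inj (frechet_derivative \<Psi> (at z0))"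
    and L: "subspace L" and S: "\<And>z. z \<in> U \<Longrightarrow> \<Psi> z \<in> S \<longleftrightarrow> z - z0 \<in> L"
  shows "submanifold_at (dim L) S (\<Psi> z0)"
proof -
  obtain U' V g where *: "open U'" "U' \<subseteq> U" "z0 \<in> U'" "open V" "homeomorphism U' V \<Psi> g"
    "smooth_on_open g V"
    by (rule smooth_local_inverse[OF \<Psi> z0 inj])
  define W' where "W' = {w. w + z0 \<in> U'}"
  define \<phi> where "\<phi> x = g x - z0" for x
  have h: "\<And>z. z \<in> U' \<Longrightarrow> \<Psi> z \<in> V \<and> g (\<Psi> z) = z" "\<And>y. y \<in> V \<Longrightarrow> g y \<in> U' \<and> \<Psi> (g y) = y"
    using *(5) by (auto simp: homeomorphism_def)
  have W': "open W'"
    using open_vimage[OF *(1), of "\<lambda>w. w + z0"] by (simp add: W'_def vimage_def continuous_intros)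
  have "diffeomorphism_between \<phi> V W'"
  proof (rule diffeomorphism_betweenI[where g = "\<lambda>w. \<Psi> (w + z0)"])
    have "smooth_on_open (\<lambda>x. g x + (- z0)) V"
      by (intro smooth_on_open_add smooth_on_open_const *)
    then show "smooth_map_on \<phi> V"
      unfolding \<phi>_def by (intro smooth_map_on_if_smooth_on_open) auto
    have "smooth_on_open (\<lambda>w. w + z0) W'"
      by (intro smooth_on_open_add smooth_on_open_const smooth_on_open_linear W' bounded_linear_ident)
    then have "smooth_on_open (\<lambda>w. \<Psi> (w + z0)) W'"
      by (rule smooth_on_open_compose[OF _ \<Psi>]) (use *(2) in \<open>auto simp: W'_def\<close>)
    then show "smooth_map_on (\<lambda>w. \<Psi> (w + z0)) W'"
      by (intro smooth_map_on_if_smooth_on_open) auto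
  qed (use h in \<open>auto simp: \<phi>_def W'_def\<close>)
  moreover have "\<phi> ` (V \<inter> S) = W' \<inter> L"
  proof (intro equalityI subsetI)
    fix w assume "w \<in> \<phi> ` (V \<inter> S)"
    then obtain x where x: "x \<in> V" "x \<in> S" "w = g x - z0" by (auto simp: \<phi>_def)
    then have "g x \<in> U" "\<Psi> (g x) \<in> S" using h(2)[of x] *(2) by auto
    then show "w \<in> W' \<inter> L" using S[of "g x"] x h(2)[of x] by (simp add: W'_def)
  next
    fix w assume w: "w \<in> W' \<inter> L"
    then have "w + z0 \<in> U'" by (simp add: W'_def)
    then have "\<Psi> (w + z0) \<in> V \<inter> S" "\<phi> (\<Psi> (w + z0)) = w"
      using h(1) S[of "w + z0"] w *(2) by (auto simp: \<phi>_def)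
    then show "w \<in> \<phi> ` (V \<inter> S)" by (metis imageI)
  qed
  ultimately show ?thesis
    unfolding submanifold_at_def using *(3,4) h(1) W' L by blast
qed

lemma diffeomorphism_between_open_subset:
  assumes "diffeomorphism_between f S T" and "open T" and "open Q"
  shows "diffeomorphism_between f (S \<inter> Q) (f ` (S \<inter> Q))" and "open (f ` (S \<inter> Q))"
proof -
  obtain g where g: "\<And>x. x \<in> S \<Longrightarrow> f x \<in> T \<and> g (f x) = x" "\<And>y. y \<in> T \<Longrightarrow> g y \<in> S \<and> f (g y) = y"
    "smooth_map_on f S" "smooth_map_on g T"
    using diffeomorphism_betweenE[OF assms(1)] by blast
  show "diffeomorphism_between f (S \<inter> Q) (f ` (S \<inter> Q))"
    by (rule diffeomorphism_betweenI[where g = g])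
      (use g(1,2) smooth_map_on_subset[OF g(3), of "S \<inter> Q"]
        smooth_map_on_subset[OF g(4), of "f ` (S \<inter> Q)"] in auto)
  have "f ` (S \<inter> Q) = T \<inter> g -` Q"
    using g(1,2) by force
  then show "open (f ` (S \<inter> Q))"
    using continuous_open_preimage[OF smooth_map_on_imp_continuous_on[OF g(4)] assms(2,3)] by simp
qed

lemma smooth_submanifold_openin:
  fixes S :: "'a::euclidean_space set"
  assumes "smooth_submanifold d S" "openin (top_of_set S) T"
  shows "smooth_submanifold d T"
  unfolding smooth_submanifold_iff
proof
  fix p assume p: "p \<in> T"
  obtain Q where Q: "open Q" "T = S \<inter> Q" using assms(2) by (auto simp: openin_open)
  obtain W W' and \<phi> :: "'a \<Rightarrow> 'a" and L where *: "open W" "p \<in> W" "open W'" "diffeomorphism_between \<phi> W W'"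
    "subspace L" "dim L = d" "\<phi> ` (W \<inter> S) = W' \<inter> L"
    by (rule submanifold_atE[OF smooth_submanifold_iff[THEN iffD1, OF assms(1), rule_format, of p]]) (use p Q(2) in auto)
  have inj: "inj_on \<phi> W" using *(4) by (simp add: diffeomorphism_between_def bij_betw_def)
  have sub: "\<phi> ` W \<subseteq> W'" using *(4) by (auto simp: diffeomorphism_between_def bij_betw_def)
  have "\<phi> ` ((W \<inter> Q) \<inter> T) = \<phi> ` (W \<inter> Q) \<inter> L"
    using *(7) sub unfolding Q(2) by (blast dest: inj_onD[OF inj])
  then show "submanifold_at d T p"
    by (intro submanifold_atI[OF _ _ _ diffeomorphism_between_open_subset(1)[OF *(4,3) Q(1)] *(5,6)])
      (use diffeomorphism_between_open_subset(2)[OF *(4,3) Q(1)] *(1,2) Q p in auto)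
qed

lemma smooth_submanifold_subspace:
  fixes L :: "'a::euclidean_space set"
  assumes "subspace L" shows "smooth_submanifold (dim L) L"
  unfolding smooth_submanifold_iff
proof
  fix p assume "p \<in> L"
  have "smooth_map_on (\<lambda>x. x) (UNIV :: 'a set)"
    by (intro smooth_map_on_if_smooth_on_open[of _ UNIV] smooth_on_open_linear bounded_linear_ident) auto
  then have "diffeomorphism_between (\<lambda>x. x) UNIV (UNIV :: 'a set)"
    by (intro diffeomorphism_betweenI[where g = "\<lambda>x. x"]) auto
  then show "submanifold_at (dim L) L p"
    using assms by (intro submanifold_atI[where W = UNIV and W' = UNIV and \<phi> = "\<lambda>x. x" and L = L]) auto
qed

lemma smooth_map_on_map_prod:
  assumes "smooth_map_on f S" "smooth_map_on g T"
  shows "smooth_map_on (map_prod f g) (S \<times> T)"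
  unfolding smooth_map_on_def
proof
  fix p assume "p \<in> S \<times> T"
  then obtain F W G V where *: "fst p \<in> W" "smooth_on_open F W" "\<forall>x \<in> W \<inter> S. F x = f x"
    "snd p \<in> V" "smooth_on_open G V" "\<forall>x \<in> V \<inter> T. G x = g x"
    using assms unfolding smooth_map_on_def by fastforce
  have op: "open (W \<times> V)" using *(2,5) by (simp add: smooth_on_open_def open_Times)
  have "smooth_on_open (\<lambda>x. F (fst x)) (W \<times> V)" "smooth_on_open (\<lambda>x. G (snd x)) (W \<times> V)"
    by (rule smooth_on_open_compose[OF smooth_on_open_linear *(2)] smooth_on_open_compose[OF smooth_on_open_linear *(5)],
        auto intro: op bounded_linear_fst bounded_linear_snd)+
  then have "smooth_on_open (\<lambda>x. (F (fst x), G (snd x))) (W \<times> V)"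
    by (rule smooth_on_open_Pair)
  then show "\<exists>W F. p \<in> W \<and> smooth_on_open F W \<and> (\<forall>x\<in>W \<inter> S \<times> T. F x = map_prod f g x)"
    using * by (intro exI[of _ "W \<times> V"] exI[of _ "\<lambda>x. (F (fst x), G (snd x))"])
      (auto simp: map_prod_def mem_Times_iff)
qed

lemma smooth_submanifold_Times:
  fixes S :: "'a::euclidean_space set" and T :: "'b::euclidean_space set"
  assumes "smooth_submanifold d S" "smooth_submanifold e T"
  shows "smooth_submanifold (d + e) (S \<times> T)"
  unfolding smooth_submanifold_iff
proof
  fix p assume "p \<in> S \<times> T"
  then have p: "fst p \<in> S" "snd p \<in> T" by auto
  obtain V V' and \<phi> :: "'a \<Rightarrow> 'a" and L where
    *: "open V" "fst p \<in> V" "open V'" "diffeomorphism_between \<phi> V V'"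
      "subspace L" "dim L = d" "\<phi> ` (V \<inter> S) = V' \<inter> L"
    by (rule submanifold_atE[OF smooth_submanifold_iff[THEN iffD1, OF assms(1), rule_format, OF p(1)]])
  obtain W W' and \<psi> :: "'b \<Rightarrow> 'b" and M where
    **: "open W" "snd p \<in> W" "open W'" "diffeomorphism_between \<psi> W W'"
      "subspace M" "dim M = e" "\<psi> ` (W \<inter> T) = W' \<inter> M"
    by (rule submanifold_atE[OF smooth_submanifold_iff[THEN iffD1, OF assms(2), rule_format, OF p(2)]])
  obtain f where f: "\<And>x. x \<in> V \<Longrightarrow> \<phi> x \<in> V' \<and> f (\<phi> x) = x" "\<And>y. y \<in> V' \<Longrightarrow> f y \<in> V \<and> \<phi> (f y) = y"
    "smooth_map_on \<phi> V" "smooth_map_on f V'"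
    using diffeomorphism_betweenE[OF *(4)] by blast
  obtain g where g: "\<And>x. x \<in> W \<Longrightarrow> \<psi> x \<in> W' \<and> g (\<psi> x) = x" "\<And>y. y \<in> W' \<Longrightarrow> g y \<in> W \<and> \<psi> (g y) = y"
    "smooth_map_on \<psi> W" "smooth_map_on g W'"
    using diffeomorphism_betweenE[OF **(4)] by blast
  have "diffeomorphism_between (map_prod \<phi> \<psi>) (V \<times> W) (V' \<times> W')"
    by (rule diffeomorphism_betweenI[where g = "map_prod f g"])
      (use f g in \<open>auto intro: smooth_map_on_map_prod\<close>)
  moreover have "map_prod \<phi> \<psi> ` ((V \<times> W) \<inter> (S \<times> T)) = (V' \<times> W') \<inter> (L \<times> M)"
    unfolding Times_Int_Times *(7)[symmetric] **(7)[symmetric]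
    by (auto simp: image_iff map_prod_def)
  ultimately show "submanifold_at (d + e) (S \<times> T) p"
    using * ** by (intro submanifold_atI[where W = "V \<times> W" and W' = "V' \<times> W'" and
          \<phi> = "map_prod \<phi> \<psi>" and L = "L \<times> M"])
      (auto simp: open_Times mem_Times_iff subspace_Times dim_Times)
qed

section \<open>Bounding the dimension of a submanifold\<close>

lemma smooth_map_on_open_differentiable:
  assumes "smooth_map_on f S" "open S" "x \<in> S"
  shows "f differentiable (at x)"
proof -
  obtain W F where W: "x \<in> W" "smooth_on_open F W" "\<forall>y \<in> W \<inter> S. F y = f y"
    using assms(1,3) unfolding smooth_map_on_def by blast
  have "open (W \<inter> S)" using W(2) assms(2) by (auto simp: smooth_on_open_def)
  then have "(f has_derivative frechet_derivative F (at x)) (at x)"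
    using has_derivative_transform_within_open[OF smooth_on_open_has_derivative[OF W(2,1)], of "W \<inter> S" f] W assms(3)
    by auto
  then show ?thesis by (auto simp: differentiable_def)
qed

text \<open>If \<open>N\<close> had larger dimension, then the product of an open piece of \<open>N\<close> with a
  complementary subspace would be a nonempty open set covered by differentiable images of
  lower-dimensional subspaces, hence negligible.\<close>

lemma submanifold_dim_le_if_covered:
  fixes N :: "'a::euclidean_space set" and f :: "'i \<Rightarrow> 'a \<Rightarrow> 'a"
  assumes N: "smooth_submanifold d N" and p: "p \<in> N" and Q: "open Q" "p \<in> Q" and I: "finite I"
    and T: "\<And>i. i \<in> I \<Longrightarrow> T i \<subseteq> P i \<and> subspace (P i) \<and> dim (P i) \<le> D \<and> f i differentiable_on (T i)"
    and cover: "N \<inter> Q \<subseteq> (\<Union>i\<in>I. f i ` T i)"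
  shows "d \<le> D"
proof (rule ccontr)
  assume "\<not> d \<le> D"
  then have dD: "D < d" by simp
  obtain W W' and \<phi> :: "'a \<Rightarrow> 'a" and L where *: "open W" "p \<in> W" "open W'" "diffeomorphism_between \<phi> W W'"
    "subspace L" "dim L = d" "\<phi> ` (W \<inter> N) = W' \<inter> L"
    by (rule submanifold_atE[OF smooth_submanifold_iff[THEN iffD1, OF N, rule_format, OF p]])
  have \<phi>smooth: "smooth_map_on \<phi> W" using *(4) by (simp add: diffeomorphism_between_def)
  define G where "G = \<phi> ` (W \<inter> Q)"
  have G: "open G" unfolding G_def by (rule diffeomorphism_between_open_subset(2)[OF *(4,3) Q(1)])
  have inj: "inj_on \<phi> W" using *(4) by (simp add: diffeomorphism_between_def bij_betw_def)
  have sub: "\<phi> ` W \<subseteq> W'" using *(4) by (auto simp: diffeomorphism_between_def bij_betw_def)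
  have GL: "G \<inter> L \<subseteq> \<phi> ` (W \<inter> (N \<inter> Q))"
  proof
    fix y assume y: "y \<in> G \<inter> L"
    then obtain x where x: "x \<in> W" "x \<in> Q" "y = \<phi> x" by (auto simp: G_def)
    then have "y \<in> W' \<inter> L" using sub y by auto
    then obtain x' where "x' \<in> W" "x' \<in> N" "y = \<phi> x'" using *(7) by (metis IntE imageE)
    then show "y \<in> \<phi> ` (W \<inter> (N \<inter> Q))" using x inj by (metis IntI image_eqI inj_onD)
  qed
  define Lc :: "'a set" where "Lc = {y. \<forall>x\<in>L. orthogonal x y}"
  have Lc: "subspace Lc" unfolding Lc_def by (rule subspace_orthogonal_to_vectors)
  have dimLc: "dim Lc + d = DIM('a)"
    using dim_subspace_orthogonal_to_vectors[OF *(5) subspace_UNIV subset_UNIV] *(6)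
    by (simp add: Lc_def)
  define E where "E = {x + y |x y. x \<in> G \<inter> L \<and> y \<in> Lc}"
  have "negligible E"
  proof -
    have "negligible {\<phi> (f i t) + y |t y. t \<in> T i \<and> f i t \<in> W \<and> y \<in> Lc}" if i: "i \<in> I" for i
    proof -
      note Ti = T[OF i]
      let ?PL = "P i \<times> Lc"
      have subPL: "subspace ?PL" using Ti Lc by (simp add: subspace_Times)
      have dPL: "dim ?PL < DIM('a)"
        using dim_Times[of "P i" Lc] Ti Lc dimLc dD by simp
      \<comment> \<open>The product \<open>?PL\<close> lives in a space of twice the dimension,
        where images of negligible sets need not be negligible. An isomorphic copy inside the
        original space has the right ambient dimension and is negligible there.\<close>
      then obtain R :: "'a set" where R: "subspace R" "dim R = dim ?PL"
        using choose_subspace_of_subspace[of "dim ?PL" "UNIV :: 'a set"] by (metis dim_UNIV less_imp_le span_UNIV)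
      obtain h where h: "linear h" "h ` R = ?PL"
        using subspace_isomorphism[OF R(1) subPL R(2)] by metis
      define R' where "R' = {r \<in> R. fst (h r) \<in> T i \<and> f i (fst (h r)) \<in> W}"
      let ?k = "\<lambda>r. \<phi> (f i (fst (h r))) + snd (h r)"
      have hb: "bounded_linear h" using h(1) linear_conv_bounded_linear by blast
      have "?k differentiable_on R'"
        unfolding differentiable_on_def
      proof
        fix r assume r: "r \<in> R'"
        have 1: "(\<lambda>r. fst (h r)) differentiable at r within R'"
          using bounded_linear_imp_differentiable[OF bounded_linear_fst_comp[OF hb]] .
        have "f i differentiable at (fst (h r)) within ((\<lambda>r. fst (h r)) ` R')"
          using Ti r by (auto simp: differentiable_on_def R'_def intro: differentiable_subset)
        then have 2: "(\<lambda>r. f i (fst (h r))) differentiable at r within R'"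
          using differentiable_chain_within[OF 1, of "f i"] by (simp add: o_def)
        have "\<phi> differentiable at (f i (fst (h r)))"
          using smooth_map_on_open_differentiable[OF \<phi>smooth *(1)] r by (simp add: R'_def)
        then have "\<phi> differentiable at (f i (fst (h r))) within ((\<lambda>r. f i (fst (h r))) ` R')"
          by (rule differentiable_at_withinI)
        then have 3: "(\<lambda>r. \<phi> (f i (fst (h r)))) differentiable at r within R'"
          using differentiable_chain_within[OF 2, of \<phi>] by (simp add: o_def)
        have 4: "(\<lambda>r. snd (h r)) differentiable at r within R'"
          using bounded_linear_imp_differentiable[OF bounded_linear_snd_comp[OF hb]] .
        show "?k differentiable at r within R'" using 3 4 by (rule differentiable_add)
      qed
      moreover have "negligible R'"
        by (rule negligible_subset[OF negligible_lowdim[of R]]) (use R dPL in \<open>auto simp: R'_def\<close>)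
      ultimately have "negligible (?k ` R')"
        using negligible_differentiable_image_negligible[of R' ?k] by simp
      moreover have "{\<phi> (f i t) + y |t y. t \<in> T i \<and> f i t \<in> W \<and> y \<in> Lc} \<subseteq> ?k ` R'"
      proof clarify
        fix t y assume ty: "t \<in> T i" "f i t \<in> W" "y \<in> Lc"
        then have "(t, y) \<in> h ` R" using Ti h(2) by auto
        then obtain r where "r \<in> R" "h r = (t, y)" by (metis imageE)
        then show "\<phi> (f i t) + y \<in> ?k ` R'"
          using ty by (intro image_eqI[of _ _ r]) (auto simp: R'_def)
      qed
      ultimately show ?thesis using negligible_subset by blast
    qed
    then have "negligible (\<Union>i\<in>I. {\<phi> (f i t) + y |t y. t \<in> T i \<and> f i t \<in> W \<and> y \<in> Lc})"
      using I by (intro negligible_Union) auto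
    moreover have "E \<subseteq> (\<Union>i\<in>I. {\<phi> (f i t) + y |t y. t \<in> T i \<and> f i t \<in> W \<and> y \<in> Lc})"
    proof
      fix e assume "e \<in> E"
      then obtain x y where e: "e = x + y" "x \<in> G \<inter> L" "y \<in> Lc" by (auto simp: E_def)
      then obtain u where "u \<in> W" "u \<in> N \<inter> Q" "x = \<phi> u" using GL by auto
      moreover then obtain i t where "i \<in> I" "t \<in> T i" "u = f i t" using cover by auto
      ultimately show "e \<in> (\<Union>i\<in>I. {\<phi> (f i t) + y |t y. t \<in> T i \<and> f i t \<in> W \<and> y \<in> Lc})"
        using e by auto
    qed
    ultimately show ?thesis using negligible_subset by blast
  qed
  moreover have "\<phi> p \<in> interior E"
  proof -
    have pG: "\<phi> p \<in> G \<inter> L"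
      using *(2,7) p Q(2) by (auto simp: G_def)
    then obtain \<epsilon> where \<epsilon>: "\<epsilon> > 0" "ball (\<phi> p) \<epsilon> \<subseteq> G" using G by (meson IntD1 openE)
    have "ball (\<phi> p) \<epsilon> \<subseteq> E"
    proof
      fix z assume z: "z \<in> ball (\<phi> p) \<epsilon>"
      have "\<exists>x y. x \<in> span L \<and> (\<forall>w. w \<in> span L \<longrightarrow> orthogonal y w) \<and> z - \<phi> p = x + y"
        using orthogonal_subspace_decomp_exists[of L "z - \<phi> p"] by metis
      then obtain x y where xy: "x \<in> L" "\<And>w. w \<in> L \<Longrightarrow> orthogonal y w" "z - \<phi> p = x + y"
        by (metis *(5) span_eq_iff)
      then have "y \<in> Lc" by (simp add: Lc_def orthogonal_commute)
      \<comment> \<open>The component along \<open>L\<close> is no longer than the whole difference,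
        so moving by it alone stays in the ball.\<close>
      have "norm (x + y) ^ 2 = norm x ^ 2 + norm y ^ 2"
        using xy(1,2) by (intro norm_add_Pythagorean) (simp add: orthogonal_commute)
      then have "norm x \<le> norm (z - \<phi> p)"
        unfolding xy(3) by (metis le_add_same_cancel1 norm_ge_zero power2_le_imp_le zero_le_power2)
      then have "\<phi> p + x \<in> ball (\<phi> p) \<epsilon>" using z by (simp add: dist_norm norm_minus_commute)
      then have "\<phi> p + x \<in> G \<inter> L" using \<epsilon>(2) pG xy(1) *(5) by (auto intro: subspace_add)
      moreover have "z = (\<phi> p + x) + y" using xy(3) by (simp add: algebra_simps)
      ultimately show "z \<in> E" using \<open>y \<in> Lc\<close> unfolding E_def by blast
    qed
    then show ?thesis using \<epsilon>(1) interior_maximal[of "ball (\<phi> p) \<epsilon>" E] by auto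
  qed
  ultimately show False using open_not_negligible[of "interior E"] negligible_subset interior_subset by blast
qed

section \<open>Orbits and spectra\<close>

lemma SO_iff: "g \<in> SO \<longleftrightarrow> g ** transpose g = mat 1 \<and> transpose g ** g = mat 1 \<and> det g = 1"
  by (auto simp: SO_def rotation_matrix_def orthogonal_matrix_def)

lemma SO_I: "g ** transpose g = mat 1 \<Longrightarrow> det g = 1 \<Longrightarrow> g \<in> SO"
  using matrix_left_right_inverse[of g "transpose g"] by (simp add: SO_iff)

lemma SO_mat1: "mat 1 \<in> SO"
  by (simp add: SO_iff transpose_mat)

lemma SO_mult: "g \<in> SO \<Longrightarrow> h \<in> SO \<Longrightarrow> g ** h \<in> SO"
  by (rule SO_I) (simp_all add: SO_iff matrix_transpose_mul det_mul
      matrix_mul_assoc[of "g ** h" "transpose h"] matrix_mul_assoc[of g h "transpose h", symmetric])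

lemma SO_transpose: "g \<in> SO \<Longrightarrow> transpose g \<in> SO"
  by (simp add: SO_iff det_transpose)

lemma conj_by_conj_by: "conj_by g (conj_by h X) = conj_by (g ** h) X"
  by (simp add: conj_by_def matrix_transpose_mul matrix_mul_assoc)

lemma conj_by_mat1: "conj_by (mat 1) X = X"
  by (simp add: conj_by_def transpose_mat)

lemma conj_by_inverse:
  assumes "g \<in> SO"
  shows "conj_by (transpose g) (conj_by g X) = X" "conj_by g (conj_by (transpose g) X) = X"
  using assms by (simp_all add: conj_by_conj_by SO_iff conj_by_mat1)

lemma conj_by_nth: "conj_by g X $ a $ b = g $ a \<bullet> (X *v (g $ b))"
proof -
  have "conj_by g X $ a $ b = (\<Sum>k\<in>UNIV. \<Sum>l\<in>UNIV. g $ a $ l * X $ l $ k * g $ b $ k)"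
    by (simp add: conj_by_def matrix_matrix_mult_def transpose_def sum_distrib_right)
  also have "\<dots> = (\<Sum>l\<in>UNIV. \<Sum>k\<in>UNIV. g $ a $ l * X $ l $ k * g $ b $ k)"
    by (rule sum.swap)
  finally show ?thesis
    by (simp add: inner_vec_def matrix_vector_mult_def sum_distrib_left mult.assoc)
qed

lemma linear_conj_by: "linear (conj_by g)"
  by (rule linearI) (simp_all add: vec_eq_iff conj_by_nth matrix_vector_mult_add_rdistrib inner_add_right
      scaleR_matrix_vector_assoc[symmetric])

lemma bounded_bilinear_matrix_mult:
  "bounded_bilinear ((**) :: real^'n::finite^'m::finite \<Rightarrow> real^'k::finite^'n \<Rightarrow> real^'k^'m)"
  unfolding bilinear_conv_bounded_bilinear[symmetric] bilinear_def
  by (intro conjI allI linearI)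
    (simp_all add: vec_eq_iff matrix_matrix_mult_def sum.distrib sum_distrib_left algebra_simps)

lemma linear_transpose: "linear (transpose :: real^'n::finite^'m::finite \<Rightarrow> real^'m^'n)"
  by (rule linearI) (simp_all add: vec_eq_iff transpose_def)

lemma bounded_linear_transpose: "bounded_linear (transpose :: real^'n::finite^'m::finite \<Rightarrow> real^'m^'n)"
  using linear_transpose linear_conv_bounded_linear by blast

lemma transpose_conj_by: "transpose (conj_by g X) = conj_by g (transpose X)"
  by (simp add: conj_by_def matrix_transpose_mul matrix_mul_assoc)

lemma conj_by_Sym: "X \<in> Sym \<Longrightarrow> conj_by g X \<in> Sym"
  by (simp add: Sym_def transpose_conj_by)

lemma Sym_nth: "X \<in> Sym \<Longrightarrow> X $ a $ b = X $ b $ a"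
proof -
  assume "X \<in> Sym"
  then have "transpose X $ b $ a = X $ b $ a" by (simp add: Sym_def)
  then show ?thesis by (simp add: transpose_def)
qed

lemma norm_transpose: "norm (transpose X :: real^'n::finite^'m::finite) = norm X"
proof -
  have "transpose X \<bullet> transpose X = X \<bullet> X"
    unfolding inner_vec_def transpose_def by (simp add: sum.swap[of "\<lambda>i j. X $ i $ j * X $ i $ j"])
  then show ?thesis by (simp add: norm_eq_sqrt_inner)
qed

lemma norm_mult_transpose_SO:
  assumes "g \<in> SO"
  shows "norm (X ** transpose g) = norm (X :: 'n::finite sqmat)"
proof -
  have "orthogonal_transformation ((*v) g)"
    using assms by (simp add: SO_def rotation_matrix_def orthogonal_transformation_matrix)
  then have "norm (g *v (X $ i)) = norm (X $ i)" for i
    by (simp add: orthogonal_transformation)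
  moreover have "(X ** transpose g) $ i = g *v (X $ i)" for i
    by (simp add: vec_eq_iff matrix_matrix_mult_def transpose_def matrix_vector_mult_def mult.commute)
  ultimately show ?thesis by (simp add: norm_vec_def)
qed

lemma norm_conj_by:
  assumes "g \<in> SO" shows "norm (conj_by g X) = norm X"
proof -
  have "norm (conj_by g X) = norm (g ** X)"
    unfolding conj_by_def using norm_mult_transpose_SO[OF assms] by blast
  also have "\<dots> = norm (transpose X ** transpose g)"
    using norm_transpose[of "g ** X"] by (simp add: matrix_transpose_mul)
  also have "\<dots> = norm X"
    using norm_mult_transpose_SO[OF assms] norm_transpose by metis
  finally show ?thesis .
qed

lemma dist_conj_by: "g \<in> SO \<Longrightarrow> dist (conj_by g X) (conj_by g Y) = dist X Y"
  using norm_conj_by[of g "X - Y"] linear_diff[OF linear_conj_by, of g X Y] by (simp add: dist_norm)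

lemma conj_by_in_Orbit: "g \<in> SO \<Longrightarrow> conj_by g A \<in> Orbit A"
  by (auto simp: Orbit_def)

lemma Orbit_refl: "A \<in> Orbit A"
  using conj_by_in_Orbit[OF SO_mat1] by (metis conj_by_mat1)

lemma Orbit_eq:
  assumes "B \<in> Orbit A" shows "Orbit B = Orbit A"
proof -
  obtain g where g: "g \<in> SO" "B = conj_by g A" using assms by (auto simp: Orbit_def)
  have "A = conj_by (transpose g) B" using conj_by_inverse[OF g(1)] g(2) by simp
  then show ?thesis
    using g SO_mult SO_transpose[OF g(1)] unfolding Orbit_def by (auto simp: conj_by_conj_by) (metis conj_by_conj_by)+
qed

lemma Orbit_conj_by: "g \<in> SO \<Longrightarrow> Orbit (conj_by g A) = Orbit A"
  using Orbit_eq conj_by_in_Orbit by blast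

lemma Orbit_Sym: "A \<in> Sym \<Longrightarrow> Orbit A \<subseteq> Sym"
  by (auto simp: Orbit_def conj_by_Sym)

lemma conj_by_eigenvector:
  assumes "g \<in> SO" "X *v v = c *\<^sub>R v"
  shows "conj_by g X *v (g *v v) = c *\<^sub>R (g *v v)"
proof -
  have "conj_by g X *v (g *v v) = g *v (X *v ((transpose g ** g) *v v))"
    by (simp add: conj_by_def matrix_vector_mul_assoc matrix_mul_assoc)
  then show ?thesis using assms by (simp add: SO_iff matrix_vector_mult_scaleR)
qed

lemma SO_mult_eq_0_iff: "g \<in> SO \<Longrightarrow> g *v v = 0 \<longleftrightarrow> v = 0"
  by (metis SO_iff matrix_vector_mul_assoc matrix_vector_mul_lid matrix_vector_mult_0_right)

lemma eigenvalues_conj_by: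
  assumes "g \<in> SO" shows "eigenvalues (conj_by g X) = eigenvalues X"
proof -
  have "eigenvalues X \<subseteq> eigenvalues (conj_by g X)" if "g \<in> SO" for g and X :: "'a sqmat"
    using conj_by_eigenvector[OF that] SO_mult_eq_0_iff[OF that] unfolding eigenvalues_def by blast
  from this[OF assms] this[OF SO_transpose[OF assms], of "conj_by g X"] show ?thesis
    using conj_by_inverse[OF assms] by auto
qed

text \<open>The \<open>c\<close>-eigenspace has dimension at least \<open>2\<close>: it meets every hyperplane.\<close>

definition multiple_eigenvalue :: "'n::finite sqmat \<Rightarrow> real \<Rightarrow> bool" where
  "multiple_eigenvalue X c \<longleftrightarrow> (\<forall>y. \<exists>u. u \<noteq> 0 \<and> y \<bullet> u = 0 \<and> X *v u = c *\<^sub>R u)"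

lemma multiple_eigenvalue_conj_by:
  assumes g: "g \<in> SO" shows "multiple_eigenvalue (conj_by g X) c \<longleftrightarrow> multiple_eigenvalue X c"
proof -
  have "multiple_eigenvalue (conj_by g X) c"
    if g: "g \<in> SO" and X: "multiple_eigenvalue X c" for g and X :: "'a sqmat"
    unfolding multiple_eigenvalue_def
  proof
    fix y
    obtain u where u: "u \<noteq> 0" "(transpose g *v y) \<bullet> u = 0" "X *v u = c *\<^sub>R u"
      using X unfolding multiple_eigenvalue_def by blast
    have "y \<bullet> (g *v u) = 0"
      using u(2) by (simp add: dot_lmul_matrix)
    then show "\<exists>u. u \<noteq> 0 \<and> y \<bullet> u = 0 \<and> conj_by g X *v u = c *\<^sub>R u"
      using u conj_by_eigenvector[OF g u(3)] SO_mult_eq_0_iff[OF g] by blast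
  qed
  from this[OF g, of X] this[OF SO_transpose[OF g], of "conj_by g X"] show ?thesis
    using conj_by_inverse[OF g] by auto
qed

subsection \<open>Plane rotations\<close>

definition plane_rotation :: "'n::finite \<Rightarrow> 'n \<Rightarrow> real \<Rightarrow> 'n sqmat" where
  "plane_rotation i j t = (\<chi> a. if a = i then cos t *\<^sub>R axis i 1 - sin t *\<^sub>R axis j 1
     else if a = j then sin t *\<^sub>R axis i 1 + cos t *\<^sub>R axis j 1 else axis a 1)"

lemma matrix_mult_nth: "(A ** B) $ x $ y = A $ x \<bullet> (\<chi> k. B $ k $ y)"
  for A :: "real^'n::finite^'m::finite" and B :: "real^'k::finite^'n"
  by (simp add: matrix_matrix_mult_def inner_vec_def)

lemma plane_rotation_add:
  assumes "i \<noteq> j"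
  shows "plane_rotation i j s ** plane_rotation i j t = plane_rotation i j (s + t)"
  using assms
  by (simp add: vec_eq_iff matrix_mult_nth plane_rotation_def inner_axis' inner_diff_left inner_add_left
      cos_add sin_add algebra_simps)

lemma plane_rotation_SO:
  assumes "i \<noteq> j" shows "plane_rotation i j t \<in> SO"
proof (rule SO_I)
  let ?R = "plane_rotation i j"
  have *: "cos t * cos t + sin t * sin t = 1" for t :: real
    using sin_cos_squared_add3[of t] by (simp add: power2_eq_square)
  have orth: "?R t ** transpose (?R t) = mat 1" for t
  proof -
    have "(?R t ** transpose (?R t)) $ a $ b = ?R t $ a \<bullet> ?R t $ b" for a b
      by (simp add: matrix_mult_nth transpose_def)
    moreover have "?R t $ a \<bullet> ?R t $ b = (if a = b then 1 else 0)" for a b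
      using assms *[of t] by (auto simp: plane_rotation_def inner_axis_axis inner_diff_left inner_diff_right
          inner_add_left inner_add_right add.commute)
    ultimately show ?thesis by (simp add: vec_eq_iff mat_def)
  qed
  then show "?R t ** transpose (?R t) = mat 1" .
  have "det (?R t) * det (?R t) = 1" for t
    using arg_cong[OF orth[of t], of det] by (simp add: det_mul det_transpose)
  \<comment> \<open>Orthogonality leaves determinant 1 or -1; as the square of the rotation by half
    the angle, the matrix has determinant 1.\<close>
  moreover have "det (?R t) = det (?R (t / 2)) * det (?R (t / 2))"
    using plane_rotation_add[OF assms, of "t / 2" "t / 2"] by (simp flip: det_mul)
  ultimately show "det (?R t) = 1" by simp
qed

text \<open>Only the diagonal entries at \<open>i\<close> and \<open>j\<close> change, and by
  opposite amounts because the trace of their block is kept. This produces the factor w j - w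
  i.\<close>

lemma trace_weighted_plane_rotation:
  fixes Y :: "'n::finite sqmat" and w :: "'n \<Rightarrow> real"
  assumes "i \<noteq> j" "Y \<in> Sym"
  shows "(\<Sum>a\<in>UNIV. w a * conj_by (plane_rotation i j t) Y $ a $ a) - (\<Sum>a\<in>UNIV. w a * Y $ a $ a) =
    (w j - w i) * (sin t ^ 2 * (Y $ i $ i - Y $ j $ j) + 2 * sin t * cos t * Y $ i $ j)"
proof -
  let ?Z = "conj_by (plane_rotation i j t) Y"
  have sym: "Y $ a $ b = Y $ b $ a" for a b
    using assms(2) by (rule Sym_nth)
  have col: "axis a 1 \<bullet> (Y *v axis b 1) = Y $ a $ b" for a b
    by (simp add: inner_axis' matrix_vector_mult_basis column_def)
  have cos2: "cos t * cos t = 1 - sin t * sin t"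
    using sin_cos_squared_add3[of t] by (simp add: eq_diff_eq add.commute)
  have "?Z $ i $ i = (cos t * cos t) * Y $ i $ i - 2 * (sin t * cos t * Y $ i $ j) + sin t * sin t * Y $ j $ j"
    "?Z $ j $ j = sin t * sin t * Y $ i $ i + 2 * (sin t * cos t * Y $ i $ j) + (cos t * cos t) * Y $ j $ j"
    using assms(1) sym[of j i]
    by (simp_all add: conj_by_nth plane_rotation_def matrix_vector_mult_diff_distrib matrix_vector_right_distrib
        matrix_vector_mult_scaleR inner_diff_left inner_diff_right inner_add_left inner_add_right col
        algebra_simps)
  then have ij: "?Z $ i $ i - Y $ i $ i = - (sin t ^ 2 * (Y $ i $ i - Y $ j $ j) + 2 * sin t * cos t * Y $ i $ j)"
    "?Z $ j $ j - Y $ j $ j = sin t ^ 2 * (Y $ i $ i - Y $ j $ j) + 2 * sin t * cos t * Y $ i $ j"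
    unfolding cos2 by (simp_all add: power2_eq_square algebra_simps)
  have other: "?Z $ a $ a - Y $ a $ a = 0" if "a \<noteq> i" "a \<noteq> j" for a
    using that by (simp add: conj_by_nth plane_rotation_def col)
  have "(\<Sum>a\<in>UNIV. w a * ?Z $ a $ a) - (\<Sum>a\<in>UNIV. w a * Y $ a $ a) =
      (\<Sum>a\<in>UNIV. w a * (?Z $ a $ a - Y $ a $ a))"
    by (simp add: sum_subtractf right_diff_distrib)
  also have "\<dots> = (\<Sum>a\<in>{i, j}. w a * (?Z $ a $ a - Y $ a $ a))"
    by (rule sum.mono_neutral_right) (auto simp: other)
  also have "\<dots> = w i * (?Z $ i $ i - Y $ i $ i) + w j * (?Z $ j $ j - Y $ j $ j)"
    using assms(1) by simp
  also have "\<dots> = (w j - w i) * (sin t ^ 2 * (Y $ i $ i - Y $ j $ j) + 2 * sin t * cos t * Y $ i $ j)"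
    unfolding ij by (simp add: algebra_simps)
  finally show ?thesis .
qed

text \<open>A maximizer of \<open>\<Sum>\<^sub>i i Y\<^sub>i\<^sub>i\<close> is diagonal-ordered: rotating by a small angle in the
  \<open>(i, j)\<close>-plane could increase the sum if \<open>Y\<^sub>i\<^sub>j \<noteq> 0\<close>, rotating by a right angle if the
  diagonal entries were in the wrong order.\<close>

lemma rotation_closed_has_diagonal_ordered:
  fixes K :: "'n::{finite,linorder} sqmat set"
  assumes K: "compact K" "K \<noteq> {}" "K \<subseteq> Sym"
    and rot: "\<And>Y i j t. Y \<in> K \<Longrightarrow> i \<noteq> j \<Longrightarrow> conj_by (plane_rotation i j t) Y \<in> K"
  shows "\<exists>D\<in>K. diagonal_ordered D"
proof -
  define w :: "'n \<Rightarrow> real" where "w i = card {k. k < i}" for i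
  have w: "w i < w j" if "i < j" for i j
    using that unfolding w_def by (auto intro!: psubset_card_mono)
  define F where "F Y = (\<Sum>a\<in>UNIV. w a * Y $ a $ a)" for Y :: "'n sqmat"
  have "continuous_on K F" unfolding F_def by (intro continuous_intros)
  then obtain Y where Y: "Y \<in> K" "\<And>Z. Z \<in> K \<Longrightarrow> F Z \<le> F Y"
    using continuous_attains_sup[OF K(1,2)] by blast
  have Ysym: "Y \<in> Sym" using Y(1) K(3) by blast
  have neg: "sin t ^ 2 * (Y $ i $ i - Y $ j $ j) + 2 * sin t * cos t * Y $ i $ j \<le> 0" if "i < j" for i j t
  proof -
    have "F (conj_by (plane_rotation i j t) Y) \<le> F Y" using Y rot that by (metis less_irrefl)
    then have "(w j - w i) * (sin t ^ 2 * (Y $ i $ i - Y $ j $ j) + 2 * sin t * cos t * Y $ i $ j) \<le> 0"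
      using trace_weighted_plane_rotation[OF less_imp_neq[OF that] Ysym, of w t] by (simp add: F_def)
    then show ?thesis using w[OF that] by (simp add: mult_le_0_iff)
  qed
  \<comment> \<open>At a right angle the sine is 1 and the cosine 0, so only the difference of the
    diagonal entries is left.\<close>
  have ord: "Y $ i $ i \<le> Y $ j $ j" if "i < j" for i j
    using neg[OF that, of "pi / 2"] by simp
  have zero: "Y $ i $ j = 0" if "i < j" for i j
  proof (rule ccontr)
    assume nz: "Y $ i $ j \<noteq> 0"
    let ?\<Delta> = "Y $ i $ i - Y $ j $ j" and ?y = "Y $ i $ j"
    \<comment> \<open>The angle with tangent e y has the sign of y to first order. The choice of
      \<open>e\<close> gives e |Delta| < 1, so the quadratic term cannot outweigh the linear one and
      e Delta + 2 is positive.\<close>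
    define e where "e = 1 / (1 + \<bar>?\<Delta>\<bar>)"
    have e: "e > 0" by (simp add: e_def)
    have "e * \<bar>?\<Delta>\<bar> < 1" unfolding e_def by (simp add: divide_less_eq)
    then have "e * ?\<Delta> > - 1" using e by (metis abs_mult abs_of_pos abs_less_iff minus_less_iff)
    let ?t = "arctan (e * ?y)"
    have c: "cos ?t > 0" using cos_gt_zero_pi[OF arctan_lbound arctan_ubound] .
    have s: "sin ?t = e * ?y * cos ?t"
      using tan_arctan[of "e * ?y"] c unfolding tan_def by (simp add: field_simps)
    have "cos ?t ^ 2 * e * ?y ^ 2 * (e * ?\<Delta> + 2) \<le> 0"
      using neg[OF that, of ?t] unfolding s by (simp add: power2_eq_square algebra_simps)
    moreover have "cos ?t ^ 2 * e * ?y ^ 2 > 0" using c e nz by simp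
    ultimately have "e * ?\<Delta> + 2 \<le> 0" by (simp add: mult_le_0_iff not_le[symmetric])
    then show False using \<open>e * ?\<Delta> > - 1\<close> by simp
  qed
  have sym: "Y $ a $ b = Y $ b $ a" for a b
    using Ysym by (rule Sym_nth)
  have "Y $ i $ j = 0" if "i \<noteq> j" for i j
    using zero[of i j] zero[of j i] sym[of i j] that by (cases i j rule: linorder_cases) auto
  then have "diagonal_ordered Y"
    using ord unfolding diagonal_ordered_def Dg_def by (auto simp: le_less)
  then show ?thesis using Y(1) by blast
qed

subsection \<open>Polynomial functions of matrices\<close>

lemma real_polynomial_function_nth:
  "real_polynomial_function (\<lambda>X :: real^'n::finite^'m::finite. X $ i $ j)"
  by (intro real_polynomial_function.intros(1)) (auto intro: bounded_linear_compose[OF bounded_linear_vec_nth bounded_linear_vec_nth])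

lemma real_polynomial_function_matrix_mult:
  fixes A :: "'a::real_normed_vector \<Rightarrow> real^'n::finite^'m::finite" and B :: "'a \<Rightarrow> real^'k::finite^'n"
  assumes "\<And>i j. real_polynomial_function (\<lambda>x. A x $ i $ j)" "\<And>i j. real_polynomial_function (\<lambda>x. B x $ i $ j)"
  shows "real_polynomial_function (\<lambda>x. (A x ** B x) $ i $ j)"
  unfolding matrix_matrix_mult_def by (simp, intro real_polynomial_function_sum real_polynomial_function.intros(4) assms) auto

lemma real_polynomial_function_det:
  fixes A :: "'a::real_normed_vector \<Rightarrow> real^'n::finite^'n"
  assumes "\<And>i j. real_polynomial_function (\<lambda>x. A x $ i $ j)"
  shows "real_polynomial_function (\<lambda>x. det (A x))"
  unfolding det_def
  by (intro real_polynomial_function_sum real_polynomial_function.intros(4) real_polynomial_function_prod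
      real_polynomial_function.intros(2) assms) (auto simp: finite_permutations)

lemma polynomial_function_matrix:
  fixes f :: "'a::real_normed_vector \<Rightarrow> real^'n::finite^'m::finite"
  assumes "\<And>i j. real_polynomial_function (\<lambda>x. f x $ i $ j)"
  shows "polynomial_function f"
proof -
  have "real_polynomial_function (\<lambda>x. f x \<bullet> b)" if "b \<in> Basis" for b
  proof -
    obtain i j where b: "b = axis i (axis j 1)" using \<open>b \<in> Basis\<close> by (auto simp: Basis_vec_def)
    show ?thesis using assms[of i j] by (simp add: b inner_axis)
  qed
  then show ?thesis by (simp add: polynomial_function_iff_Basis_inner)
qed

lemma algebraic_set_closed: "algebraic_set S \<Longrightarrow> closed S"
proof -
  assume "algebraic_set S"
  then obtain P where P: "\<forall>p \<in> P. real_polynomial_function p" "S = {x. \<forall>p \<in> P. p x = 0}"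
    by (auto simp: algebraic_set_def)
  have "closed {x. p x = 0}" if "p \<in> P" for p
    using P(1) that continuous_real_polymonial_function by (intro closed_Collect_eq) (auto simp: continuous_on_eq_continuous_at)
  then have "closed (\<Inter>p\<in>P. {x. p x = 0})" by blast
  moreover have "S = (\<Inter>p\<in>P. {x. p x = 0})" using P(2) by auto
  ultimately show ?thesis by simp
qed

text \<open>The free first factor makes this the domain of \<open>DO\<close>; a slice of it shows
  that \<open>SO\<close> is closed.\<close>

lemma algebraic_set_Times_SO: "algebraic_set (UNIV \<times> SO :: ('a::euclidean_space \<times> 'n::finite sqmat) set)"
proof -
  have nth: "real_polynomial_function (\<lambda>x :: 'a \<times> 'n sqmat. snd x $ i $ j)" for i j
    by (intro real_polynomial_function.intros(1) bounded_linear_compose[OF bounded_linear_vec_nth]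
        bounded_linear_compose[OF bounded_linear_vec_nth bounded_linear_snd])
  have nthT: "real_polynomial_function (\<lambda>x :: 'a \<times> 'n sqmat. transpose (snd x) $ i $ j)" for i j
    using nth by (simp add: transpose_def)
  define P where "P = insert (\<lambda>x :: 'a \<times> 'n sqmat. det (snd x) - 1)
    (range (\<lambda>(i, j) x. (snd x ** transpose (snd x)) $ i $ j - (mat 1 :: 'n sqmat) $ i $ j))"
  have "\<forall>p \<in> P. real_polynomial_function p"
    unfolding P_def
    by (auto intro!: real_polynomial_function_diff real_polynomial_function_det real_polynomial_function_matrix_mult
        nth nthT)
  moreover have "UNIV \<times> SO = {x. \<forall>p \<in> P. p x = 0}"
  proof -
    have "(\<forall>p \<in> P. p x = 0) \<longleftrightarrow> det (snd x) = 1 \<and> snd x ** transpose (snd x) = mat 1" for x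
      unfolding P_def by (auto simp: vec_eq_iff)
    moreover have "g \<in> SO \<longleftrightarrow> det g = 1 \<and> g ** transpose g = mat 1" for g :: "'n sqmat"
      by (metis SO_I SO_iff)
    ultimately show ?thesis by auto
  qed
  ultimately show ?thesis unfolding algebraic_set_def by blast
qed

lemma compact_SO: "compact (SO :: 'n::finite sqmat set)"
proof -
  have "closed (UNIV \<times> SO :: (real \<times> 'n sqmat) set)"
    using algebraic_set_closed[OF algebraic_set_Times_SO] .
  then have "closed ((\<lambda>g. (0 :: real, g)) -` (UNIV \<times> SO :: (real \<times> 'n sqmat) set))"
    by (rule closed_vimage) (intro continuous_intros)
  moreover have "(\<lambda>g. (0 :: real, g)) -` (UNIV \<times> SO) = (SO :: 'n sqmat set)" by auto
  ultimately have "closed (SO :: 'n sqmat set)" by simp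
  moreover have "norm g \<le> norm (mat 1 :: 'n sqmat)" if "g \<in> SO" for g :: "'n sqmat"
    using norm_mult_transpose_SO[OF SO_transpose[OF that], of "mat 1"] by simp
  ultimately show ?thesis by (auto simp: compact_eq_bounded_closed bounded_iff)
qed

lemma continuous_on_conj_by: "continuous_on S (\<lambda>g. conj_by g A)"
  unfolding conj_by_def
  by (intro bounded_bilinear.continuous_on[OF bounded_bilinear_matrix_mult] continuous_intros
      bounded_linear.continuous_on[OF bounded_linear_transpose])

lemma Orbit_image: "Orbit A = (\<lambda>g. conj_by g A) ` SO"
  by (auto simp: Orbit_def)

lemma compact_Orbit: "compact (Orbit A)"
  unfolding Orbit_image by (rule compact_continuous_image[OF continuous_on_conj_by compact_SO])

lemma Orbit_plane_rotation:
  "Y \<in> Orbit A \<Longrightarrow> i \<noteq> j \<Longrightarrow> conj_by (plane_rotation i j t) Y \<in> Orbit A"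
  using Orbit_eq conj_by_in_Orbit plane_rotation_SO by blast

lemma Orbit_has_diagonal_ordered:
  fixes A :: "'n::{finite,linorder} sqmat"
  assumes "A \<in> Sym" shows "\<exists>D\<in>Orbit A. diagonal_ordered D"
proof (rule rotation_closed_has_diagonal_ordered[OF compact_Orbit _ Orbit_Sym[OF assms]])
  show "Orbit A \<noteq> {}" using Orbit_refl by blast
qed (rule Orbit_plane_rotation)

subsection \<open>Characteristic polynomial and spectrum\<close>

lemma poly_charpoly: "poly (charpoly X) x = det (x *\<^sub>R mat 1 - X)"
proof -
  have "poly (of_int (sign p)) x = of_int (sign p)" for p :: "'a \<Rightarrow> 'a"
    by simp
  then show ?thesis
    unfolding charpoly_def det_def
    by (simp add: poly_sum poly_prod mat_def if_distrib[of "\<lambda>p. poly p x"] cong: if_cong)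
      (intro sum.cong prod.cong refl arg_cong2[of _ _ _ _ "(*)"], auto)
qed

lemma charpoly_conj_by:
  assumes g: "g \<in> SO" shows "charpoly (conj_by g X) = charpoly X"
proof -
  have "x *\<^sub>R mat 1 - conj_by g X = conj_by g (x *\<^sub>R mat 1 - X)" for x
  proof -
    have "conj_by g (mat 1) = mat 1" using g by (simp add: conj_by_def SO_iff)
    then show ?thesis
      by (simp add: linear_diff[OF linear_conj_by] linear_scale[OF linear_conj_by])
  qed
  then have "det (x *\<^sub>R mat 1 - conj_by g X) = det (x *\<^sub>R mat 1 - X)" for x
    using g by (simp add: conj_by_def det_mul det_transpose SO_iff)
  then have "poly (charpoly (conj_by g X)) = poly (charpoly X)"
    by (simp add: fun_eq_iff poly_charpoly)
  then show ?thesis by (simp add: poly_eq_poly_eq_iff)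
qed

lemma charpoly_Dg:
  assumes "D \<in> Dg" shows "charpoly D = (\<Prod>i\<in>UNIV. [:- D $ i $ i, 1:])"
  unfolding charpoly_def by (subst det_diagonal) (use assms in \<open>auto simp: Dg_def\<close>)

lemma spectrum_conj_by: "g \<in> SO \<Longrightarrow> spectrum (conj_by g X) = spectrum X"
  by (simp add: spectrum_def charpoly_conj_by)

lemma spectrum_Orbit: "B \<in> Orbit A \<Longrightarrow> spectrum B = spectrum A"
  by (auto simp: Orbit_def spectrum_conj_by)

lemma charpoly_Orbit: "B \<in> Orbit A \<Longrightarrow> charpoly B = charpoly A"
  by (auto simp: Orbit_def charpoly_conj_by)

lemma spectrum_Dg:
  assumes "D \<in> Dg" shows "spectrum D = (\<Sum>i\<in>UNIV. {#D $ i $ i#})"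
proof -
  have "proots [:- c, 1:] = {#c#}" for c :: real
    using proots_linear_factor[of "- c"] by (simp only: minus_minus)
  then show ?thesis
    unfolding spectrum_def charpoly_Dg[OF assms] by (subst proots_prod) (simp_all only:, auto)
qed

text \<open>Read along the order of the indices, the diagonal is a sorted list whose multiset is the
  spectrum, and a multiset has only one sorted arrangement.\<close>

lemma diagonal_ordered_unique:
  fixes D D' :: "'n::{finite,linorder} sqmat"
  assumes D: "diagonal_ordered D" "diagonal_ordered D'" and spec: "spectrum D = spectrum D'"
  shows "D = D'"
proof -
  define xs :: "'n list" where "xs = sorted_list_of_set UNIV"
  have xs: "set xs = UNIV" "distinct xs" "sorted xs"
    by (simp_all add: xs_def)
  have "spectrum E = mset (map (\<lambda>i. E $ i $ i) xs)" if "diagonal_ordered E" for E :: "'n sqmat"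
  proof -
    have "spectrum E = (\<Sum>i\<in>set xs. {#E $ i $ i#})"
      using that xs(1) by (simp add: spectrum_Dg diagonal_ordered_def)
    also have "\<dots> = (\<Sum>i\<leftarrow>xs. {#E $ i $ i#})"
      by (rule sum.distinct_set_conv_list[OF xs(2)])
    also have "\<dots> = mset (map (\<lambda>i. E $ i $ i) xs)" by (induction xs) auto
    finally show ?thesis .
  qed
  note ms = this
  have so: "sorted (map (\<lambda>i. E $ i $ i) xs)" if "diagonal_ordered E" for E :: "'n sqmat"
    using that xs(3) by (auto simp: diagonal_ordered_def sorted_map intro: sorted_wrt_mono_rel[rotated])
  have "mset (map (\<lambda>i. D' $ i $ i) xs) = mset (map (\<lambda>i. D $ i $ i) xs)"
    using ms[OF D(1)] ms[OF D(2)] spec by simp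
  from properties_for_sort[OF this so[OF D(2)]] properties_for_sort[OF refl so[OF D(1)]]
  have "map (\<lambda>i. D $ i $ i) xs = map (\<lambda>i. D' $ i $ i) xs" by simp
  then have "D $ i $ i = D' $ i $ i" for i using xs(1) by simp
  then show ?thesis
    using D unfolding vec_eq_iff diagonal_ordered_def Dg_def mem_Collect_eq by metis
qed

lemma Orbit_unique_diagonal_ordered:
  fixes A :: "'n::{finite,linorder} sqmat"
  assumes "A \<in> Sym" shows "\<exists>!D. D \<in> Orbit A \<and> diagonal_ordered D"
proof -
  obtain D where D: "D \<in> Orbit A" "diagonal_ordered D" using Orbit_has_diagonal_ordered[OF assms] by blast
  then have "E = D" if "E \<in> Orbit A" "diagonal_ordered E" for E
    using diagonal_ordered_unique[OF that(2) D(2)] spectrum_Orbit[OF that(1)] spectrum_Orbit[OF D(1)] by simp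
  then show ?thesis using D by blast
qed

lemma Orbit_eq_iff_spectrum:
  fixes A B :: "'n::{finite,linorder} sqmat"
  assumes "A \<in> Sym" "B \<in> Sym" shows "Orbit A = Orbit B \<longleftrightarrow> spectrum A = spectrum B"
proof
  show "Orbit A = Orbit B \<Longrightarrow> spectrum A = spectrum B" using spectrum_Orbit[of A B] Orbit_refl[of A] by simp
  assume spec: "spectrum A = spectrum B"
  then show "Orbit A = Orbit B"
  proof -
    obtain D where D: "D \<in> Orbit A" "diagonal_ordered D" using Orbit_has_diagonal_ordered[OF assms(1)] by blast
    obtain E where E: "E \<in> Orbit B" "diagonal_ordered E" using Orbit_has_diagonal_ordered[OF assms(2)] by blast
    have "D = E"
      using diagonal_ordered_unique[OF D(2) E(2)] spectrum_Orbit[OF D(1)] spectrum_Orbit[OF E(1)] spec by simp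
    then show ?thesis using Orbit_eq[OF D(1)] Orbit_eq[OF E(1)] by simp
  qed
qed

lemma connected_Orbit:
  fixes A :: "'n::{finite,linorder} sqmat"
  assumes A: "A \<in> Sym" shows "connected (Orbit A)"
proof (rule ccontr)
  assume "\<not> connected (Orbit A)"
  then obtain P Q where PQ: "closed P" "closed Q" "Orbit A \<subseteq> P \<union> Q" "P \<inter> Q \<inter> Orbit A = {}"
    "P \<inter> Orbit A \<noteq> {}" "Q \<inter> Orbit A \<noteq> {}"
    unfolding connected_closed not_not by (elim exE conjE) (rule that)
  have "\<exists>D\<in>P \<inter> Orbit A. diagonal_ordered D"
    if PQ: "closed P" "closed Q" "Orbit A \<subseteq> P \<union> Q" "P \<inter> Q \<inter> Orbit A = {}" "P \<inter> Orbit A \<noteq> {}" for P Q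
  proof (rule rotation_closed_has_diagonal_ordered)
    show "compact (P \<inter> Orbit A)" using PQ(1) compact_Orbit by (rule closed_Int_compact)
    show "P \<inter> Orbit A \<noteq> {}" by fact
    show "P \<inter> Orbit A \<subseteq> Sym" using Orbit_Sym[OF A] by blast
    fix Y i and j :: 'n and t assume Y: "Y \<in> P \<inter> Orbit A" and ij: "i \<noteq> j"
    let ?c = "\<lambda>t. conj_by (plane_rotation i j t) Y"
    \<comment> \<open>As the angle varies, the conjugates form a connected curve in the orbit
      through \<open>Y\<close>, which cannot leave \<open>P\<close>. Each closed part is thus closed
      under plane rotations, as the maximization requires.\<close>
    have "connected (range ?c)"
    proof (rule connected_continuous_image)
      have "continuous_on UNIV (plane_rotation i j)"
        unfolding plane_rotation_def
        by (rule continuous_on_vec_lambda, rename_tac a, case_tac "a = i"; case_tac "a = j")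
          (auto intro!: continuous_intros)
      then show "continuous_on UNIV ?c"
        by (rule continuous_on_compose2[OF continuous_on_conj_by[of UNIV]]) simp
    qed simp
    moreover have "range ?c \<subseteq> Orbit A" using Orbit_plane_rotation[OF _ ij] Y by blast
    moreover have "?c 0 = Y"
    proof -
      have "plane_rotation i j 0 = (mat 1 :: 'n sqmat)"
        by (simp add: plane_rotation_def vec_eq_iff mat_def axis_def)
      then show ?thesis by (simp add: conj_by_mat1)
    qed
    then have "P \<inter> range ?c \<noteq> {}" using Y by (metis IntD1 disjoint_iff rangeI)
    ultimately have "Q \<inter> range ?c = {}"
      using PQ(1-4) connected_closedD[of "range ?c" P Q] by blast
    then show "?c t \<in> P \<inter> Orbit A" using \<open>range ?c \<subseteq> Orbit A\<close> PQ(3) by blast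
  qed
  from this[OF PQ(1-5)] this[OF PQ(2,1) _ _ PQ(6)] PQ(3,4)
  have "\<exists>D\<in>P \<inter> Orbit A. diagonal_ordered D" "\<exists>D\<in>Q \<inter> Orbit A. diagonal_ordered D"
    by (auto simp: Un_commute Int_commute)
  then show False using Orbit_unique_diagonal_ordered[OF A] PQ(4) by blast
qed

section \<open>Matrices with a multiple eigenvalue\<close>

lemma Dg_Sym: "Dg \<subseteq> Sym"
proof
  fix D :: "'a sqmat" assume D: "D \<in> Dg"
  have "D $ j $ i = D $ i $ j" for i j using D by (cases "i = j") (auto simp: Dg_def)
  then show "D \<in> Sym" by (simp add: Sym_def transpose_def vec_eq_iff)
qed

lemma Dg_mult_vector:
  assumes "D \<in> Dg" shows "(D *v v) $ i = D $ i $ i * v $ i"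
proof -
  have "(D *v v) $ i = (\<Sum>j\<in>UNIV. D $ i $ j * v $ j)" by (simp add: matrix_vector_mult_def)
  also have "\<dots> = (\<Sum>j\<in>{i}. D $ i $ j * v $ j)"
    by (rule sum.mono_neutral_right) (use assms in \<open>auto simp: Dg_def\<close>)
  finally show ?thesis by simp
qed

lemma eigenvector_Dg_iff:
  "D \<in> Dg \<Longrightarrow> D *v v = c *\<^sub>R v \<longleftrightarrow> (\<forall>i. v $ i \<noteq> 0 \<longrightarrow> D $ i $ i = c)"
  by (auto simp: vec_eq_iff Dg_mult_vector)

lemma eigenvalues_Dg: "D \<in> Dg \<Longrightarrow> eigenvalues D = range (\<lambda>i. D $ i $ i)"
proof (intro equalityI subsetI)
  fix c assume D: "D \<in> Dg" and "c \<in> eigenvalues D"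
  then obtain v where "v \<noteq> 0" "D *v v = c *\<^sub>R v" by (auto simp: eigenvalues_def)
  then obtain i where "v $ i \<noteq> 0" by (auto simp: vec_eq_iff)
  then have "D $ i $ i = c" using \<open>D *v v = c *\<^sub>R v\<close> eigenvector_Dg_iff[OF D] by blast
  then show "c \<in> range (\<lambda>i. D $ i $ i)" by blast
next
  fix c assume D: "D \<in> Dg" and "c \<in> range (\<lambda>i. D $ i $ i)"
  then obtain i where "c = D $ i $ i" by blast
  then have "D *v axis i 1 = c *\<^sub>R axis i 1" "axis i (1::real) \<noteq> 0"
    by (simp add: eigenvector_Dg_iff[OF D] axis_def, simp add: axis_eq_0_iff)
  then show "c \<in> eigenvalues D" unfolding eigenvalues_def by blast
qed

lemma multiple_eigenvalue_Dg_iff: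
  assumes D: "D \<in> Dg"
  shows "multiple_eigenvalue D c \<longleftrightarrow> (\<exists>i j. i \<noteq> j \<and> D $ i $ i = c \<and> D $ j $ j = c)"
proof
  assume m: "multiple_eigenvalue D c"
  obtain u where u: "u \<noteq> 0" "D *v u = c *\<^sub>R u"
    using m unfolding multiple_eigenvalue_def by blast
  then obtain i where i: "u $ i \<noteq> 0" by (metis vec_eq_iff zero_index)
  \<comment> \<open>Taking the hyperplane orthogonal to the axis of \<open>i\<close> forces the
    second eigenvector to be supported off \<open>i\<close>, which yields a different index.\<close>
  obtain u' where u': "u' \<noteq> 0" "axis i 1 \<bullet> u' = 0" "D *v u' = c *\<^sub>R u'"
    using m unfolding multiple_eigenvalue_def by blast
  then obtain j where j: "u' $ j \<noteq> 0" by (metis vec_eq_iff zero_index)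
  have "j \<noteq> i" using u'(2) j by (auto simp: inner_axis')
  then show "\<exists>i j. i \<noteq> j \<and> D $ i $ i = c \<and> D $ j $ j = c"
    using i j u(2) u'(3) eigenvector_Dg_iff[OF D] by metis
next
  assume "\<exists>i j. i \<noteq> j \<and> D $ i $ i = c \<and> D $ j $ j = c"
  then obtain i j where ij: "i \<noteq> j" "D $ i $ i = c" "D $ j $ j = c" by blast
  show "multiple_eigenvalue D c"
    unfolding multiple_eigenvalue_def
  proof
    fix y :: "real^'a"
    \<comment> \<open>A nonzero vector in the plane of the axes \<open>i\<close> and
      \<open>j\<close> orthogonal to \<open>y\<close>; the first case avoids the zero vector when
      both coordinates of \<open>y\<close> vanish.\<close>
    define u where "u = (if y $ i = 0 then axis i 1 else y $ j *\<^sub>R axis i 1 - y $ i *\<^sub>R axis j (1::real))"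
    have "u $ i \<noteq> 0 \<or> u $ j \<noteq> 0" using ij(1) by (auto simp: u_def axis_def)
    then have "u \<noteq> 0" by auto
    moreover have "y \<bullet> u = 0" by (auto simp: u_def inner_axis inner_diff_right)
    moreover have "u $ k = 0" if "k \<noteq> i" "k \<noteq> j" for k
      using that by (auto simp: u_def axis_def)
    then have "D *v u = c *\<^sub>R u" using eigenvector_Dg_iff[OF D] ij by metis
    ultimately show "\<exists>u. u \<noteq> 0 \<and> y \<bullet> u = 0 \<and> D *v u = c *\<^sub>R u" by blast
  qed
qed

lemma Sym_diagonalize:
  fixes X :: "'n::{finite,linorder} sqmat"
  assumes "X \<in> Sym"
  obtains g D where "g \<in> SO" "D \<in> Dg" "X = conj_by g D"
proof -
  obtain D where D: "D \<in> Orbit X" "diagonal_ordered D" using Orbit_has_diagonal_ordered[OF assms] by blast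
  then obtain g where g: "g \<in> SO" "D = conj_by g X" by (auto simp: Orbit_def)
  then have "X = conj_by (transpose g) D" using conj_by_inverse[OF g(1)] by simp
  then show ?thesis using that[OF SO_transpose[OF g(1)]] D(2) by (auto simp: diagonal_ordered_def)
qed

lemma degree_charpoly_Dg: "D \<in> Dg \<Longrightarrow> degree (charpoly D) = CARD('n)" for D :: "'n::finite sqmat"
  by (simp only: charpoly_Dg, subst degree_prod_eq_sum_degree) auto

lemma lead_coeff_charpoly_Dg: "D \<in> Dg \<Longrightarrow> lead_coeff (charpoly D) = 1"
  by (simp only: charpoly_Dg lead_coeff_prod) simp

lemma degree_charpoly: "X \<in> Sym \<Longrightarrow> degree (charpoly X) = CARD('n)" for X :: "'n::{finite,linorder} sqmat"
  by (erule Sym_diagonalize) (simp add: charpoly_conj_by degree_charpoly_Dg)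

lemma lead_coeff_charpoly: "X \<in> Sym \<Longrightarrow> lead_coeff (charpoly X) = 1" for X :: "'n::{finite,linorder} sqmat"
  by (erule Sym_diagonalize) (simp add: charpoly_conj_by lead_coeff_charpoly_Dg)

lemma discriminant_charpoly_eq_0_iff:
  fixes X :: "'n::{finite,linorder} sqmat"
  assumes "X \<in> Sym"
  shows "discriminant (charpoly X) = 0 \<longleftrightarrow> resultant (charpoly X) (pderiv (charpoly X)) = 0"
  using lead_coeff_charpoly[OF assms] by (simp add: discriminant_def)

lemma poly_pderiv_linear_mult: "poly (pderiv ([:- c, 1:] * r)) c = poly r c" for c :: "'a::idom"
  unfolding pderiv_mult poly_add poly_mult by (simp add: pderiv_pCons)

text \<open>The resultant vanishes iff the gcd is not constant. As the polynomial splits, this means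
  a common root with the derivative, and such a root is one that two linear factors share.\<close>

lemma resultant_pderiv_prod_linear:
  fixes d :: "'n::finite \<Rightarrow> real"
  defines "p \<equiv> (\<Prod>i\<in>UNIV. [:- d i, 1:])"
  shows "resultant p (pderiv p) = 0 \<longleftrightarrow> (\<exists>i j. i \<noteq> j \<and> d i = d j)"
proof -
  have p0: "p \<noteq> 0" unfolding p_def by (subst prod_zero_iff) auto
  have p_split: "p = [:- d i, 1:] * (\<Prod>k\<in>UNIV - {i}. [:- d k, 1:])" for i
    unfolding p_def by (subst prod.remove[of UNIV i]) auto
  have "degree (gcd p (pderiv p)) \<noteq> 0 \<longleftrightarrow> (\<exists>c. poly p c = 0 \<and> poly (pderiv p) c = 0)"
  proof
    assume deg: "degree (gcd p (pderiv p)) \<noteq> 0"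
    \<comment> \<open>If no linear factor divided the gcd, the gcd would be coprime to
      \<open>p\<close>; being a divisor of \<open>p\<close>, it would be a unit.\<close>
    have "\<exists>i. [:- d i, 1:] dvd gcd p (pderiv p)"
    proof (rule ccontr)
      assume "\<not> (\<exists>i. [:- d i, 1:] dvd gcd p (pderiv p))"
      then have nd: "\<not> [:- d i, 1:] dvd gcd p (pderiv p)" for i by blast
      have "coprime [:- d i, 1:] (gcd p (pderiv p))" for i
        by (rule prime_elem_imp_coprime[OF prime_elem_linear_field_poly nd]) simp
      then have "coprime p (gcd p (pderiv p))" unfolding p_def by (intro prod_coprime_left) auto
      then have "is_unit (gcd p (pderiv p))"
        by (metis coprime_absorb_right gcd_dvd1)
      then show False using deg by (auto simp: is_unit_poly_iff)
    qed
    then show "\<exists>c. poly p c = 0 \<and> poly (pderiv p) c = 0"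
      by (metis dvd_trans gcd_dvd1 gcd_dvd2 poly_eq_0_iff_dvd)
  next
    assume "\<exists>c. poly p c = 0 \<and> poly (pderiv p) c = 0"
    then obtain c where "[:- c, 1:] dvd p" "[:- c, 1:] dvd pderiv p" by (auto simp: poly_eq_0_iff_dvd)
    then have "[:- c, 1:] dvd gcd p (pderiv p)" by simp
    from dvd_imp_degree_le[OF this] show "degree (gcd p (pderiv p)) \<noteq> 0" using p0 by simp
  qed
  also have "\<dots> \<longleftrightarrow> (\<exists>i j. i \<noteq> j \<and> d i = d j)"
  proof
    assume "\<exists>c. poly p c = 0 \<and> poly (pderiv p) c = 0"
    then obtain c where c: "poly p c = 0" "poly (pderiv p) c = 0" by blast
    then obtain i where i: "d i = c" unfolding p_def poly_prod by (subst (asm) prod_zero_iff) auto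
    have "poly (\<Prod>k\<in>UNIV - {i}. [:- d k, 1:]) c = 0"
      using c(2) unfolding p_split[of i] i poly_pderiv_linear_mult .
    then obtain k where "k \<noteq> i" "d k = c" unfolding poly_prod by (subst (asm) prod_zero_iff) auto
    then show "\<exists>i j. i \<noteq> j \<and> d i = d j" using i by metis
  next
    assume "\<exists>i j. i \<noteq> j \<and> d i = d j"
    then obtain i j where ij: "i \<noteq> j" "d i = d j" by blast
    have "poly (\<Prod>k\<in>UNIV - {i}. [:- d k, 1:]) (d i) = 0"
      unfolding poly_prod by (subst prod_zero_iff) (use ij in auto)
    then have "poly p (d i) = 0 \<and> poly (pderiv p) (d i) = 0"
      unfolding p_split[of i] poly_pderiv_linear_mult by simp
    then show "\<exists>c. poly p c = 0 \<and> poly (pderiv p) c = 0" by blast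
  qed
  finally show ?thesis unfolding resultant_0_gcd .
qed

text \<open>Both sides are invariant under conjugation by \<open>SO\<close>, so a diagonal
  representative decides. This trades the discriminant for eigenvectors, with which the geometric
  arguments work.\<close>

lemma MM_iff:
  fixes X :: "'n::{finite,linorder} sqmat"
  shows "X \<in> MM \<longleftrightarrow> X \<in> Sym \<and> (\<exists>c. multiple_eigenvalue X c)"
proof (cases "X \<in> Sym")
  case True
  then obtain g D where gD: "g \<in> SO" "D \<in> Dg" "X = conj_by g D" by (rule Sym_diagonalize)
  have "X \<in> MM \<longleftrightarrow> resultant (charpoly D) (pderiv (charpoly D)) = 0"
    using True discriminant_charpoly_eq_0_iff[OF True] gD by (simp add: MM_def charpoly_conj_by)
  also have "\<dots> \<longleftrightarrow> (\<exists>i j. i \<noteq> j \<and> D $ i $ i = D $ j $ j)"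
    unfolding charpoly_Dg[OF gD(2)] by (rule resultant_pderiv_prod_linear)
  also have "\<dots> \<longleftrightarrow> (\<exists>c. multiple_eigenvalue D c)"
    using multiple_eigenvalue_Dg_iff[OF gD(2)] by metis
  finally show ?thesis using True gD by (simp add: multiple_eigenvalue_conj_by)
qed (simp add: MM_def)

lemma MM_subset_Sym: "MM \<subseteq> Sym" and MH_subset_Sym: "MH \<subseteq> Sym"
  by (auto simp: MM_def MH_def)

lemma conj_by_Sym_iff: "g \<in> SO \<Longrightarrow> conj_by g X \<in> Sym \<longleftrightarrow> X \<in> Sym"
  using conj_by_Sym[of X g] conj_by_Sym[of "conj_by g X" "transpose g"] conj_by_inverse(1)[of g X] by auto

lemma MM_conj_by: "g \<in> SO \<Longrightarrow> conj_by g X \<in> MM \<longleftrightarrow> X \<in> MM" for X :: "'n::{finite,linorder} sqmat"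
  by (simp add: MM_iff multiple_eigenvalue_conj_by conj_by_Sym_iff)

lemma MH_conj_by: "g \<in> SO \<Longrightarrow> conj_by g X \<in> MH \<longleftrightarrow> X \<in> MH"
  by (simp add: MH_def eigenvalues_conj_by conj_by_Sym_iff)

lemma Orbit_subset_MH: "A \<in> MH \<Longrightarrow> Orbit A \<subseteq> MH"
  by (auto simp: Orbit_def MH_conj_by)

lemma MH_Dg_iff:
  "D \<in> Dg \<Longrightarrow> D \<in> MH \<longleftrightarrow> card (range (\<lambda>i. D $ i $ i)) = CARD('n) - 1" for D :: "'n::finite sqmat"
  using Dg_Sym by (auto simp: MH_def eigenvalues_Dg)

lemma MH_subset_MM: "MH \<subseteq> (MM :: 'n::{finite,linorder} sqmat set)"
proof
  fix X :: "'n sqmat" assume X: "X \<in> MH"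
  then have "X \<in> Sym" using MH_subset_Sym by blast
  then obtain g D where gD: "g \<in> SO" "D \<in> Dg" "X = conj_by g D" by (rule Sym_diagonalize)
  have "D \<in> MH" using X gD MH_conj_by by blast
  then have "card (range (\<lambda>i. D $ i $ i)) = CARD('n) - 1" using MH_Dg_iff[OF gD(2)] by blast
  moreover have "CARD('n) - 1 \<noteq> CARD('n)" using zero_less_card_finite[where 'a = 'n] by linarith
  ultimately have "\<not> inj (\<lambda>i. D $ i $ i)"
    using card_image[of "\<lambda>i. D $ i $ i" UNIV] by metis
  then have "\<exists>c. multiple_eigenvalue D c"
    using multiple_eigenvalue_Dg_iff[OF gD(2)] unfolding inj_def by metis
  then show "X \<in> MM" using gD Dg_Sym MM_conj_by MM_iff by blast
qed

subsection \<open>The plane \<open>\<Pi>\<close>\<close>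

definition idx1 :: "'n::{finite,linorder}" where "idx1 = Min UNIV"
text \<open>The minimum is meaningful only with at least two indices, hence the assumption
  \<open>CARD('n) > 1\<close> in what follows.\<close>

definition idx2 :: "'n::{finite,linorder}" where "idx2 = Min (UNIV - {idx1})"

lemma idx1_le: "idx1 \<le> k"
  by (simp add: idx1_def)

lemma idx2_le: "k \<noteq> idx1 \<Longrightarrow> idx2 \<le> k"
  by (simp add: idx2_def)

lemma idx1_less_idx2:
  assumes "CARD('n::{finite,linorder}) > 1" shows "idx1 < (idx2 :: 'n)"
proof -
  have "UNIV - {idx1 :: 'n} \<noteq> {}"
  proof -
    have "card (UNIV - {idx1 :: 'n}) = CARD('n) - 1" by (rule card_Diff_singleton) simp
    then show ?thesis using assms by (metis card.empty zero_less_diff less_irrefl)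
  qed
  then have "(idx2 :: 'n) \<in> UNIV - {idx1}" unfolding idx2_def by (intro Min_in) auto
  then show ?thesis using idx1_le[of idx2] by (simp add: less_le)
qed

text \<open>\<open>diag_list\<close> finds an entry by counting predecessors. That count is inverse
  to indexing into the sorted list of all indices.\<close>

lemma
  fixes i :: "'n::{finite,linorder}"
  shows card_less_sorted_list:
      "\<And>m. m < CARD('n) \<Longrightarrow> card {k. k < sorted_list_of_set (UNIV :: 'n set) ! m} = m"
    and ex_nth_sorted_list: "\<exists>m<CARD('n). i = sorted_list_of_set UNIV ! m"
proof -
  define xs :: "'n list" where "xs = sorted_list_of_set UNIV"
  have xs: "set xs = UNIV" "distinct xs" "sorted_wrt (<) xs" "length xs = CARD('n)"
    by (simp_all add: xs_def strict_sorted_iff)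
  show "\<exists>m<CARD('n). i = sorted_list_of_set UNIV ! m"
    using xs(1,4) unfolding xs_def[symmetric] by (metis UNIV_I in_set_conv_nth)
  show "card {k. k < sorted_list_of_set (UNIV :: 'n set) ! m} = m" if m: "m < CARD('n)" for m
  proof -
    have "{k. k < xs ! m} = (!) xs ` {..<m}"
    proof (intro equalityI subsetI)
      fix k assume k: "k \<in> {k. k < xs ! m}"
      obtain l where l: "l < length xs" "k = xs ! l" using xs(1) by (metis UNIV_I in_set_conv_nth)
      have "l < m"
      proof (rule ccontr)
        assume "\<not> l < m"
        then have "xs ! m \<le> xs ! l" using sorted_wrt_nth_less[OF xs(3), of m l] l(1) by (cases "l = m") auto
        then show False using k l(2) by auto
      qed
      then show "k \<in> (!) xs ` {..<m}" using l(2) by blast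
    qed (use sorted_wrt_nth_less[OF xs(3)] m xs(4) in auto)
    moreover have "inj_on ((!) xs) {..<m}"
      using xs(2,4) m by (auto simp: inj_on_def nth_eq_iff_index_eq)
    ultimately show ?thesis unfolding xs_def[symmetric] by (simp add: card_image)
  qed
qed

lemma card_less_idx1: "card {k. k < (idx1 :: 'n::{finite,linorder})} = 0"
proof -
  have "{k. k < (idx1 :: 'n)} = {}" using idx1_le by (auto simp: not_less[symmetric])
  then show ?thesis by simp
qed

lemma card_less_idx2:
  assumes "CARD('n::{finite,linorder}) > 1" shows "card {k. k < (idx2 :: 'n)} = 1"
proof -
  have "{k. k < (idx2 :: 'n)} = {idx1}"
    using idx2_le idx1_less_idx2[OF assms] by (auto simp: not_le[symmetric])
  then show ?thesis by simp
qed

lemma Pi_plane_iff: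
  fixes D :: "'n::{finite,linorder} sqmat"
  assumes n: "CARD('n) > 1"
  shows "D \<in> Pi_plane \<longleftrightarrow> D \<in> Dg \<and> D $ idx1 $ idx1 = D $ idx2 $ idx2"
proof
  assume "D \<in> Pi_plane"
  then obtain l ms where D: "D = diag_list (l # l # ms)" by (auto simp: Pi_plane_def)
  then have "D $ idx1 $ idx1 = l" "D $ idx2 $ idx2 = l"
    using card_less_idx1[where 'n = 'n] card_less_idx2[OF n] by (simp_all add: diag_list_def)
  then show "D \<in> Dg \<and> D $ idx1 $ idx1 = D $ idx2 $ idx2" by (simp add: D Dg_def diag_list_def)
next
  assume D: "D \<in> Dg \<and> D $ idx1 $ idx1 = D $ idx2 $ idx2"
  define xs :: "'n list" where "xs = sorted_list_of_set UNIV"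
  define ys where "ys = map (\<lambda>k. D $ k $ k) xs"
  have len: "length xs = CARD('n)" by (simp add: xs_def)
  have nth: "xs ! card {k. k < i} = i \<and> card {k. k < i} < CARD('n)" for i
    using ex_nth_sorted_list[of i] card_less_sorted_list[where 'n = 'n] unfolding xs_def by metis
  then have ys: "ys ! card {k. k < i} = D $ i $ i" for i using len by (simp add: ys_def)
  have "D = diag_list ys" using D ys by (auto simp: vec_eq_iff diag_list_def Dg_def)
  moreover have "\<exists>ms. ys = ys ! 0 # ys ! 1 # ms \<and> length ms = CARD('n) - 2"
  proof (intro exI[of _ "drop 2 ys"] conjI)
    show "ys = ys ! 0 # ys ! 1 # drop 2 ys"
      using n len by (cases ys; cases "tl ys") (auto simp: ys_def)
  qed (simp add: ys_def len)
  moreover have "ys ! 0 = ys ! 1"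
    using ys[of idx1] ys[of idx2] card_less_idx1[where 'n = 'n] card_less_idx2[OF n] D by simp
  ultimately show "D \<in> Pi_plane" unfolding Pi_plane_def by (metis (mono_tags, lifting) mem_Collect_eq)
qed

lemma ex_bij_first_two:
  assumes "CARD('n::{finite,linorder}) > 1" "i \<noteq> j"
  shows "\<exists>\<sigma> :: 'n \<Rightarrow> 'n. bij \<sigma> \<and> \<sigma> idx1 = i \<and> \<sigma> idx2 = j"
proof -
  let ?s = "Transposition.transpose idx1 i"
  \<comment> \<open>The inner swap fixes \<open>idx1\<close> and sends \<open>idx2\<close> to
    \<open>?s j\<close>; the outer swap, being its own inverse, then gives \<open>i\<close> and
    \<open>j\<close>.\<close>
  let ?\<sigma> = "?s \<circ> Transposition.transpose idx2 (?s j)"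
  have ne: "idx1 \<noteq> (idx2 :: 'n)" using idx1_less_idx2[OF assms(1)] by auto
  have "?s j \<noteq> idx1" using assms(2) by (auto simp: Transposition.transpose_def)
  then have "?\<sigma> idx1 = i" using ne by (simp add: Transposition.transpose_def)
  moreover have "?\<sigma> idx2 = j" by simp
  moreover have "bij ?\<sigma>" by (intro bij_comp bij_transpose)
  ultimately show ?thesis by blast
qed

text \<open>A permutation matrix may have determinant -1 and so lie outside \<open>SO\<close>.
  Equality of the spectra gives membership in the orbit for every permutation.\<close>

lemma Dg_permute_Orbit:
  fixes D :: "'n::{finite,linorder} sqmat"
  assumes "D \<in> Dg" "bij \<sigma>"
  shows "(\<chi> a b. if a = b then D $ \<sigma> a $ \<sigma> a else 0) \<in> Orbit D"
proof -
  let ?E = "\<chi> a b. if a = b then D $ \<sigma> a $ \<sigma> a else 0"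
  have E: "?E \<in> Dg" by (simp add: Dg_def)
  have "spectrum ?E = (\<Sum>i\<in>UNIV. {#D $ \<sigma> i $ \<sigma> i#})" by (simp add: spectrum_Dg[OF E])
  also have "\<dots> = (\<Sum>i\<in>UNIV. {#D $ i $ i#})" by (rule sum.reindex_bij_betw[OF assms(2)])
  finally have "spectrum ?E = spectrum D" by (simp add: spectrum_Dg assms(1))
  then have "Orbit ?E = Orbit D" using Orbit_eq_iff_spectrum E assms(1) Dg_Sym by blast
  then show ?thesis using Orbit_refl by blast
qed

lemma MM_conj_Pi_plane:
  fixes X :: "'n::{finite,linorder} sqmat"
  assumes n: "CARD('n) > 1" and X: "X \<in> MM"
  obtains g D where "g \<in> SO" "D \<in> Pi_plane" "X = conj_by g D"
proof -
  have "X \<in> Sym" using X MM_subset_Sym by blast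
  then obtain g D where gD: "g \<in> SO" "D \<in> Dg" "X = conj_by g D" by (rule Sym_diagonalize)
  have "D \<in> MM" using X gD MM_conj_by by blast
  then obtain i j where ij: "i \<noteq> j" "D $ i $ i = D $ j $ j"
    using MM_iff multiple_eigenvalue_Dg_iff[OF gD(2)] by metis
  obtain \<sigma> :: "'n \<Rightarrow> 'n" where \<sigma>: "bij \<sigma>" "\<sigma> idx1 = i" "\<sigma> idx2 = j" using ex_bij_first_two[OF n ij(1)] by blast
  let ?E = "\<chi> a b. if a = b then D $ \<sigma> a $ \<sigma> a else 0"
  have "?E \<in> Orbit D" by (rule Dg_permute_Orbit[OF gD(2) \<sigma>(1)])
  then obtain h where h: "h \<in> SO" "?E = conj_by h D" by (auto simp: Orbit_def)
  have "conj_by (transpose h) ?E = D" unfolding h(2) by (rule conj_by_inverse(1)[OF h(1)])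
  then have "X = conj_by (g ** transpose h) ?E"
    unfolding gD(3) conj_by_conj_by[symmetric] by (intro arg_cong[of _ _ "conj_by g"]) (rule sym)
  moreover have "?E \<in> Pi_plane" using ij(2) \<sigma>(2,3) by (simp add: Pi_plane_iff[OF n] Dg_def)
  ultimately show ?thesis using that SO_mult[OF gD(1) SO_transpose[OF h(1)]] by blast
qed

lemma Pi_plane_subset_MM:
  assumes n: "CARD('n) > 1" shows "Pi_plane \<subseteq> (MM :: 'n::{finite,linorder} sqmat set)"
proof
  fix D :: "'n sqmat" assume "D \<in> Pi_plane"
  then have D: "D \<in> Dg" "D $ idx1 $ idx1 = D $ idx2 $ idx2" using Pi_plane_iff[OF n] by auto
  then have "multiple_eigenvalue D (D $ idx1 $ idx1)"
    using multiple_eigenvalue_Dg_iff[OF D(1)] idx1_less_idx2[OF n] by (metis less_irrefl)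
  then show "D \<in> MM" using D(1) Dg_Sym MM_iff by blast
qed

lemma DO_image:
  assumes n: "CARD('n::{finite,linorder}) > 1" and card_m: "CARD('n) = CARD('m::{finite,linorder}) + 2"
  shows "(DO :: 'm plane_coords \<times> 'n sqmat \<Rightarrow> 'n sqmat) ` (UNIV \<times> SO) = MM"
proof -
  have "(DO :: 'm plane_coords \<times> 'n sqmat \<Rightarrow> 'n sqmat) ` (UNIV \<times> SO) =
      {conj_by g D | g D. g \<in> SO \<and> D \<in> range (diag_coords :: 'm plane_coords \<Rightarrow> 'n sqmat)}"
    unfolding DO_def by force
  also have "\<dots> = {conj_by g D | g D. g \<in> SO \<and> D \<in> Pi_plane}"
    by (simp add: range_diag_coords[OF card_m])
  also have "\<dots> = MM"
  proof (intro equalityI subsetI)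
    fix X :: "'n sqmat" assume "X \<in> MM"
    then show "X \<in> {conj_by g D | g D. g \<in> SO \<and> D \<in> Pi_plane}" by (rule MM_conj_Pi_plane[OF n]) blast
  qed (use Pi_plane_subset_MM[OF n] MM_conj_by in auto)
  finally show ?thesis .
qed

lemma polynomial_function_DO:
  assumes card_m: "CARD('n::{finite,linorder}) = CARD('m::{finite,linorder}) + 2"
  shows "polynomial_function (DO :: 'm plane_coords \<times> 'n sqmat \<Rightarrow> 'n sqmat)"
proof -
  have "real_polynomial_function (\<lambda>x :: 'm plane_coords \<times> 'n sqmat. snd x $ i $ j)" for i j
    by (intro real_polynomial_function.intros(1) bounded_linear_compose[OF bounded_linear_vec_nth]
        bounded_linear_compose[OF bounded_linear_vec_nth bounded_linear_snd])
  moreover from this have "real_polynomial_function (\<lambda>x :: 'm plane_coords \<times> 'n sqmat. transpose (snd x) $ i $ j)" for i j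
    by (simp add: transpose_def)
  moreover have "real_polynomial_function (\<lambda>x :: 'm plane_coords \<times> 'n sqmat. (diag_coords (fst x) :: 'n sqmat) $ i $ j)" for i j
  proof (cases "i = j")
    case True
    let ?q = "card {k. k < i}"
    have q: "?q < CARD('m) + 2"
      using card_m psubset_card_mono[of "UNIV :: 'n set" "{k. k < i}"] by auto
    define xs :: "'m list" where "xs = sorted_list_of_set UNIV"
    have len: "length xs = CARD('m)" by (simp add: xs_def)
    have eq: "(diag_coords (fst x) :: 'n sqmat) $ i $ j =
        (fst (fst x) # fst (fst x) # map (\<lambda>k. snd (fst x) $ k) xs) ! ?q" for x :: "'m plane_coords \<times> 'n sqmat"
      using True by (simp add: diag_coords_def diag_list_def case_prod_beta xs_def)
    have fst: "real_polynomial_function (\<lambda>x :: 'm plane_coords \<times> 'n sqmat. fst (fst x))"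
      by (intro real_polynomial_function.intros(1) bounded_linear_compose[OF bounded_linear_fst bounded_linear_fst])
    have snd: "real_polynomial_function (\<lambda>x :: 'm plane_coords \<times> 'n sqmat. snd (fst x) $ k)" for k
      by (intro real_polynomial_function.intros(1) bounded_linear_compose[OF bounded_linear_vec_nth]
          bounded_linear_compose[OF bounded_linear_snd bounded_linear_fst])
    consider "?q = 0" | "?q = 1" | r where "?q = Suc (Suc r)" by (metis One_nat_def not0_implies_Suc)
    then show ?thesis
    proof cases
      case (3 r)
      then have "r < length xs" using q len by simp
      then show ?thesis using snd[of "xs ! r"] unfolding eq 3 by simp
    qed (simp_all add: eq fst)
  qed (simp add: diag_coords_def diag_list_def case_prod_beta real_polynomial_function.intros(2))
  ultimately show ?thesis
    unfolding DO_def conj_by_def case_prod_beta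
    by (intro polynomial_function_matrix real_polynomial_function_matrix_mult)
qed

subsection \<open>Algebraic sets\<close>

lemma real_polynomial_function_if:
  "real_polynomial_function f \<Longrightarrow> real_polynomial_function g \<Longrightarrow>
    real_polynomial_function (\<lambda>x. if c then f x else g x)"
  by (cases c) simp_all

lemma real_polynomial_function_coeff_mult:
  assumes "\<And>k. real_polynomial_function (\<lambda>x. coeff (p x) k)" "\<And>k. real_polynomial_function (\<lambda>x. coeff (q x) k)"
  shows "real_polynomial_function (\<lambda>x. coeff (p x * q x) k)"
  unfolding coeff_mult by (intro real_polynomial_function_sum real_polynomial_function.intros(4) assms) auto

lemma real_polynomial_function_coeff_prod:
  assumes "\<And>i k. real_polynomial_function (\<lambda>x. coeff (p i x) k)"
  shows "real_polynomial_function (\<lambda>x. coeff (\<Prod>i\<in>I. p i x) k)"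
proof (induction I arbitrary: k rule: infinite_finite_induct)
  case (insert i I)
  then show ?case
    using real_polynomial_function_coeff_mult[OF assms[of i], of "\<lambda>x. \<Prod>i\<in>I. p i x"] by simp
qed (auto simp: real_polynomial_function.intros(2))

lemma real_polynomial_function_coeff_charpoly:
  "real_polynomial_function (\<lambda>X :: 'n::finite sqmat. coeff (charpoly X) k)"
  unfolding charpoly_def det_def coeff_sum
proof (intro real_polynomial_function_sum real_polynomial_function_coeff_mult real_polynomial_function_coeff_prod)
  fix \<sigma> :: "'n \<Rightarrow> 'n" and i k
  show "real_polynomial_function (\<lambda>X :: 'n sqmat.
      coeff ((\<chi> i j. if i = j then [:- X $ i $ j, 1:] else [:- X $ i $ j:]) $ i $ \<sigma> i) k)"
    using real_polynomial_function_nth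
    by (cases k; cases "i = \<sigma> i")
      (auto simp: coeff_pCons real_polynomial_function.intros(2) split: nat.splits intro!: real_polynomial_function_minus)
qed (auto simp: real_polynomial_function.intros(2))

lemma real_polynomial_function_coeff_pderiv:
  "(\<And>k. real_polynomial_function (\<lambda>x. coeff (p x) k)) \<Longrightarrow> real_polynomial_function (\<lambda>x. coeff (pderiv (p x)) k)"
  by (simp add: coeff_pderiv real_polynomial_function.intros)

lemma real_polynomial_function_resultant_sub:
  assumes "\<And>k. real_polynomial_function (\<lambda>x. coeff (p x) k)" "\<And>k. real_polynomial_function (\<lambda>x. coeff (q x) k)"
  shows "real_polynomial_function (\<lambda>x. resultant_sub m n (p x) (q x))"
proof -
  have "real_polynomial_function (\<lambda>x. (sylvester_mat_sub m n (p x) (q x)) $$ (i, \<sigma> i))"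
    if "i < m + n" "\<sigma> permutes {0..<m + n}" for i \<sigma>
  proof -
    have "\<sigma> i < m + n" using that permutes_in_image[OF that(2), of i] by simp
    then show ?thesis
      by (subst sylvester_mat_sub_index)
        (use that(1) in \<open>auto intro!: real_polynomial_function_if real_polynomial_function.intros(2) assms\<close>)
  qed
  then show ?thesis
    unfolding resultant_sub_def
    by (subst det_def'[OF sylvester_mat_sub_carrier])
      (intro real_polynomial_function_sum real_polynomial_function.intros(2,4) real_polynomial_function_prod,
        auto simp: finite_permutations)
qed

lemma algebraic_set_Int:
  assumes "algebraic_set S" "algebraic_set T" shows "algebraic_set (S \<inter> T)"
proof -
  obtain P Q where "\<forall>p \<in> P. real_polynomial_function p" "S = {x. \<forall>p \<in> P. p x = 0}"
    "\<forall>p \<in> Q. real_polynomial_function p" "T = {x. \<forall>p \<in> Q. p x = 0}"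
    using assms by (auto simp: algebraic_set_def)
  then show ?thesis unfolding algebraic_set_def by (intro exI[of _ "P \<union> Q"]) auto
qed

lemma algebraic_set_zeros:
  assumes "\<And>i. real_polynomial_function (p i)"
  shows "algebraic_set {x. \<forall>i. p i x = 0}"
  unfolding algebraic_set_def using assms by (intro exI[of _ "range p"]) auto

lemma algebraic_set_Sym: "algebraic_set (Sym :: 'n::finite sqmat set)"
proof -
  have "Sym = {X :: 'n sqmat. \<forall>i. (\<lambda>X. X $ fst i $ snd i - X $ snd i $ fst i) X = 0}"
    by (auto simp: Sym_nth) (auto simp: Sym_def transpose_def vec_eq_iff)
  also have "algebraic_set \<dots>"
    by (intro algebraic_set_zeros real_polynomial_function_diff real_polynomial_function_nth)
  finally show ?thesis .
qed

text \<open>The size of a Sylvester matrix depends on the degrees. On \<open>Sym\<close> these are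
  constantly n and n - 1, so \<open>resultant_sub\<close> with fixed sizes gives one polynomial
  equation.\<close>

lemma algebraic_set_MM: "algebraic_set (MM :: 'n::{finite,linorder} sqmat set)"
proof -
  let ?r = "\<lambda>X :: 'n sqmat. resultant_sub CARD('n) (CARD('n) - 1) (charpoly X) (pderiv (charpoly X))"
  \<comment> \<open>The index type \<open>unit\<close> presents a single equation as a family, the
    form expected by \<open>algebraic_set_zeros\<close>.\<close>
  have "MM = Sym \<inter> {X. \<forall>i :: unit. ?r X = 0}"
  proof -
    have "X \<in> MM \<longleftrightarrow> ?r X = 0" if "X \<in> Sym" for X
      using that discriminant_charpoly_eq_0_iff[OF that] degree_charpoly[OF that]
      by (simp add: MM_def resultant_sub degree_pderiv)
    then show ?thesis using MM_subset_Sym by blast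
  qed
  also have "algebraic_set \<dots>"
    by (intro algebraic_set_Int algebraic_set_Sym algebraic_set_zeros real_polynomial_function_resultant_sub
        real_polynomial_function_coeff_pderiv real_polynomial_function_coeff_charpoly)
  finally show ?thesis .
qed

text \<open>The characteristic polynomial determines the spectrum and hence the orbit, so its
  coefficients supply the equations.\<close>

lemma algebraic_set_Orbit:
  fixes A :: "'n::{finite,linorder} sqmat"
  assumes A: "A \<in> Sym" shows "algebraic_set (Orbit A)"
proof -
  have "Orbit A = Sym \<inter> {X. \<forall>k. coeff (charpoly X) k - coeff (charpoly A) k = 0}"
  proof -
    have "X \<in> Orbit A \<longleftrightarrow> charpoly X = charpoly A" if "X \<in> Sym" for X
    proof
      show "X \<in> Orbit A \<Longrightarrow> charpoly X = charpoly A" by (rule charpoly_Orbit)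
      assume "charpoly X = charpoly A"
      then have "Orbit X = Orbit A" using Orbit_eq_iff_spectrum[OF that A] by (simp add: spectrum_def)
      then show "X \<in> Orbit A" using Orbit_refl[of X] by simp
    qed
    moreover have "(\<forall>k. coeff (charpoly X) k - coeff (charpoly A) k = 0) \<longleftrightarrow> charpoly X = charpoly A" for X
      by (simp add: poly_eq_iff)
    ultimately show ?thesis using Orbit_Sym[OF A] by blast
  qed
  also have "algebraic_set \<dots>"
    by (intro algebraic_set_Int algebraic_set_Sym algebraic_set_zeros real_polynomial_function_diff
        real_polynomial_function_coeff_charpoly real_polynomial_function.intros(2))
  finally show ?thesis .
qed

text \<open>On the line joining the two points both functions are nonzero polynomials in one
  variable; so is their product, which is therefore nonzero somewhere.\<close>

lemma real_polynomial_functions_common_nonzero: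
  fixes p q :: "'a::real_normed_vector \<Rightarrow> real"
  assumes p: "real_polynomial_function p" "p x \<noteq> 0" and q: "real_polynomial_function q" "q y \<noteq> 0"
  shows "\<exists>z. p z \<noteq> 0 \<and> q z \<noteq> 0"
proof -
  define l where "l t = x + t *\<^sub>R (y - x)" for t :: real
  have l: "polynomial_function l"
    unfolding l_def by (intro polynomial_function_add polynomial_function_const polynomial_function_bounded_linear
        bounded_linear_scaleR_left)
  have "\<exists>P. \<forall>t. f (l t) = poly P t" if "real_polynomial_function f" for f
  proof -
    have "real_polynomial_function (f \<circ> l)" using l that by (rule real_polynomial_function_compose)
    then obtain a n where "f \<circ> l = (\<lambda>t. \<Sum>i\<le>n. a i * t ^ i)"
      using real_polynomial_function_imp_sum by blast
    then have "f (l t) = poly (\<Sum>i\<le>n. monom (a i) i) t" for t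
      by (simp add: fun_eq_iff poly_sum poly_monom)
    then show ?thesis by blast
  qed
  then obtain P Q where P: "\<And>t. p (l t) = poly P t" and Q: "\<And>t. q (l t) = poly Q t" using p(1) q(1) by metis
  have "P \<noteq> 0" using P[of 0] p(2) by (auto simp: l_def)
  moreover have "Q \<noteq> 0" using Q[of 1] q(2) by (auto simp: l_def)
  ultimately obtain t where "poly (P * Q) t \<noteq> 0" by (metis mult_eq_0_iff poly_all_0_iff_0)
  then show ?thesis using P Q by (intro exI[of _ "l t"]) auto
qed

text \<open>Equations that separate the two pieces from the image pull back along \<open>G\<close>
  to nonzero polynomial functions on a vector space, and these have a common point where neither
  vanishes.\<close>

lemma irreducible_polynomial_image:
  fixes G :: "'a::euclidean_space \<Rightarrow> 'b::euclidean_space"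
  assumes G: "polynomial_function G" and alg: "algebraic_set (range G)"
  shows "irreducible_algebraic_set (range G)"
  unfolding irreducible_algebraic_set_def
proof (intro conjI alg notI, elim exE conjE)
  fix A B assume A: "algebraic_set A" "A \<noteq> range G" and B: "algebraic_set B" "B \<noteq> range G"
    and AB: "range G = A \<union> B"
  have "\<exists>p x. real_polynomial_function p \<and> (\<forall>z\<in>C. p z = 0) \<and> p (G x) \<noteq> 0"
    if C: "algebraic_set C" "C \<noteq> range G" "C \<subseteq> range G" for C
  proof -
    obtain P where P: "\<forall>p \<in> P. real_polynomial_function p" "C = {x. \<forall>p \<in> P. p x = 0}"
      using C(1) by (auto simp: algebraic_set_def)
    obtain x where "G x \<notin> C" using C(2,3) by blast
    then show ?thesis using P by blast
  qed
  then obtain p x q y where p: "real_polynomial_function p" "\<forall>z\<in>A. p z = 0" "p (G x) \<noteq> 0"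
    and q: "real_polynomial_function q" "\<forall>z\<in>B. q z = 0" "q (G y) \<noteq> 0"
    using A B AB by (metis Un_upper1 Un_upper2)
  obtain z where "p (G z) \<noteq> 0" "q (G z) \<noteq> 0"
    using real_polynomial_functions_common_nonzero[of "p \<circ> G" x "q \<circ> G" y]
      real_polynomial_function_compose[OF G] p q by auto
  then show False using p(2) q(2) AB by blast
qed

text \<open>Dropping the orthogonality of \<open>g\<close> turns the map \<open>DO\<close>, written as
  \<open>\<lambda>E + g diag(0, 0, \<mu>\<^sub>1 - \<lambda>, \<dots>) g\<^sup>*\<close>, into a polynomial map from a vector space
  with the same image.\<close>

lemma irreducible_MM:
  assumes n: "CARD('n::{finite,linorder}) > 1"
  shows "irreducible_algebraic_set (MM :: 'n sqmat set)"
proof -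
  define C0 where "C0 C = (\<chi> i j. if i = j \<and> i \<noteq> idx1 \<and> i \<noteq> idx2 then C $ i $ i else 0)" for C :: "'n sqmat"
  define G where "G = (\<lambda>(l :: real, C, S :: 'n sqmat). l *\<^sub>R mat 1 + conj_by S (C0 C))"
  have ne: "idx1 \<noteq> (idx2 :: 'n)" using idx1_less_idx2[OF n] by auto
  have "polynomial_function G"
  proof -
    have 1: "real_polynomial_function (\<lambda>x :: real \<times> 'n sqmat \<times> 'n sqmat. fst x)"
      by (intro real_polynomial_function.intros(1) bounded_linear_fst)
    have 2: "real_polynomial_function (\<lambda>x :: real \<times> 'n sqmat \<times> 'n sqmat. fst (snd x) $ i $ j)"
      "real_polynomial_function (\<lambda>x :: real \<times> 'n sqmat \<times> 'n sqmat. snd (snd x) $ i $ j)" for i j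
      by (intro real_polynomial_function.intros(1) bounded_linear_compose[OF bounded_linear_vec_nth]
        bounded_linear_compose[OF bounded_linear_fst bounded_linear_snd]
        bounded_linear_compose[OF bounded_linear_snd bounded_linear_snd])+
    have "real_polynomial_function (\<lambda>x :: real \<times> 'n sqmat \<times> 'n sqmat.
        (fst x *\<^sub>R mat 1 + snd (snd x) ** C0 (fst (snd x)) ** transpose (snd (snd x))) $ i $ j)" for i j
      unfolding vector_add_component vector_scaleR_component real_scaleR_def
      by (intro real_polynomial_function.intros(2-4) 1 real_polynomial_function_matrix_mult)
        (auto simp: 2 C0_def transpose_def intro!: 2 real_polynomial_function_if real_polynomial_function.intros(2))
    then show ?thesis
      unfolding G_def conj_by_def case_prod_beta by (rule polynomial_function_matrix)
  qed
  moreover have "range G = MM"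
  proof (intro equalityI subsetI)
    fix X assume "X \<in> range G"
    then obtain l C S where X: "X = l *\<^sub>R mat 1 + conj_by S (C0 C)" by (auto simp: G_def)
    have "C0 C \<in> Sym" by (auto simp: Sym_def C0_def transpose_def vec_eq_iff)
    then have "X \<in> Sym"
      using conj_by_Sym[of "C0 C" S] unfolding X Sym_def
      by (simp add: linear_add[OF linear_transpose] linear_scale[OF linear_transpose] transpose_mat)
    moreover have "multiple_eigenvalue X l"
      unfolding multiple_eigenvalue_def
    proof
      fix y :: "(real, 'n) Finite_Cartesian_Product.vec"
      \<comment> \<open>The zero row makes \<open>A\<close> singular even if \<open>S\<close> is
        invertible. A kernel vector is orthogonal to \<open>y\<close>, and
        \<open>transpose S\<close> maps it to a vector supported on the first two indices, which
        \<open>C0 C\<close> annihilates.\<close>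
      define A where "A = (\<chi> i. if i = idx1 then y else if i = idx2 then 0 else transpose S $ i)"
      have "row idx2 A = 0" using ne by (auto simp: A_def row_def vec_eq_iff)
      then have "det A = 0" by (rule det_zero_row)
      then have "\<not> (\<exists>B. B ** A = mat 1)" using invertible_det_nz invertible_left_inverse by blast
      then obtain u where u: "A *v u = 0" "u \<noteq> 0" using matrix_left_invertible_ker by blast
      have Au: "A $ i \<bullet> u = 0" for i
        using arg_cong[OF u(1), of "\<lambda>v. v $ i"] by (simp add: matrix_vector_mult_def inner_vec_def)
      have "y \<bullet> u = 0" using Au[of idx1] by (simp add: A_def)
      moreover have "(transpose S *v u) $ i = 0" if "i \<noteq> idx1" "i \<noteq> idx2" for i
        using Au[of i] that by (simp add: A_def matrix_vector_mult_def inner_vec_def)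
      then have "C0 C *v (transpose S *v u) = 0"
        using Dg_mult_vector[of "C0 C"] by (auto simp: vec_eq_iff Dg_def C0_def)
      then have "X *v u = l *\<^sub>R u"
        unfolding X conj_by_def
        by (simp add: matrix_vector_mult_add_rdistrib scaleR_matrix_vector_assoc[symmetric]
            matrix_vector_mul_assoc[symmetric])
      ultimately show "\<exists>u. u \<noteq> 0 \<and> y \<bullet> u = 0 \<and> X *v u = l *\<^sub>R u" using u(2) by blast
    qed
    ultimately show "X \<in> MM" using MM_iff by blast
  next
    fix X :: "'n sqmat" assume "X \<in> MM"
    then obtain g D where gD: "g \<in> SO" "D \<in> Pi_plane" "X = conj_by g D" by (rule MM_conj_Pi_plane[OF n])
    let ?l = "D $ idx1 $ idx1"
    have D: "D \<in> Dg" "D $ idx2 $ idx2 = ?l" using gD(2) Pi_plane_iff[OF n] by auto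
    \<comment> \<open>After the double eigenvalue is subtracted, the first two diagonal entries are
      0, so \<open>C0\<close> changes nothing.\<close>
    have "D = ?l *\<^sub>R mat 1 + C0 (D - ?l *\<^sub>R mat 1)"
      using D by (auto simp: vec_eq_iff C0_def mat_def Dg_def)
    then have "conj_by g D = conj_by g (?l *\<^sub>R mat 1 + C0 (D - ?l *\<^sub>R mat 1))" by (rule arg_cong)
    also have "\<dots> = ?l *\<^sub>R conj_by g (mat 1) + conj_by g (C0 (D - ?l *\<^sub>R mat 1))"
      by (simp only: linear_add[OF linear_conj_by] linear_scale[OF linear_conj_by])
    also have "conj_by g (mat 1) = mat 1" using gD(1) by (simp add: conj_by_def SO_iff)
    finally have "X = ?l *\<^sub>R mat 1 + conj_by g (C0 (D - ?l *\<^sub>R mat 1))" using gD(3) by simp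
    then have "X = G (?l, D - ?l *\<^sub>R mat 1, g)" by (simp add: G_def)
    then show "X \<in> range G" by blast
  qed
  ultimately show ?thesis using irreducible_polynomial_image[of G] algebraic_set_MM by simp
qed

subsection \<open>The cylinder and the spheres\<close>

lemma inner_mat1: "inner (mat 1) X = trace X" for X :: "'n::finite sqmat"
proof -
  have "mat 1 $ i \<bullet> X $ i = X $ i $ i" for i
    by (simp add: inner_vec_def mat_def if_distrib[of "\<lambda>c. c * _"] cong: if_cong)
  then show ?thesis by (simp add: inner_vec_def[of "mat 1"] trace_def)
qed

lemma Scal_Sym: "c *\<^sub>R mat 1 \<in> Sym"
  by (simp add: Sym_def linear_scale[OF linear_transpose] transpose_mat)

lemma Sym_add: "X \<in> Sym \<Longrightarrow> Y \<in> Sym \<Longrightarrow> X + Y \<in> Sym"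
  by (simp add: Sym_def linear_add[OF linear_transpose])

lemma trace_add_Scal: "trace (X + c *\<^sub>R mat 1) = trace X + c * CARD('n)" for X :: "'n::finite sqmat"
  by (simp add: trace_def mat_def sum.distrib)

lemma MM_add_Scal:
  fixes X :: "'n::{finite,linorder} sqmat"
  assumes "X \<in> MM" shows "X + c *\<^sub>R mat 1 \<in> MM"
proof -
  obtain l where l: "multiple_eigenvalue X l" "X \<in> Sym" using assms MM_iff by blast
  have "multiple_eigenvalue (X + c *\<^sub>R mat 1) (l + c)"
    using l(1) unfolding multiple_eigenvalue_def
    by (simp add: matrix_vector_mult_add_rdistrib scaleR_matrix_vector_assoc[symmetric] scaleR_left_distrib)
  then show ?thesis using Sym_add[OF l(2) Scal_Sym] MM_iff by blast
qed

lemma hyperplane_trace: "hyperplane_orth_Scal {X \<in> Sym. trace X = s}"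
  unfolding hyperplane_orth_Scal_def
proof (intro bexI exI)
  show "{X \<in> Sym. trace X = s} = {X \<in> Sym. inner (mat 1) X = s}" by (simp add: inner_mat1)
  have "(mat 1 :: 'a sqmat) \<noteq> 0"
    by (simp add: vec_eq_iff mat_def)
  then show "(mat 1 :: 'a sqmat) \<in> Scal - {0}"
    unfolding Scal_def by (auto intro: exI[of _ 1])
qed

lemma straight_cylinder_MM: "straight_cylinder_Scal (MM :: 'n::{finite,linorder} sqmat set) (MM_level 0)"
  unfolding straight_cylinder_Scal_def
proof
  show "\<exists>H. hyperplane_orth_Scal H \<and> (MM_level 0 :: 'n sqmat set) \<subseteq> H"
    using hyperplane_trace[of 0] MM_subset_Sym unfolding MM_level_def by blast
  show "(MM :: 'n sqmat set) = {X + Y | X Y. X \<in> MM_level 0 \<and> Y \<in> Scal}"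
  proof (intro equalityI subsetI)
    fix X :: "'n sqmat" assume X: "X \<in> MM"
    let ?c = "trace X / CARD('n)"
    have "X + (- ?c) *\<^sub>R mat 1 \<in> MM_level 0"
      unfolding MM_level_def using MM_add_Scal[OF X, of "- ?c"] trace_add_Scal[of X "- ?c"] by simp
    moreover have "?c *\<^sub>R mat 1 \<in> Scal" by (auto simp: Scal_def)
    moreover have "X = (X + (- ?c) *\<^sub>R mat 1) + ?c *\<^sub>R mat 1" by simp
    ultimately show "X \<in> {X + Y | X Y. X \<in> MM_level 0 \<and> Y \<in> Scal}" by blast
  qed (auto simp: MM_level_def Scal_def MM_add_Scal)
qed

lemma trace_conj_by:
  assumes "g \<in> SO" shows "trace (conj_by g X) = trace X"
  using assms trace_mul_sym[of "g ** X" "transpose g"]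
  by (simp add: conj_by_def matrix_mul_assoc SO_iff)

text \<open>The centre is the scalar matrix with the trace of \<open>A\<close>. Conjugation fixes it
  and is an isometry. The radius is positive because a scalar matrix has one eigenvalue, fewer than
  n - 1 when n > 2.\<close>

lemma Orbit_in_sphere:
  fixes A :: "'n::finite sqmat"
  assumes n: "CARD('n) > 2" and A: "A \<in> MH"
  shows "\<exists>H C r. hyperplane_orth_Scal H \<and> C \<in> H \<and> r > 0 \<and> Orbit A \<subseteq> H \<inter> sphere C r"
proof (intro exI conjI)
  let ?C = "(trace A / CARD('n)) *\<^sub>R mat 1 :: 'n sqmat" and ?H = "{X \<in> Sym. trace X = trace A}"
  show "hyperplane_orth_Scal ?H" by (rule hyperplane_trace)
  show "?C \<in> ?H" using Scal_Sym trace_add_Scal[of "0 :: 'n sqmat" "trace A / CARD('n)"] by (simp add: trace_def)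
  have "A \<noteq> ?C"
  proof
    assume AC: "A = ?C"
    let ?c = "trace A / CARD('n)"
    have D: "?C \<in> Dg" by (auto simp: Dg_def mat_def)
    have "range (\<lambda>i. ?C $ i $ i) = {?c}" by (auto simp: mat_def)
    then have "card (range (\<lambda>i. ?C $ i $ i)) = 1" by simp
    then show False using A AC MH_Dg_iff[OF D] n by simp
  qed
  then show "dist A ?C > 0" by simp
  have "conj_by g A \<in> sphere ?C (dist A ?C)" if g: "g \<in> SO" for g
  proof -
    have "conj_by g ?C = ?C"
      using g linear_scale[OF linear_conj_by, of g] by (simp add: conj_by_def SO_iff)
    then show ?thesis using dist_conj_by[OF g, of A ?C] by (simp add: dist_commute)
  qed
  then show "Orbit A \<subseteq> ?H \<inter> sphere ?C (dist A ?C)"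
    using A MH_subset_Sym conj_by_Sym trace_conj_by by (auto simp: Orbit_def)
qed

section \<open>The special orthogonal group as a manifold\<close>

subsection \<open>The Cayley transform\<close>

text \<open>When the inverse exists, this is (E + K)^-1 (E - K), written so that only the inverse
  depends on \<open>K\<close>.\<close>

definition cayley :: "'n::finite sqmat \<Rightarrow> 'n sqmat" where
  "cayley K = 2 *\<^sub>R matrix_inv (mat 1 + K) - mat 1"

lemma transpose_add: "transpose (A + B) = transpose A + transpose (B :: real^'n::finite^'m::finite)"
  by (rule linear_add[OF linear_transpose])

lemma transpose_diff: "transpose (A - B) = transpose A - transpose (B :: real^'n::finite^'m::finite)"
  by (rule linear_diff[OF linear_transpose])

lemmas matrix_mult_add_left = bounded_bilinear.add_left[OF bounded_bilinear_matrix_mult]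
  and matrix_mult_add_right = bounded_bilinear.add_right[OF bounded_bilinear_matrix_mult]
  and matrix_mult_diff_left = bounded_bilinear.diff_left[OF bounded_bilinear_matrix_mult]
  and matrix_mult_diff_right = bounded_bilinear.diff_right[OF bounded_bilinear_matrix_mult]
  and matrix_mult_scaleR_left = bounded_bilinear.scaleR_left[OF bounded_bilinear_matrix_mult]
  and matrix_mult_scaleR_right = bounded_bilinear.scaleR_right[OF bounded_bilinear_matrix_mult]
  and matrix_mult_minus_left = bounded_bilinear.minus_left[OF bounded_bilinear_matrix_mult]
  and matrix_mult_minus_right = bounded_bilinear.minus_right[OF bounded_bilinear_matrix_mult]

text \<open>A skew matrix sends each \<open>v\<close> to a vector orthogonal to \<open>v\<close>, so
  K v = -v forces v = 0.\<close>

lemma invertible_mat1_plus_skew: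
  fixes K :: "'n::finite sqmat"
  assumes "transpose K = - K"
  shows "(mat 1 + K) ** matrix_inv (mat 1 + K) = mat 1" "matrix_inv (mat 1 + K) ** (mat 1 + K) = mat 1"
proof -
  have "v = 0" if v: "(mat 1 + K) *v v = 0" for v
  proof -
    have "K *v v = - v"
      using v by (simp add: matrix_vector_mult_add_rdistrib add_eq_0_iff)
    have "v \<bullet> (K *v v) = (transpose K *v v) \<bullet> v"
      by (simp add: dot_lmul_matrix[symmetric])
    also have "transpose K *v v = - (K *v v)"
      unfolding assms by (simp add: vec_eq_iff matrix_vector_mult_def sum_negf)
    finally have "v \<bullet> v = 0" unfolding \<open>K *v v = - v\<close> by simp
    then show ?thesis by simp
  qed
  then have "\<exists>B. B ** (mat 1 + K) = mat 1" by (simp add: matrix_left_invertible_ker)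
  then have "invertible (mat 1 + K)" by (simp add: invertible_left_inverse)
  then show "(mat 1 + K) ** matrix_inv (mat 1 + K) = mat 1" "matrix_inv (mat 1 + K) ** (mat 1 + K) = mat 1"
    using someI_ex[of "\<lambda>A'. (mat 1 + K) ** A' = mat 1 \<and> A' ** (mat 1 + K) = mat 1"]
    unfolding invertible_def matrix_inv_def by auto
qed

lemma cayley_SO:
  fixes K :: "'n::finite sqmat"
  assumes K: "transpose K = - K" shows "cayley K \<in> SO"
proof (rule SO_I)
  let ?P = "matrix_inv (mat 1 + K)"
  have P: "(mat 1 + K) ** ?P = mat 1" "?P ** (mat 1 + K) = mat 1"
    using invertible_mat1_plus_skew[OF K] by auto
  have T: "transpose (mat 1 + K) = mat 1 - K" by (simp add: transpose_add transpose_mat K)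
  have "?P ** (mat 1 - K) = ?P ** (2 *\<^sub>R mat 1 - (mat 1 + K))"
    by (simp add: scaleR_2)
  also have "\<dots> = cayley K"
    unfolding matrix_mult_diff_right P matrix_mult_scaleR_right by (simp add: cayley_def)
  finally have c: "cayley K = ?P ** (mat 1 - K)" by (rule sym)
  have T': "transpose (mat 1 - K) = mat 1 + K" by (simp add: transpose_diff transpose_mat K)
  have "transpose (?P ** (mat 1 + K)) = mat 1" unfolding P by (simp add: transpose_mat)
  then have P': "(mat 1 - K) ** transpose ?P = mat 1" by (simp add: matrix_transpose_mul T)
  have comm: "(mat 1 - K) ** (mat 1 + K) = (mat 1 + K) ** (mat 1 - K)"
    by (simp add: matrix_mult_add_left matrix_mult_add_right matrix_mult_diff_left matrix_mult_diff_right)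
  have "cayley K ** transpose (cayley K) = ?P ** ((mat 1 - K) ** (mat 1 + K)) ** transpose ?P"
    unfolding c matrix_transpose_mul T' by (simp add: matrix_mul_assoc)
  also have "\<dots> = (?P ** (mat 1 + K)) ** ((mat 1 - K) ** transpose ?P)"
    unfolding comm by (simp add: matrix_mul_assoc)
  finally show "cayley K ** transpose (cayley K) = mat 1" unfolding P P' by simp
  \<comment> \<open>The two factors of the Cayley transform are transposes of each other up to
    inversion, so their determinants cancel.\<close>
  have "det (mat 1 - K) = det (mat 1 + K)" using det_transpose[of "mat 1 + K"] by (simp add: T)
  then have "det (cayley K) = det (?P ** (mat 1 + K))" unfolding c by (simp add: det_mul)
  then show "det (cayley K) = 1" unfolding P by simp
qed

lemma cayley_0: "cayley 0 = mat 1"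
proof -
  have "(mat 1 :: 'a sqmat) ** matrix_inv (mat 1) = mat 1"
    using invertible_mat1_plus_skew(1)[of "0 :: 'a sqmat"] by (simp add: transpose_def vec_eq_iff)
  then show ?thesis by (simp add: cayley_def scaleR_2)
qed

lemma cayley_smooth:
  fixes \<kappa> :: "'a::euclidean_space \<Rightarrow> 'n::finite sqmat"
  assumes lin: "linear \<kappa>" and skew: "\<And>z. transpose (\<kappa> z) = - \<kappa> z"
  shows "smooth_on_open (\<lambda>z. cayley (\<kappa> z)) UNIV"
    and "\<kappa> z0 = 0 \<Longrightarrow> ((\<lambda>z. cayley (\<kappa> z)) has_derivative (\<lambda>h. - 2 *\<^sub>R \<kappa> h)) (at z0)"
proof -
  have bl: "bounded_linear \<kappa>" using lin linear_conv_bounded_linear by blast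
  \<comment> \<open>Matrices act on matrices by left multiplication; the inverse matrix is the
    inverse operator applied to \<open>mat 1\<close>.\<close>
  interpret inverse_family "\<lambda>z X. (mat 1 + \<kappa> z) ** X" "\<lambda>z X. matrix_inv (mat 1 + \<kappa> z) ** X" UNIV
  proof (rule inverse_family.intro)
    show "linear (\<lambda>X. (mat 1 + \<kappa> z) ** X)" for z
      using bounded_bilinear.bounded_linear_right[OF bounded_bilinear_matrix_mult] bounded_linear.linear by blast
    show "(mat 1 + \<kappa> z) ** (matrix_inv (mat 1 + \<kappa> z) ** w) = w"
      "matrix_inv (mat 1 + \<kappa> z) ** ((mat 1 + \<kappa> z) ** w) = w" for z w
      using invertible_mat1_plus_skew[OF skew[of z]] by (simp_all add: matrix_mul_assoc)
  qed simp
  have sM: "smooth_on_open (\<lambda>z. (mat 1 + \<kappa> z) ** v) UNIV" for v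
    by (intro smooth_on_open_bilinear[OF bounded_bilinear_matrix_mult] smooth_on_open_add smooth_on_open_const
        smooth_on_open_linear[OF bl]) auto
  then have sCk: "Ck_on k (\<lambda>z. (mat 1 + \<kappa> z) ** v) UNIV" for k v
    unfolding smooth_on_open_def by blast
  have Ck: "Ck_on k (\<lambda>z. matrix_inv (mat 1 + \<kappa> z) ** w) UNIV" for k w
    by (rule N_Ck_on[OF sCk])
  have "smooth_on_open (\<lambda>z. matrix_inv (mat 1 + \<kappa> z)) UNIV"
    using Ck[of _ "mat 1"] by (simp add: smooth_on_open_def)
  then have "smooth_on_open (\<lambda>z. 2 *\<^sub>R matrix_inv (mat 1 + \<kappa> z) + (- mat 1)) UNIV"
    by (intro smooth_on_open_add smooth_on_open_const smooth_on_open_linear_compose[OF bounded_linear_scaleR_right]) auto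
  then show "smooth_on_open (\<lambda>z. cayley (\<kappa> z)) UNIV" by (simp add: cayley_def)
  assume z0: "\<kappa> z0 = 0"
  have inv1: "matrix_inv (mat 1 + \<kappa> z0) = mat 1"
    using invertible_mat1_plus_skew(1)[OF skew[of z0]] z0 by simp
  have "((\<lambda>z. (mat 1 + \<kappa> z) ** (mat 1)) has_derivative (\<lambda>h. \<kappa> h)) (at z0)"
    using has_derivative_add[OF has_derivative_const[of "mat 1"] bounded_linear_imp_has_derivative[OF bl]] by simp
  then have "((\<lambda>z. matrix_inv (mat 1 + \<kappa> z) ** mat 1) has_derivative
      (\<lambda>h. - (matrix_inv (mat 1 + \<kappa> z0) ** \<kappa> h))) (at z0)"
    using N_has_derivative[OF smooth_on_open_continuous_on[OF sM] UNIV_I, of z0 "mat 1" \<kappa>] by (simp add: inv1)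
  then have "((\<lambda>z. matrix_inv (mat 1 + \<kappa> z)) has_derivative (\<lambda>h. - \<kappa> h)) (at z0)"
    by (simp add: inv1)
  then have "((\<lambda>z. 2 *\<^sub>R matrix_inv (mat 1 + \<kappa> z) - mat 1) has_derivative (\<lambda>h. 2 *\<^sub>R (- \<kappa> h) - 0)) (at z0)"
    by (intro has_derivative_diff has_derivative_scaleR_right has_derivative_const)
  then show "((\<lambda>z. cayley (\<kappa> z)) has_derivative (\<lambda>h. - 2 *\<^sub>R \<kappa> h)) (at z0)"
    by (simp add: cayley_def)
qed

subsection \<open>Coordinate subspaces\<close>

definition coord_subspace :: "('n \<times> 'n) set \<Rightarrow> 'n::finite sqmat set" where
  "coord_subspace I = {Z. \<forall>i j. (i, j) \<notin> I \<longrightarrow> Z $ i $ j = 0}"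

lemma subspace_coord_subspace: "subspace (coord_subspace I)"
  by (simp add: coord_subspace_def subspace_def)

lemma dim_coord_subspace: "dim (coord_subspace I :: 'n::finite sqmat set) = card I"
proof -
  let ?b = "\<lambda>(i, j). axis i (axis j 1) :: 'n sqmat"
  have inj: "inj_on ?b I" by (auto simp: inj_on_def axis_eq_axis)
  have sub: "?b ` I \<subseteq> Basis" by (auto simp: Basis_vec_def)
  have "coord_subspace I = {Z :: 'n sqmat. \<forall>b\<in>Basis. b \<notin> ?b ` I \<longrightarrow> Z \<bullet> b = 0}"
  proof (intro equalityI subsetI)
    fix Z :: "'n sqmat" assume Z: "Z \<in> coord_subspace I"
    show "Z \<in> {Z. \<forall>b\<in>Basis. b \<notin> ?b ` I \<longrightarrow> Z \<bullet> b = 0}"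
    proof safe
      fix b :: "'n sqmat" assume b: "b \<in> Basis" "b \<notin> ?b ` I"
      then obtain i j where ij: "b = axis i (axis j 1)" by (auto simp: Basis_vec_def)
      then have "(i, j) \<notin> I" using b(2) by force
      then show "Z \<bullet> b = 0" using Z by (simp add: ij inner_axis coord_subspace_def)
    qed
  next
    fix Z :: "'n sqmat" assume Z: "Z \<in> {Z. \<forall>b\<in>Basis. b \<notin> ?b ` I \<longrightarrow> Z \<bullet> b = 0}"
    show "Z \<in> coord_subspace I"
      unfolding coord_subspace_def
    proof safe
      fix i j assume "(i, j) \<notin> I"
      then have "?b (i, j) \<notin> ?b ` I" by (auto simp: axis_eq_axis)
      moreover have "?b (i, j) \<in> Basis" by (auto simp: Basis_vec_def)
      ultimately have "Z \<bullet> ?b (i, j) = 0" using Z by blast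
      then show "Z $ i $ j = 0" by (simp add: inner_axis)
    qed
  qed
  then show ?thesis using dim_substandard[OF sub] card_image[OF inj] by simp
qed

lemma card_less_pairs: "2 * card {(i, j). i < (j :: 'n::{finite,linorder})} + CARD('n) = CARD('n) * CARD('n)"
proof -
  let ?A = "{(i, j). i < (j :: 'n)}"
  have "card ((\<lambda>(i, j). (j, i)) ` ?A) = card ?A" by (rule card_image) (auto simp: inj_on_def)
  moreover have "card ((\<lambda>i. (i, i)) ` (UNIV :: 'n set)) = CARD('n)" by (rule card_image) (auto simp: inj_on_def)
  moreover have UNIV_eq: "(UNIV :: ('n \<times> 'n) set) = (?A \<union> (\<lambda>(i, j). (j, i)) ` ?A) \<union> (\<lambda>i. (i, i)) ` UNIV"
    by (auto simp: image_iff)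
  moreover have "card ((?A \<union> (\<lambda>(i, j). (j, i)) ` ?A) \<union> (\<lambda>i. (i, i)) ` UNIV) =
      card ?A + card ((\<lambda>(i, j). (j, i)) ` ?A) + card ((\<lambda>i. (i, i)) ` (UNIV :: 'n set))"
    by (subst card_Un_disjoint; (subst card_Un_disjoint)?) auto
  moreover have "card (UNIV :: ('n \<times> 'n) set) = CARD('n) * CARD('n)" by simp
  ultimately show ?thesis using arg_cong[OF UNIV_eq, of card] by linarith
qed

lemma card_less_pairs': "card {(i, j). i < (j :: 'n::{finite,linorder})} = CARD('n) * (CARD('n) - 1) div 2"
proof -
  have "2 * card {(i, j). i < (j :: 'n)} = CARD('n) * (CARD('n) - 1)"
    using card_less_pairs[where 'n = 'n] by (simp add: diff_mult_distrib2)
  then show ?thesis by simp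
qed

subsection \<open>\<open>SO(n)\<close> as a submanifold\<close>

text \<open>The entries of one matrix serve as coordinates of the ambient space: one triangle
  encodes a skew matrix, the other a complementary summand, skew or symmetric depending on the
  chart.\<close>

definition upper_skew :: "'n::{finite,linorder} sqmat \<Rightarrow> 'n sqmat" where
  "upper_skew Z = (\<chi> i j. if i < j then Z $ i $ j else if j < i then - Z $ j $ i else 0)"

definition lower_skew :: "'n::{finite,linorder} sqmat \<Rightarrow> 'n sqmat" where
  "lower_skew Z = (\<chi> i j. if j < i then Z $ i $ j else if i < j then - Z $ j $ i else 0)"

definition lower_sym :: "'n::{finite,linorder} sqmat \<Rightarrow> 'n sqmat" where
  "lower_sym Z = (\<chi> i j. if j \<le> i then Z $ i $ j else Z $ j $ i)"

lemma linear_upper_skew: "linear upper_skew"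
  and linear_lower_skew: "linear lower_skew"
  and linear_lower_sym: "linear lower_sym"
  by (rule linearI; simp add: vec_eq_iff upper_skew_def lower_skew_def lower_sym_def)+

lemma transpose_upper_skew: "transpose (upper_skew Z) = - upper_skew Z"
  and transpose_lower_skew: "transpose (lower_skew Z) = - lower_skew Z"
  and transpose_lower_sym: "transpose (lower_sym Z) = lower_sym Z"
  by (auto simp: vec_eq_iff upper_skew_def lower_skew_def lower_sym_def transpose_def)

lemma skew_plus_sym_eq_0:
  fixes K :: "'n::finite sqmat"
  assumes "transpose K = - K" "transpose S = S" "K + S = 0"
  shows "K = 0" "S = 0"
proof -
  have "S = - K" using assms(3) by (simp add: add_eq_0_iff)
  then have "S = transpose K" using assms(1) by simp
  also have "\<dots> = - S" using \<open>S = - K\<close> assms(2) linear_neg[OF linear_transpose, of K] by simp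
  finally show "S = 0" by (simp add: eq_neg_iff_add_eq_0 flip: scaleR_2)
  then show "K = 0" using assms(3) by simp
qed

lemma norm_matrix_vector_mult_le: "norm (A *v v) \<le> norm A * norm v" for A :: "real^'n::finite^'m::finite"
proof -
  have "\<bar>(A *v v) $ i\<bar> \<le> norm (A $ i) * norm v" for i
    using Cauchy_Schwarz_ineq2[of "A $ i" v] by (simp add: matrix_vector_mult_def inner_vec_def)
  then have "norm (A *v v) \<le> L2_set (\<lambda>i. norm (A $ i) * norm v) UNIV"
    unfolding norm_vec_def by (intro L2_set_mono) auto
  also have "\<dots> = norm A * norm v"
    by (simp add: L2_set_left_distrib norm_vec_def[of A])
  finally show ?thesis .
qed

text \<open>Near \<open>g0\<close> a matrix is written as a rotation times E + S with S symmetric,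
  in the manner of a polar decomposition. It lies in \<open>SO\<close> iff S = 0: a symmetric
  orthogonal E + S has square E, so S has only the eigenvalues 0 and -2, and -2 is too
  large.\<close>

lemma smooth_submanifold_SO:
  "smooth_submanifold (CARD('n) * (CARD('n) - 1) div 2) (SO :: 'n::{finite,linorder} sqmat set)"
  unfolding smooth_submanifold_iff
proof
  fix g0 :: "'n sqmat" assume g0: "g0 \<in> SO"
  define \<Theta> where "\<Theta> z = g0 ** (cayley (upper_skew z) ** (mat 1 + lower_sym z))" for z :: "'n sqmat"
  note cay = cayley_smooth[OF linear_upper_skew transpose_upper_skew]
  have bl: "bounded_linear (lower_sym :: 'n sqmat \<Rightarrow> _)"
    using linear_lower_sym linear_conv_bounded_linear by blast
  have blg: "bounded_linear (\<lambda>X. g0 ** X)"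
    by (rule bounded_bilinear.bounded_linear_right[OF bounded_bilinear_matrix_mult])
  have z0: "upper_skew (0 :: 'n sqmat) = 0" "lower_sym (0 :: 'n sqmat) = 0"
    using linear_0[OF linear_upper_skew] linear_0[OF linear_lower_sym] .
  have smooth: "smooth_on_open \<Theta> UNIV"
    unfolding \<Theta>_def
    by (intro smooth_on_open_linear_compose[OF blg] smooth_on_open_bilinear[OF bounded_bilinear_matrix_mult] cay(1)
        smooth_on_open_add smooth_on_open_const smooth_on_open_linear[OF bl]) auto
  let ?D = "\<lambda>h. g0 ** (- 2 *\<^sub>R upper_skew h + lower_sym h)"
  have "((\<lambda>z :: 'n sqmat. cayley (upper_skew z) ** (mat 1 + lower_sym z)) has_derivative
      (\<lambda>h. cayley (upper_skew 0) ** (0 + lower_sym h) + (- 2 *\<^sub>R upper_skew h) ** (mat 1 + lower_sym 0))) (at 0)"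
    by (intro bounded_bilinear.FDERIV[OF bounded_bilinear_matrix_mult] cay(2) z0(1) has_derivative_add
        has_derivative_const bounded_linear_imp_has_derivative bl)
  then have "(\<Theta> has_derivative ?D) (at 0)"
    unfolding \<Theta>_def using bounded_linear.has_derivative[OF blg] by (force simp: z0 cayley_0 add.commute)
  from frechet_derivative_at[OF this] have fd: "frechet_derivative \<Theta> (at 0) = ?D" by (rule sym)
  have "inj ?D"
  proof (rule linear_inj_on_iff_eq_0[THEN iffD2, of _ UNIV, simplified])
    show "linear ?D" using \<open>(\<Theta> has_derivative ?D) (at 0)\<close> has_derivative_linear by blast
    show "\<forall>h. ?D h = 0 \<longrightarrow> h = 0"
    proof (intro allI impI)
      fix h assume "?D h = 0"
      then have "transpose g0 ** ?D h = 0" by (simp add: bounded_bilinear.zero_right[OF bounded_bilinear_matrix_mult])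
      then have "- 2 *\<^sub>R upper_skew h + lower_sym h = 0"
        using g0 by (simp add: matrix_mul_assoc SO_iff)
      moreover have "transpose (- 2 *\<^sub>R upper_skew h) = - (- 2 *\<^sub>R upper_skew h)"
        unfolding linear_scale[OF linear_transpose] transpose_upper_skew by simp
      ultimately have eq: "- 2 *\<^sub>R upper_skew h = 0" "lower_sym h = 0"
        using skew_plus_sym_eq_0[OF _ transpose_lower_sym] by blast+
      have "h $ i $ j = 0" for i j
      proof (cases "i < j")
        case True
        then show ?thesis using arg_cong[OF eq(1), of "\<lambda>X. X $ i $ j"] by (simp add: upper_skew_def)
      next
        case False
        then show ?thesis using arg_cong[OF eq(2), of "\<lambda>X. X $ i $ j"] by (simp add: lower_sym_def not_less)
      qed
      then show "h = 0" by (simp add: vec_eq_iff)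
    qed
  qed
  \<comment> \<open>The bound 2 excludes the eigenvalue -2 of \<open>lower_sym z\<close>, since the
    entrywise norm dominates the operator norm.\<close>
  define U where "U = {z :: 'n sqmat. norm (lower_sym z) < 2}"
  have U: "open U"
    unfolding U_def by (intro open_Collect_less continuous_intros linear_continuous_on bl)
  let ?L = "coord_subspace {(i, j). i < j} :: 'n sqmat set"
  have key: "\<Theta> z \<in> SO \<longleftrightarrow> z - 0 \<in> ?L" if z: "z \<in> U" for z
  proof -
    let ?S = "lower_sym z" and ?c = "cayley (upper_skew z)"
    have c: "?c \<in> SO" by (rule cayley_SO[OF transpose_upper_skew])
    have L: "z \<in> ?L \<longleftrightarrow> ?S = 0"
      by (auto simp: coord_subspace_def lower_sym_def vec_eq_iff not_less)
    have "?S = 0" if "\<Theta> z \<in> SO"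
    proof -
      have gc: "g0 ** ?c \<in> SO" using SO_mult[OF g0 c] .
      have "transpose (g0 ** ?c) ** \<Theta> z \<in> SO" using SO_mult[OF SO_transpose[OF gc] that] .
      moreover have "transpose (g0 ** ?c) ** \<Theta> z = mat 1 + ?S"
      proof -
        have "transpose (g0 ** ?c) ** \<Theta> z = (transpose (g0 ** ?c) ** (g0 ** ?c)) ** (mat 1 + ?S)"
          unfolding \<Theta>_def matrix_mul_assoc ..
        also have "transpose (g0 ** ?c) ** (g0 ** ?c) = mat 1" using gc SO_iff by blast
        finally show ?thesis by simp
      qed
      ultimately have "(mat 1 + ?S) ** (mat 1 + ?S) = mat 1"
        by (simp add: SO_iff transpose_add transpose_mat transpose_lower_sym)
      then have S2: "?S ** ?S = - (2 *\<^sub>R ?S)"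
        by (simp add: matrix_mult_add_left matrix_mult_add_right scaleR_2 algebra_simps add_eq_0_iff2)
      have "?S *v v = 0" for v
      proof (rule ccontr)
        let ?w = "?S *v v"
        assume "?w \<noteq> 0"
        have "?S *v ?w = - (2 *\<^sub>R ?w)"
          unfolding matrix_vector_mul_assoc S2
          by (simp add: vec_eq_iff matrix_vector_mult_def sum_negf sum_distrib_left mult.assoc)
        then have "2 * norm ?w \<le> norm ?S * norm ?w" using norm_matrix_vector_mult_le[of ?S ?w] by simp
        then show False using z \<open>?w \<noteq> 0\<close> by (simp add: U_def)
      qed
      then show ?thesis by (simp add: matrix_eq)
    qed
    moreover have "\<Theta> z \<in> SO" if "?S = 0" using SO_mult[OF g0 c] by (simp add: \<Theta>_def that)
    ultimately show ?thesis using L by auto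
  qed
  have "submanifold_at (dim ?L) SO (\<Theta> 0)"
    using submanifold_at_chart[OF smooth_on_open_subset[OF smooth U] _ _ subspace_coord_subspace key] \<open>inj ?D\<close> fd z0(2)
    by (simp add: U_def)
  then show "submanifold_at (CARD('n) * (CARD('n) - 1) div 2) SO g0"
    by (simp add: dim_coord_subspace card_less_pairs' \<Theta>_def z0 cayley_0)
qed

section \<open>The smooth part\<close>

subsection \<open>Charts adapted to the orbits\<close>

text \<open>Near a diagonal matrix \<open>D\<^sub>0\<close> in \<open>\<Pi> \<inter> \<M>\<H>\<close> every matrix is
  \<open>g B g\<^sup>* + R\<close> with \<open>g\<close> the Cayley transform of a skew matrix without \<open>(1, 2)\<close>
  entry, \<open>B\<close> diagonal up to its \<open>(1, 2)\<close> entries, and \<open>R\<close> skew. The coordinates are the entries of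
  one matrix \<open>Z\<close>: those above the diagonal other than \<open>(1, 2)\<close> give \<open>g\<close>, those below it
  give \<open>R\<close>, and the rest gives \<open>B\<close>, with \<open>Z\<^sub>2\<^sub>2 = B\<^sub>2\<^sub>2 - B\<^sub>1\<^sub>1\<close>.\<close>

definition rot_part :: "'n::{finite,linorder} sqmat \<Rightarrow> 'n sqmat" where
  "rot_part Z = (\<chi> i j. if {i, j} = {idx1, idx2} then 0 else upper_skew Z $ i $ j)"

definition core :: "'n::{finite,linorder} sqmat \<Rightarrow> 'n sqmat" where
  "core Z = (\<chi> i j. if i = j then (if i = idx2 then Z $ idx1 $ idx1 + Z $ idx2 $ idx2 else Z $ i $ i)
     else if {i, j} = {idx1, idx2} then Z $ idx1 $ idx2 else 0)"

text \<open>A linear section of \<open>core\<close> over \<open>Pi_plane\<close>: the entry at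
  \<open>idx2\<close> is 0 because this coordinate stores the difference of the first two diagonal
  entries.\<close>

definition diag_lift :: "'n::{finite,linorder} sqmat \<Rightarrow> 'n sqmat" where
  "diag_lift D = (\<chi> i j. if i = j then (if i = idx2 then 0 else D $ i $ i) else 0)"

definition off_diag :: "'n::finite sqmat \<Rightarrow> 'n sqmat" where
  "off_diag Z = (\<chi> i j. if i = j then 0 else Z $ i $ j)"

definition orbit_chart :: "'n::{finite,linorder} sqmat \<Rightarrow> 'n sqmat" where
  "orbit_chart Z = conj_by (cayley (rot_part Z)) (core Z) + lower_skew Z"

definition orbit_coords :: "('n::{finite,linorder} \<times> 'n) set" where
  "orbit_coords = {(i, j). i < j} - {(idx1, idx2)}"

text \<open>The two omitted entries on or above the diagonal are the deviations of the leading block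
  of \<open>core\<close> from a scalar block; the omitted lower ones describe the skew
  summand.\<close>

definition MH_coords :: "('n::{finite,linorder} \<times> 'n) set" where
  "MH_coords = {(i, j). i \<le> j} - {(idx1, idx2), (idx2, idx2)}"

lemma linear_rot_part: "linear rot_part"
  and linear_core: "linear core"
  and linear_diag_lift: "linear diag_lift"
  and linear_off_diag: "linear off_diag"
  by (rule linearI; simp add: vec_eq_iff rot_part_def core_def diag_lift_def off_diag_def upper_skew_def
      algebra_simps)+

lemma transpose_rot_part: "transpose (rot_part Z) = - rot_part Z"
proof -
  have "upper_skew Z $ j $ i = - upper_skew Z $ i $ j" for i j
    by (cases i j rule: linorder_cases) (auto simp: upper_skew_def)
  note u = this
  have "rot_part Z $ j $ i = - rot_part Z $ i $ j" for i j
  proof -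
    have d: "{j, i} = {i, j}" by (rule insert_commute)
    show ?thesis unfolding rot_part_def vec_lambda_beta d u[of j i]
      by (cases "{i, j} = {idx1, idx2}") (simp_all only: if_True if_False simp_thms minus_zero)
  qed
  then show ?thesis
    unfolding vec_eq_iff transpose_def vec_lambda_beta vector_uminus_component by blast
qed

lemma core_Sym: "core Z \<in> Sym"
proof -
  have "core Z $ j $ i = core Z $ i $ j" for i j
  proof -
    have d: "{j, i} = {i, j}" by (rule insert_commute)
    show ?thesis unfolding core_def vec_lambda_beta d by (cases "i = j") simp_all
  qed
  then show ?thesis by (simp add: Sym_def vec_eq_iff transpose_def)
qed

lemma linear_imp_bounded: "linear f \<Longrightarrow> bounded_linear f"
  for f :: "'a::euclidean_space \<Rightarrow> 'b::real_normed_vector"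
  by (simp add: linear_conv_bounded_linear)

lemma smooth_orbit_chart: "smooth_on_open orbit_chart UNIV"
proof -
  have "smooth_on_open (\<lambda>Z. conj_by (cayley (rot_part Z)) (core Z) + lower_skew Z) (UNIV :: 'a sqmat set)"
    unfolding conj_by_def
    by (intro smooth_on_open_add smooth_on_open_bilinear[OF bounded_bilinear_matrix_mult]
        smooth_on_open_linear_compose[OF bounded_linear_transpose]
        cayley_smooth(1)[OF linear_rot_part transpose_rot_part]
        smooth_on_open_linear[OF linear_imp_bounded[OF linear_core]]
        smooth_on_open_linear[OF linear_imp_bounded[OF linear_lower_skew]]) auto
  moreover have "orbit_chart = (\<lambda>Z :: 'a sqmat. conj_by (cayley (rot_part Z)) (core Z) + lower_skew Z)"
    by (rule ext) (rule orbit_chart_def)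
  ultimately show ?thesis by simp
qed

text \<open>On the plane the value at \<open>idx2\<close> is a repetition, so having n - 1
  eigenvalues means injectivity on the other n - 1 indices.\<close>

lemma Pi_MH_iff:
  fixes D :: "'n::{finite,linorder} sqmat"
  assumes n: "CARD('n) > 1" and D: "D \<in> Pi_plane"
  shows "D \<in> MH \<longleftrightarrow> (\<forall>a b. a \<noteq> b \<longrightarrow> D $ a $ a = D $ b $ b \<longrightarrow> {a, b} = {idx1, idx2})"
proof -
  let ?d = "\<lambda>i. D $ i $ i"
  have D': "D \<in> Dg" "?d idx1 = ?d idx2" using D Pi_plane_iff[OF n] by auto
  have ne: "idx1 \<noteq> (idx2 :: 'n)" using idx1_less_idx2[OF n] by auto
  have "?d i \<in> ?d ` (UNIV - {idx2})" for i
  proof (cases "i = idx2")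
    case True
    then show ?thesis using D'(2) ne by (intro image_eqI[of _ _ idx1]) auto
  qed auto
  then have range: "range ?d = ?d ` (UNIV - {idx2})" by blast
  have cardU: "card (UNIV - {idx2 :: 'n}) = CARD('n) - 1" by (rule card_Diff_singleton) simp
  have "D \<in> MH \<longleftrightarrow> card (?d ` (UNIV - {idx2})) = card (UNIV - {idx2 :: 'n})"
    using MH_Dg_iff[OF D'(1)] unfolding range cardU .
  also have "\<dots> \<longleftrightarrow> inj_on ?d (UNIV - {idx2})"
    by (rule inj_on_iff_eq_card[symmetric]) simp
  also have "\<dots> \<longleftrightarrow> (\<forall>a b. a \<noteq> b \<longrightarrow> ?d a = ?d b \<longrightarrow> {a, b} = {idx1, idx2})"
  proof
    assume inj: "inj_on ?d (UNIV - {idx2})"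
    show "\<forall>a b. a \<noteq> b \<longrightarrow> ?d a = ?d b \<longrightarrow> {a, b} = {idx1, idx2}"
    proof (intro allI impI)
      fix a b assume ab: "a \<noteq> b" "?d a = ?d b"
      show "{a, b} = {idx1, idx2}"
      proof (cases "a = idx2")
        case True
        have "?d b = ?d idx1" unfolding ab(2)[symmetric] True D'(2) ..
        moreover have "b \<in> UNIV - {idx2}" "(idx1 :: 'n) \<in> UNIV - {idx2}" using ab(1) True ne by blast+
        ultimately have "b = idx1" by (rule inj_onD[OF inj])
        then show ?thesis using True by blast
      next
        case False
        then have a: "a \<in> UNIV - {idx2}" "(idx1 :: 'n) \<in> UNIV - {idx2}" using ne by blast+
        have b: "b = idx2" using inj_onD[OF inj ab(2) a(1)] ab(1) by blast
        have "?d a = ?d idx1" unfolding ab(2) b D'(2) ..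
        then have "a = idx1" using a by (rule inj_onD[OF inj])
        then show ?thesis using b by blast
      qed
    qed
  next
    assume *: "\<forall>a b. a \<noteq> b \<longrightarrow> ?d a = ?d b \<longrightarrow> {a, b} = {idx1, idx2}"
    show "inj_on ?d (UNIV - {idx2})"
    proof (rule inj_onI, rule ccontr)
      fix a b assume "a \<in> UNIV - {idx2}" "b \<in> UNIV - {idx2}" "?d a = ?d b" "a \<noteq> b"
      then have "idx2 \<in> {a, b}" using * by blast
      then show False using \<open>a \<in> UNIV - {idx2}\<close> \<open>b \<in> UNIV - {idx2}\<close> by auto
    qed
  qed
  finally show ?thesis .
qed

lemma core_mult_vector:
  fixes Z :: "'n::{finite,linorder} sqmat"
  assumes n: "CARD('n) > 1"
  shows "k \<noteq> idx1 \<Longrightarrow> k \<noteq> idx2 \<Longrightarrow> (core Z *v u) $ k = core Z $ k $ k * u $ k"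
    and "(core Z *v u) $ idx1 = core Z $ idx1 $ idx1 * u $ idx1 + Z $ idx1 $ idx2 * u $ idx2"
    and "(core Z *v u) $ idx2 = Z $ idx1 $ idx2 * u $ idx1 + core Z $ idx2 $ idx2 * u $ idx2"
proof -
  have ne: "idx1 \<noteq> (idx2 :: 'n)" using idx1_less_idx2[OF n] by auto
  have *: "(core Z *v u) $ k = (\<Sum>j\<in>UNIV. core Z $ k $ j * u $ j)" for k
    by (simp add: matrix_vector_mult_def)
  have "(\<Sum>j\<in>UNIV. core Z $ k $ j * u $ j) = (\<Sum>j\<in>{k}. core Z $ k $ j * u $ j)" if "k \<noteq> idx1" "k \<noteq> idx2"
    by (rule sum.mono_neutral_right) (use that in \<open>auto simp: core_def\<close>)
  then show "k \<noteq> idx1 \<Longrightarrow> k \<noteq> idx2 \<Longrightarrow> (core Z *v u) $ k = core Z $ k $ k * u $ k" by (simp add: *)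
  have "(\<Sum>j\<in>UNIV. core Z $ k $ j * u $ j) = (\<Sum>j\<in>{idx1, idx2}. core Z $ k $ j * u $ j)"
    if "k = idx1 \<or> k = idx2" for k
    by (rule sum.mono_neutral_right) (use that in \<open>auto simp: core_def\<close>)
  then show "(core Z *v u) $ idx1 = core Z $ idx1 $ idx1 * u $ idx1 + Z $ idx1 $ idx2 * u $ idx2"
    "(core Z *v u) $ idx2 = Z $ idx1 $ idx2 * u $ idx1 + core Z $ idx2 $ idx2 * u $ idx2"
    unfolding * using ne insert_commute[of "idx2 :: 'n" idx1 "{}"] by (simp_all add: core_def)
qed

text \<open>If an eigenvalue coming from a third diagonal entry were multiple, then it would also be an
  eigenvalue of the leading \<open>2 \<times> 2\<close> block, but that block minus the eigenvalue is diagonally dominant.\<close>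

lemma core_multiple_eigenvalue:
  fixes Z :: "'n::{finite,linorder} sqmat"
  assumes n: "CARD('n) > 1"
    and gap: "\<And>a b. a \<noteq> b \<Longrightarrow> {a, b} \<noteq> {idx1, idx2} \<Longrightarrow>
      \<bar>core Z $ a $ a - core Z $ b $ b\<bar> > \<bar>Z $ idx1 $ idx2\<bar>"
    and mult: "multiple_eigenvalue (core Z) c"
  shows "Z $ idx1 $ idx2 = 0" "Z $ idx2 $ idx2 = 0"
proof -
  let ?a = "\<lambda>i. core Z $ i $ i" and ?t = "Z $ idx1 $ idx2"
  have ne: "idx1 \<noteq> (idx2 :: 'n)" using idx1_less_idx2[OF n] by auto
  have ev: "\<exists>u. u \<noteq> 0 \<and> u $ k = 0 \<and> core Z *v u = c *\<^sub>R u" for k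
    using mult[unfolded multiple_eigenvalue_def, rule_format, of "axis k 1"] by (simp add: inner_axis')
  have ev_k: "(?a k - c) * u $ k = 0" if "core Z *v u = c *\<^sub>R u" "k \<noteq> idx1" "k \<noteq> idx2" for u k
    using arg_cong[OF that(1), of "\<lambda>v. v $ k"] core_mult_vector(1)[OF n that(2,3), of Z u] by (simp add: algebra_simps)
  have ev_1: "(?a idx1 - c) * u $ idx1 + ?t * u $ idx2 = 0"
    and ev_2: "?t * u $ idx1 + (?a idx2 - c) * u $ idx2 = 0" if "core Z *v u = c *\<^sub>R u" for u
    using arg_cong[OF that, of "\<lambda>v. v $ idx1"] arg_cong[OF that, of "\<lambda>v. v $ idx2"]
      core_mult_vector(2,3)[OF n, of Z u] by (simp_all add: algebra_simps)
  have no_other: "?a k \<noteq> c" if k: "k \<noteq> idx1" "k \<noteq> idx2" for k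
  proof
    assume kc: "?a k = c"
    obtain u where u: "u \<noteq> 0" "u $ k = 0" "core Z *v u = c *\<^sub>R u" using ev by blast
    have gap1: "\<bar>?a idx1 - c\<bar> > \<bar>?t\<bar>" and gap2: "\<bar>?a idx2 - c\<bar> > \<bar>?t\<bar>"
      using gap[of idx1 k] gap[of idx2 k] k kc by (auto simp: doubleton_eq_iff)
    have 1: "\<bar>?a idx1 - c\<bar> * \<bar>u $ idx1\<bar> = \<bar>?t\<bar> * \<bar>u $ idx2\<bar>"
      using ev_1[OF u(3)] by (metis abs_minus_cancel abs_mult add_eq_0_iff)
    have 2: "\<bar>?a idx2 - c\<bar> * \<bar>u $ idx2\<bar> = \<bar>?t\<bar> * \<bar>u $ idx1\<bar>"
      using ev_2[OF u(3)] by (metis abs_minus_cancel abs_mult add_eq_0_iff)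
    \<comment> \<open>Dominance of the diagonal makes each of the first two coordinates, if nonzero,
      strictly smaller than the other in absolute value. So both vanish.\<close>
    have le1: "\<bar>u $ idx1\<bar> \<le> \<bar>u $ idx2\<bar> \<and> (u $ idx1 \<noteq> 0 \<longrightarrow> \<bar>u $ idx1\<bar> < \<bar>u $ idx2\<bar>)"
    proof (cases "u $ idx1 = 0")
      case False
      then have "\<bar>?t\<bar> * \<bar>u $ idx1\<bar> < \<bar>?t\<bar> * \<bar>u $ idx2\<bar>"
        unfolding 1[symmetric] using gap1 by (intro mult_strict_right_mono) auto
      then have "\<bar>u $ idx1\<bar> < \<bar>u $ idx2\<bar>" by (metis abs_ge_zero mult_less_cancel_left not_less)
      then show ?thesis by simp
    qed simp
    have le2: "\<bar>u $ idx2\<bar> \<le> \<bar>u $ idx1\<bar> \<and> (u $ idx2 \<noteq> 0 \<longrightarrow> \<bar>u $ idx2\<bar> < \<bar>u $ idx1\<bar>)"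
    proof (cases "u $ idx2 = 0")
      case False
      then have "\<bar>?t\<bar> * \<bar>u $ idx2\<bar> < \<bar>?t\<bar> * \<bar>u $ idx1\<bar>"
        unfolding 2[symmetric] using gap2 by (intro mult_strict_right_mono) auto
      then have "\<bar>u $ idx2\<bar> < \<bar>u $ idx1\<bar>" by (metis abs_ge_zero mult_less_cancel_left not_less)
      then show ?thesis by simp
    qed simp
    have "u $ idx1 = 0" "u $ idx2 = 0" using le1 le2 by auto
    moreover have "u $ j = 0" if "j \<noteq> idx1" "j \<noteq> idx2" for j
    proof (cases "j = k")
      case False
      then have "?a j \<noteq> c" using gap[of j k] k that kc by (auto simp: doubleton_eq_iff)
      then show ?thesis using ev_k[OF u(3) that] by simp
    qed (use u in simp)
    ultimately have "u = 0" by (metis vec_eq_iff zero_index)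
    then show False using u(1) by blast
  qed
  have supp: "u $ k = 0" if "core Z *v u = c *\<^sub>R u" "k \<noteq> idx1" "k \<noteq> idx2" for u k
    using ev_k[OF that] no_other[OF that(2,3)] by simp
  \<comment> \<open>Eigenvectors along each of the first two axes force the leading block to be
    scalar: one shows that \<open>?t\<close> is 0, and together they give both diagonal
    entries.\<close>
  obtain u where u: "u \<noteq> 0" "u $ idx1 = 0" "core Z *v u = c *\<^sub>R u" using ev by blast
  then have "u $ idx2 \<noteq> 0" using supp[OF u(3)] by (metis vec_eq_iff zero_index)
  then have t: "?t = 0" and a2: "?a idx2 = c" using ev_1[OF u(3)] ev_2[OF u(3)] u(2) by auto
  obtain v where v: "v \<noteq> 0" "v $ idx2 = 0" "core Z *v v = c *\<^sub>R v" using ev by blast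
  then have "v $ idx1 \<noteq> 0" using supp[OF v(3)] by (metis vec_eq_iff zero_index)
  then have "?a idx1 = c" using ev_1[OF v(3)] v(2) by auto
  then show "?t = 0" "Z $ idx2 $ idx2 = 0" using t a2 ne by (auto simp: core_def)
qed

text \<open>Unlike a ball, a box constrains each entry separately. It therefore splits into a
  diagonal and an off-diagonal part, as the product structure of the fibration demands.\<close>

definition box_around :: "'n::finite sqmat \<Rightarrow> real \<Rightarrow> 'n sqmat set" where
  "box_around Z e = {X. \<forall>i j. \<bar>X $ i $ j - Z $ i $ j\<bar> < e}"

lemma open_box_around: "open (box_around Z e)"
proof -
  have "box_around Z e = (\<Inter>i. \<Inter>j. {X. \<bar>X $ i $ j - Z $ i $ j\<bar> < e})"
    by (auto simp: box_around_def)
  also have "open \<dots>"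
    by (intro open_INT ballI open_Collect_less continuous_intros) auto
  finally show ?thesis .
qed

lemma box_around_subset_open:
  fixes Z :: "'n::finite sqmat"
  assumes "open U" "Z \<in> U"
  shows "\<exists>e>0. box_around Z e \<subseteq> U"
proof -
  obtain d where d: "d > 0" "ball Z d \<subseteq> U" using assms by (meson openE)
  let ?n = "real CARD('n)"
  \<comment> \<open>The norm is at most the sum of the absolute values of all n * n entries.\<close>
  let ?e = "d / (?n * ?n)"
  have "box_around Z ?e \<subseteq> ball Z d"
  proof
    fix X assume X: "X \<in> box_around Z ?e"
    have "norm (X - Z) \<le> (\<Sum>i\<in>UNIV. norm ((X - Z) $ i))"
      unfolding norm_vec_def[of "X - Z"] by (rule L2_set_le_sum) simp
    also have "\<dots> \<le> (\<Sum>i\<in>UNIV. \<Sum>j\<in>UNIV. \<bar>(X - Z) $ i $ j\<bar>)"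
      by (intro sum_mono norm_le_l1_cart)
    also have "\<dots> < (\<Sum>i\<in>(UNIV :: 'n set). \<Sum>j\<in>(UNIV :: 'n set). ?e)"
      by (intro sum_strict_mono) (use X in \<open>auto simp: box_around_def\<close>)
    also have "\<dots> = d" by simp
    finally show "X \<in> ball Z d" by (simp add: dist_norm norm_minus_commute)
  qed
  then show ?thesis using d by (intro exI[of _ ?e]) (auto intro!: divide_pos_pos mult_pos_pos)
qed

text \<open>Equal entries of \<open>D\<close> and \<open>D'\<close> at positions \<open>a\<close>
  and \<open>b\<close> bring the corresponding entries of \<open>D0\<close> closer than 4 e. So the
  positions agree or are the first two, where \<open>D'\<close> is constant.\<close>

lemma near_diag_Orbit_eq:
  fixes D D' D0 :: "'n::{finite,linorder} sqmat"
  assumes n: "CARD('n) > 1"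
    and D: "D \<in> Pi_plane" "D' \<in> Pi_plane" "D \<in> Orbit D'"
    and gap: "\<And>a b. a \<noteq> b \<Longrightarrow> {a, b} \<noteq> {idx1, idx2} \<Longrightarrow> \<bar>D0 $ a $ a - D0 $ b $ b\<bar> \<ge> 4 * e"
    and near: "\<And>a. \<bar>D $ a $ a - D0 $ a $ a\<bar> < 2 * e" "\<And>a. \<bar>D' $ a $ a - D0 $ a $ a\<bar> < 2 * e"
  shows "D = D'"
proof -
  have Dg: "D \<in> Dg" "D' \<in> Dg" "D' $ idx1 $ idx1 = D' $ idx2 $ idx2"
    using D(1,2) Pi_plane_iff[OF n] by auto
  have "eigenvalues D = eigenvalues D'"
    using D(3) eigenvalues_conj_by by (auto simp: Orbit_def)
  then have ran: "range (\<lambda>i. D $ i $ i) = range (\<lambda>i. D' $ i $ i)" by (simp add: eigenvalues_Dg Dg)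
  have "D $ a $ a = D' $ a $ a" for a
  proof -
    have "D $ a $ a \<in> range (\<lambda>i. D $ i $ i)" by (rule rangeI)
    then obtain b where b: "D $ a $ a = D' $ b $ b" unfolding ran by (rule rangeE)
    have "\<bar>D0 $ a $ a - D0 $ b $ b\<bar> < 4 * e" using near(1)[of a] near(2)[of b] b by linarith
    then have "a = b \<or> {a, b} = {idx1, idx2}" using gap[of a b] not_le by blast
    then show ?thesis using b Dg(3) unfolding doubleton_eq_iff by metis
  qed
  then have "D $ i $ j = D' $ i $ j" for i j using Dg by (cases "i = j") (auto simp: Dg_def)
  then show ?thesis by (simp add: vec_eq_iff)
qed

text \<open>The margin 6 e is chosen for the chart: in a box of size \<open>e\<close> two diagonal
  entries of \<open>core\<close> move by less than 2 e each, which leaves more than 2 e, above the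
  off-diagonal entry.\<close>

lemma MH_gap:
  fixes D0 :: "'n::{finite,linorder} sqmat"
  assumes n: "CARD('n) > 1" and D0: "D0 \<in> Pi_plane" "D0 \<in> MH"
  shows "\<exists>e>0. \<forall>a b. a \<noteq> b \<longrightarrow> {a, b} \<noteq> {idx1, idx2} \<longrightarrow> \<bar>D0 $ a $ a - D0 $ b $ b\<bar> \<ge> 6 * e"
proof -
  define P where "P = {(a :: 'n, b). a \<noteq> b \<and> {a, b} \<noteq> {idx1, idx2}}"
  \<comment> \<open>Inserting 1 keeps the set nonempty when n = 2, where \<open>P\<close> is
    empty.\<close>
  define S where "S = insert 1 ((\<lambda>(a, b). \<bar>D0 $ a $ a - D0 $ b $ b\<bar>) ` P)"
  have fin: "finite S" by (simp add: S_def)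
  have "x > 0" if "x \<in> S" for x
  proof -
    have "D0 $ a $ a \<noteq> D0 $ b $ b" if "(a, b) \<in> P" for a b
      using that Pi_MH_iff[OF n D0(1)] D0(2) unfolding P_def by blast
    then show ?thesis using that by (auto simp: S_def)
  qed
  then have "Min S > 0" using fin by (subst Min_gr_iff) (auto simp: S_def)
  moreover have "Min S \<le> \<bar>D0 $ a $ a - D0 $ b $ b\<bar>" if "a \<noteq> b" "{a, b} \<noteq> {idx1, idx2}" for a b
  proof (rule Min_le[OF fin])
    have "(a, b) \<in> P" using that unfolding P_def by blast
    then show "\<bar>D0 $ a $ a - D0 $ b $ b\<bar> \<in> S" by (auto simp: S_def)
  qed
  ultimately show ?thesis by (intro exI[of _ "Min S / 6"]) simp
qed

locale orbit_chart_at =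
  fixes D0 :: "'n::{finite,linorder} sqmat" and e :: real
  assumes n: "CARD('n) > 1" and D0: "D0 \<in> Pi_plane" "D0 \<in> MH"
    and e: "e > 0"
    and gap: "\<And>a b. a \<noteq> b \<Longrightarrow> {a, b} \<noteq> {idx1, idx2} \<Longrightarrow> \<bar>D0 $ a $ a - D0 $ b $ b\<bar> \<ge> 6 * e"
begin

abbreviation "z0 \<equiv> diag_lift D0"
abbreviation "L \<equiv> coord_subspace MH_coords :: 'n sqmat set"

lemma ne: "idx1 \<noteq> (idx2 :: 'n)" and lt: "idx1 < (idx2 :: 'n)"
  using idx1_less_idx2[OF n] by auto

lemma core_diag_lift:
  fixes D :: "'n sqmat"
  assumes "D \<in> Pi_plane" shows "core (diag_lift D) = D"
proof -
  have "D \<in> Dg" "D $ idx1 $ idx1 = D $ idx2 $ idx2" using assms Pi_plane_iff[OF n] by auto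
  then show ?thesis using ne by (auto simp: vec_eq_iff core_def diag_lift_def Dg_def)
qed

lemma rot_part_diag_lift: "rot_part (diag_lift D) = 0"
  and lower_skew_diag_lift: "lower_skew (diag_lift D) = 0"
  by (auto simp: vec_eq_iff rot_part_def upper_skew_def lower_skew_def diag_lift_def)

lemma orbit_chart_diag_lift: "D \<in> Pi_plane \<Longrightarrow> orbit_chart (diag_lift D) = D" for D :: "'n sqmat"
  by (simp add: orbit_chart_def rot_part_diag_lift lower_skew_diag_lift core_diag_lift cayley_0 conj_by_mat1)

lemma L_iff: "z \<in> L \<longleftrightarrow> lower_skew z = 0 \<and> z $ idx1 $ idx2 = 0 \<and> z $ idx2 $ idx2 = 0"
proof
  assume "z \<in> L"
  then show "lower_skew z = 0 \<and> z $ idx1 $ idx2 = 0 \<and> z $ idx2 $ idx2 = 0"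
    by (auto simp: coord_subspace_def MH_coords_def lower_skew_def vec_eq_iff not_le)
next
  assume *: "lower_skew z = 0 \<and> z $ idx1 $ idx2 = 0 \<and> z $ idx2 $ idx2 = 0"
  then have "lower_skew z $ i $ j = 0" for i j by simp
  then have "z $ i $ j = 0" if "j < i" for i j
  proof -
    have "lower_skew z $ i $ j = z $ i $ j" using that by (simp add: lower_skew_def)
    then show ?thesis using \<open>lower_skew z $ i $ j = 0\<close> by simp
  qed
  then show "z \<in> L" using * by (auto simp: coord_subspace_def MH_coords_def not_le)
qed

lemma diag_lift_L: "diag_lift D \<in> L"
  using ne by (simp add: L_iff lower_skew_diag_lift) (simp add: diag_lift_def)

lemma core_Pi_plane: "z \<in> L \<Longrightarrow> core z \<in> Pi_plane"
  using ne by (auto simp: L_iff Pi_plane_iff[OF n] core_def Dg_def)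

lemma orbit_chart_L: "z \<in> L \<Longrightarrow> orbit_chart z = conj_by (cayley (rot_part z)) (core z)"
  by (simp add: L_iff orbit_chart_def)

lemma cayley_rot_part_SO: "cayley (rot_part z) \<in> SO"
  by (rule cayley_SO[OF transpose_rot_part])

lemma orbit_chart_Orbit_core: "z \<in> L \<Longrightarrow> orbit_chart z \<in> Orbit (core z)"
  by (simp add: orbit_chart_L conj_by_in_Orbit cayley_rot_part_SO)

text \<open>The bound is 2 e rather than \<open>e\<close> because the entry of \<open>core\<close>
  at \<open>idx2\<close> is a sum of two coordinates.\<close>

lemma box_core_near:
  assumes "z \<in> box_around z0 e"
  shows "\<bar>core z $ a $ a - D0 $ a $ a\<bar> < 2 * e" "\<bar>z $ idx1 $ idx2\<bar> < e"
proof -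
  have b: "\<bar>z $ i $ j - z0 $ i $ j\<bar> < e" for i j using assms by (simp add: box_around_def)
  have "D0 $ idx1 $ idx1 = D0 $ idx2 $ idx2" using D0(1) Pi_plane_iff[OF n] by blast
  moreover have "core z $ idx2 $ idx2 = z $ idx1 $ idx1 + z $ idx2 $ idx2" "z0 $ idx2 $ idx2 = 0"
    "z0 $ idx1 $ idx1 = D0 $ idx1 $ idx1" using ne by (simp_all add: core_def diag_lift_def)
  moreover have "core z $ a $ a = z $ a $ a" "z0 $ a $ a = D0 $ a $ a" if "a \<noteq> idx2"
    using that by (simp_all add: core_def diag_lift_def)
  ultimately show "\<bar>core z $ a $ a - D0 $ a $ a\<bar> < 2 * e"
    using b[of a a] b[of idx1 idx1] b[of idx2 idx2] e by (cases "a = idx2"; simp; linarith?)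
  show "\<bar>z $ idx1 $ idx2\<bar> < e" using b[of idx1 idx2] ne by (simp add: diag_lift_def)
qed

lemma core_gap:
  assumes z: "z \<in> box_around z0 e" and ab: "a \<noteq> b" "{a, b} \<noteq> {idx1, idx2}"
  shows "\<bar>core z $ a $ a - core z $ b $ b\<bar> > \<bar>z $ idx1 $ idx2\<bar>"
  using gap[OF ab] box_core_near[OF z] box_core_near(1)[OF z, of a] box_core_near(1)[OF z, of b] e by linarith

text \<open>Symmetry kills the skew summand, and a multiple eigenvalue of the remaining core makes
  its leading block scalar. \<open>MH\<close> will receive the same description, so it fills
  \<open>MM\<close> near \<open>D0\<close>.\<close>

lemma orbit_chart_MM_iff:
  assumes z: "z \<in> box_around z0 e"
  shows "orbit_chart z \<in> MM \<longleftrightarrow> z \<in> L"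
proof
  assume M: "orbit_chart z \<in> MM"
  let ?C = "conj_by (cayley (rot_part z)) (core z)"
  have C: "?C \<in> Sym" by (rule conj_by_Sym[OF core_Sym])
  have tl: "transpose (lower_skew z) = lower_skew z"
  proof -
    have "lower_skew z = orbit_chart z - ?C" by (simp add: orbit_chart_def)
    then show ?thesis using M MM_subset_Sym C by (auto simp: Sym_def transpose_diff)
  qed
  then have "transpose (- lower_skew z) = - lower_skew z" by (simp only: linear_neg[OF linear_transpose])
  then have R: "lower_skew z = 0"
    using skew_plus_sym_eq_0(1)[OF transpose_lower_skew, of "- lower_skew z" z] by simp
  then have "core z \<in> MM" using M MM_conj_by[OF cayley_rot_part_SO, of z "core z"] by (simp add: orbit_chart_def)
  then obtain c where "multiple_eigenvalue (core z) c" using MM_iff by blast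
  from core_multiple_eigenvalue[OF n core_gap[OF z] this] R show "z \<in> L" by (simp add: L_iff)
next
  assume L: "z \<in> L"
  then have "core z \<in> MM" using Pi_plane_subset_MM[OF n] core_Pi_plane by blast
  then show "orbit_chart z \<in> MM" using L by (simp add: orbit_chart_L MM_conj_by[OF cayley_rot_part_SO])
qed

lemma orbit_chart_MH_iff:
  assumes z: "z \<in> box_around z0 e"
  shows "orbit_chart z \<in> MH \<longleftrightarrow> z \<in> L"
proof
  assume "orbit_chart z \<in> MH"
  then show "z \<in> L" using MH_subset_MM orbit_chart_MM_iff[OF z] by blast
next
  assume L: "z \<in> L"
  have "core z \<in> MH"
    unfolding Pi_MH_iff[OF n core_Pi_plane[OF L]]
  proof (intro allI impI, rule ccontr)
    fix a b :: 'n assume "a \<noteq> b" "core z $ a $ a = core z $ b $ b" "{a, b} \<noteq> {idx1, idx2}"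
    then show False using core_gap[OF z, of a b] by simp
  qed
  then show "orbit_chart z \<in> MH" using L by (simp add: orbit_chart_L MH_conj_by[OF cayley_rot_part_SO])
qed

lemma near_eq:
  assumes "D \<in> Pi_plane" "D' \<in> Pi_plane" "D \<in> Orbit D'"
    and "\<And>a. \<bar>D $ a $ a - D0 $ a $ a\<bar> < 2 * e" "\<And>a. \<bar>D' $ a $ a - D0 $ a $ a\<bar> < 2 * e"
  shows "D = D'"
proof (rule near_diag_Orbit_eq[OF n assms(1-3) _ assms(4,5)])
  fix a b :: 'n assume "a \<noteq> b" "{a, b} \<noteq> {idx1, idx2}"
  then show "4 * e \<le> \<bar>D0 $ a $ a - D0 $ b $ b\<bar>" using gap[of a b] e by linarith
qed

text \<open>Within the box the orbit meets the plane only in \<open>D0\<close>. So on the orbit the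
  core is frozen and only the rotation coordinates vary.\<close>

lemma orbit_chart_Orbit_iff:
  assumes z: "z \<in> box_around z0 e"
  shows "orbit_chart z \<in> Orbit D0 \<longleftrightarrow> z - z0 \<in> coord_subspace orbit_coords"
proof -
  have "z - z0 \<in> coord_subspace orbit_coords \<longleftrightarrow> z \<in> L \<and> core z = D0"
  proof
    assume *: "z - z0 \<in> coord_subspace orbit_coords"
    have zz: "z $ i $ j = z0 $ i $ j" if "(i, j) \<notin> orbit_coords" for i j
      using * that by (simp add: coord_subspace_def)
    have "z \<in> L"
      unfolding coord_subspace_def
    proof (intro CollectI allI impI)
      fix i j :: 'n assume "(i, j) \<notin> MH_coords"
      then have "(i, j) \<notin> orbit_coords" "(i, j) \<notin> MH_coords" by (auto simp: MH_coords_def orbit_coords_def)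
      then show "z $ i $ j = 0" using zz diag_lift_L[of D0] by (simp add: coord_subspace_def)
    qed
    moreover have "core z = core z0"
      using zz lt by (auto simp: vec_eq_iff core_def orbit_coords_def)
    ultimately show "z \<in> L \<and> core z = D0" using core_diag_lift[OF D0(1)] by simp
  next
    assume *: "z \<in> L \<and> core z = D0"
    have "z $ i $ j = z0 $ i $ j" if "(i, j) \<notin> orbit_coords" for i j
    proof (cases "i = j \<and> i \<noteq> idx2")
      case True
      then have "i = j" "i \<noteq> idx2" by blast+
      then have "core z $ i $ i = z $ i $ i" "z0 $ i $ i = D0 $ i $ i" by (simp_all add: core_def diag_lift_def)
      then show ?thesis using * \<open>i = j\<close> by simp
    next
      case False
      then have "(i, j) \<notin> MH_coords" using that by (auto simp: MH_coords_def orbit_coords_def)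
      then show ?thesis using * diag_lift_L[of D0] by (simp add: coord_subspace_def)
    qed
    then show "z - z0 \<in> coord_subspace orbit_coords" by (simp add: coord_subspace_def)
  qed
  also have "\<dots> \<longleftrightarrow> orbit_chart z \<in> Orbit D0"
  proof
    show "orbit_chart z \<in> Orbit D0" if "z \<in> L \<and> core z = D0"
      using orbit_chart_Orbit_core that by blast
    assume O: "orbit_chart z \<in> Orbit D0"
    then have "z \<in> L" using Orbit_subset_MH[OF D0(2)] orbit_chart_MH_iff[OF z] by blast
    moreover have "core z \<in> Orbit D0"
      using O Orbit_eq[OF O] Orbit_eq[OF orbit_chart_Orbit_core[OF \<open>z \<in> L\<close>]] Orbit_refl[of "core z"] by simp
    then have "core z = D0"
      using near_eq[OF core_Pi_plane[OF \<open>z \<in> L\<close>] D0(1)] box_core_near(1)[OF z] e by simp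
    ultimately show "z \<in> L \<and> core z = D0" by blast
  qed
  finally show ?thesis by (rule sym)
qed

text \<open>The Cayley transform has derivative -2 \<open>rot_part h\<close> and its transpose the
  opposite one; the product rule turns this into a commutator with \<open>D0\<close>.\<close>

lemma orbit_chart_has_derivative:
  "(orbit_chart has_derivative
    (\<lambda>h. core h + 2 *\<^sub>R (D0 ** rot_part h - rot_part h ** D0) + lower_skew h)) (at z0)"
proof -
  have bl: "bounded_linear (core :: 'n sqmat \<Rightarrow> _)" "bounded_linear (lower_skew :: 'n sqmat \<Rightarrow> _)"
    using linear_imp_bounded linear_core linear_lower_skew by blast+
  let ?c = "\<lambda>z :: 'n sqmat. cayley (rot_part z)"
  have c: "(?c has_derivative (\<lambda>h. - 2 *\<^sub>R rot_part h)) (at z0)"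
    by (rule cayley_smooth(2)[OF linear_rot_part transpose_rot_part rot_part_diag_lift])
  have c0: "?c z0 = mat 1" by (simp add: rot_part_diag_lift cayley_0)
  have core0: "core z0 = D0" by (rule core_diag_lift[OF D0(1)])
  have tc: "((\<lambda>z. transpose (?c z)) has_derivative (\<lambda>h. 2 *\<^sub>R rot_part h)) (at z0)"
    using bounded_linear.has_derivative[OF bounded_linear_transpose c]
    by (simp add: linear_scale[OF linear_transpose] linear_neg[OF linear_transpose] transpose_rot_part)
  have "((\<lambda>z. ?c z ** core z) has_derivative (\<lambda>h. core h + (- 2 *\<^sub>R rot_part h) ** D0)) (at z0)"
    using bounded_bilinear.FDERIV[OF bounded_bilinear_matrix_mult c bounded_linear_imp_has_derivative[OF bl(1)]]
    by (simp add: c0 core0)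
  from bounded_bilinear.FDERIV[OF bounded_bilinear_matrix_mult this tc]
  have "((\<lambda>z. ?c z ** core z ** transpose (?c z)) has_derivative
      (\<lambda>h. D0 ** (2 *\<^sub>R rot_part h) + (core h + (- 2 *\<^sub>R rot_part h) ** D0))) (at z0)"
    by (simp add: c0 core0 transpose_mat)
  then have "((\<lambda>z. ?c z ** core z ** transpose (?c z) + lower_skew z) has_derivative
      (\<lambda>h. D0 ** (2 *\<^sub>R rot_part h) + (core h + (- 2 *\<^sub>R rot_part h) ** D0) + lower_skew h)) (at z0)"
    by (intro has_derivative_add bounded_linear_imp_has_derivative bl)
  moreover have "(\<lambda>h. D0 ** (2 *\<^sub>R rot_part h) + (core h + (- 2 *\<^sub>R rot_part h) ** D0) + lower_skew h) =
      (\<lambda>h. core h + 2 *\<^sub>R (D0 ** rot_part h - rot_part h ** D0) + lower_skew h)"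
    by (rule ext) (simp add: matrix_mult_scaleR_left matrix_mult_scaleR_right matrix_mult_minus_left scaleR_diff_right)
  moreover have "orbit_chart = (\<lambda>z :: 'n sqmat. ?c z ** core z ** transpose (?c z) + lower_skew z)"
    by (rule ext) (simp add: orbit_chart_def conj_by_def)
  ultimately show ?thesis by simp
qed

text \<open>The symmetric and skew parts of the derivative vanish separately. The commutator
  multiplies the entry (i, j) by a difference of diagonal entries of \<open>D0\<close>, nonzero by
  the gap except within the first two indices; there \<open>core\<close> supplies the missing
  off-diagonal coordinate.\<close>

lemma inj_orbit_chart_derivative: "inj (frechet_derivative orbit_chart (at z0))"
proof -
  let ?D = "\<lambda>h. core h + 2 *\<^sub>R (D0 ** rot_part h - rot_part h ** D0) + lower_skew h"
  have fd: "frechet_derivative orbit_chart (at z0) = ?D"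
    using frechet_derivative_at[OF orbit_chart_has_derivative] by (rule sym)
  have Dg: "D0 \<in> Dg" using D0(1) Pi_plane_iff[OF n] by blast
  have mult: "(D0 ** K) $ i $ j = D0 $ i $ i * K $ i $ j" "(K ** D0) $ i $ j = K $ i $ j * D0 $ j $ j"
    for K :: "'n sqmat" and i j
  proof -
    have "(\<Sum>k\<in>UNIV. D0 $ i $ k * K $ k $ j) = (\<Sum>k\<in>{i}. D0 $ i $ k * K $ k $ j)"
      by (rule sum.mono_neutral_right) (use Dg in \<open>auto simp: Dg_def\<close>)
    then show "(D0 ** K) $ i $ j = D0 $ i $ i * K $ i $ j" by (simp add: matrix_matrix_mult_def)
    have "(\<Sum>k\<in>UNIV. K $ i $ k * D0 $ k $ j) = (\<Sum>k\<in>{j}. K $ i $ k * D0 $ k $ j)"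
      by (rule sum.mono_neutral_right) (use Dg in \<open>auto simp: Dg_def\<close>)
    then show "(K ** D0) $ i $ j = K $ i $ j * D0 $ j $ j" by (simp add: matrix_matrix_mult_def)
  qed
  have "linear ?D" using orbit_chart_has_derivative has_derivative_linear by blast
  moreover have "h = 0" if h: "?D h = 0" for h
  proof -
    let ?S = "core h + 2 *\<^sub>R (D0 ** rot_part h - rot_part h ** D0)"
    have "transpose ?S = ?S"
      using core_Sym[of h] Dg Dg_Sym
      by (auto simp: Sym_def transpose_add transpose_diff linear_scale[OF linear_transpose] matrix_transpose_mul
          transpose_rot_part matrix_mult_minus_left matrix_mult_minus_right)
    moreover have "lower_skew h + ?S = 0" using h by (simp add: add.commute)
    ultimately have eq: "lower_skew h = 0" "?S = 0"
      using skew_plus_sym_eq_0[OF transpose_lower_skew] by blast+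
    have S: "core h $ i $ j + 2 * ((D0 $ i $ i - D0 $ j $ j) * rot_part h $ i $ j) = 0" for i j
      using arg_cong[OF eq(2), of "\<lambda>X. X $ i $ j"] by (simp add: mult algebra_simps)
    have low: "h $ i $ j = 0" if "j < i" for i j
      using that arg_cong[OF eq(1), of "\<lambda>X. X $ i $ j"] by (simp add: lower_skew_def)
    have dia: "h $ i $ i = 0" for i
    proof -
      have c: "core h $ i $ i = 0" for i using S[of i i] by simp
      have *: "h $ i $ i = 0" if "i \<noteq> idx2" for i using c[of i] that by (simp add: core_def)
      show ?thesis using *[of i] *[OF ne] c[of idx2] by (cases "i = idx2") (auto simp: core_def)
    qed
    have 12: "h $ idx1 $ idx2 = 0" using S[of idx1 idx2] ne by (simp add: core_def rot_part_def)
    have upp: "h $ i $ j = 0" if ij: "i < j" "\<not> (i = idx1 \<and> j = idx2)" for i j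
    proof -
      have nd: "{i, j} \<noteq> {idx1, idx2}" using ij lt by (auto simp: doubleton_eq_iff)
      then have "rot_part h $ i $ j = h $ i $ j" "core h $ i $ j = 0"
        using ij(1) by (simp_all add: rot_part_def upper_skew_def core_def)
      then have "(D0 $ i $ i - D0 $ j $ j) * h $ i $ j = 0" using S[of i j] by simp
      moreover have "6 * e \<le> \<bar>D0 $ i $ i - D0 $ j $ j\<bar>" using nd by (rule gap[OF less_imp_neq[OF ij(1)]])
      then have "D0 $ i $ i - D0 $ j $ j \<noteq> 0" using e by auto
      ultimately show ?thesis by simp
    qed
    have "h $ i $ j = 0" for i j
      using low[of j i] dia[of i] 12 upp[of i j] by (cases i j rule: linorder_cases) auto
    then show "h = 0" by (simp add: vec_eq_iff)
  qed
  ultimately show ?thesis unfolding fd using linear_injective_0[of ?D] by blast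
qed

end

lemma mem_box_around: "e > 0 \<Longrightarrow> Z \<in> box_around Z e"
  by (simp add: box_around_def)

context orbit_chart_at
begin

lemma submanifold_at_conj_chart:
  assumes g: "g \<in> SO" and L': "subspace L'"
    and S: "\<And>z. z \<in> box_around z0 e \<Longrightarrow> conj_by g (orbit_chart z) \<in> S \<longleftrightarrow> z - z0 \<in> L'"
  shows "submanifold_at (dim L') S (conj_by g D0)"
proof -
  have bl: "bounded_linear (conj_by g)" by (rule linear_imp_bounded[OF linear_conj_by])
  let ?\<Psi> = "\<lambda>z. conj_by g (orbit_chart z)"
  have smooth: "smooth_on_open ?\<Psi> (box_around z0 e)"
    by (rule smooth_on_open_subset[OF smooth_on_open_linear_compose[OF bl smooth_orbit_chart] open_box_around]) simp
  have "(?\<Psi> has_derivative (\<lambda>h. conj_by g (frechet_derivative orbit_chart (at z0) h))) (at z0)"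
    by (rule bounded_linear.has_derivative[OF bl smooth_on_open_has_derivative[OF smooth_orbit_chart UNIV_I]])
  from frechet_derivative_at[OF this]
  have fd: "frechet_derivative ?\<Psi> (at z0) = (\<lambda>h. conj_by g (frechet_derivative orbit_chart (at z0) h))"
    by (rule sym)
  have "inj (conj_by g)" by (rule inj_on_inverseI[where g = "conj_by (transpose g)"]) (rule conj_by_inverse(1)[OF g])
  then have "inj (frechet_derivative ?\<Psi> (at z0))"
    using inj_compose[OF _ inj_orbit_chart_derivative] unfolding fd o_def by blast
  from submanifold_at_chart[OF smooth mem_box_around[OF e] this L' S]
  show ?thesis by (simp add: orbit_chart_diag_lift[OF D0(1)])
qed

lemma submanifold_at_MH:
  assumes g: "g \<in> SO" shows "submanifold_at (card (MH_coords :: ('n \<times> 'n) set)) MH (conj_by g D0)"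
proof -
  have "z \<in> L \<longleftrightarrow> z - z0 \<in> L" for z
    using diag_lift_L[of D0] subspace_coord_subspace subspace_add[of L "z - z0" z0] subspace_diff[of L z z0] by auto
  then have "submanifold_at (dim L) MH (conj_by g D0)"
    using orbit_chart_MH_iff
    by (intro submanifold_at_conj_chart[OF g subspace_coord_subspace]) (simp add: MH_conj_by[OF g])
  then show ?thesis by (simp add: dim_coord_subspace)
qed

lemma submanifold_at_Orbit:
  assumes g: "g \<in> SO"
  shows "submanifold_at (card (orbit_coords :: ('n \<times> 'n) set)) (Orbit D0) (conj_by g D0)"
proof -
  have "conj_by g X \<in> Orbit D0 \<longleftrightarrow> X \<in> Orbit D0" for X
    using Orbit_conj_by[OF g, of X] Orbit_eq[of _ D0] Orbit_refl by metis
  then have "submanifold_at (dim (coord_subspace orbit_coords :: 'n sqmat set)) (Orbit D0) (conj_by g D0)"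
    using orbit_chart_Orbit_iff
    by (intro submanifold_at_conj_chart[OF g subspace_coord_subspace]) simp
  then show ?thesis by (simp add: dim_coord_subspace)
qed

end

lemma card_orbit_coords:
  assumes "CARD('n::{finite,linorder}) > 1"
  shows "card (orbit_coords :: ('n \<times> 'n) set) = CARD('n) * (CARD('n) - 1) div 2 - 1"
  using idx1_less_idx2[OF assms] unfolding orbit_coords_def
  by (subst card_Diff_singleton) (simp_all add: card_less_pairs')

lemma card_le_pairs: "card {(i, j). i \<le> (j :: 'n::{finite,linorder})} = CARD('n) * (CARD('n) - 1) div 2 + CARD('n)"
proof -
  have eq: "{(i, j). i \<le> (j :: 'n)} = {(i, j). i < j} \<union> (\<lambda>i. (i, i)) ` UNIV" by auto
  have "card ((\<lambda>i. (i, i)) ` (UNIV :: 'n set)) = CARD('n)" by (rule card_image) (auto simp: inj_on_def)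
  then show ?thesis unfolding eq by (subst card_Un_disjoint) (auto simp: card_less_pairs')
qed

lemma card_MH_coords:
  assumes "CARD('n::{finite,linorder}) > 1"
  shows "card (MH_coords :: ('n \<times> 'n) set) = CARD('n) * (CARD('n) - 1) div 2 + CARD('n) - 2"
proof -
  have lt: "idx1 < (idx2 :: 'n)" by (rule idx1_less_idx2[OF assms])
  then have "card {(idx1 :: 'n, idx2 :: 'n), (idx2, idx2)} = 2" by simp
  moreover have "{(idx1 :: 'n, idx2 :: 'n), (idx2, idx2)} \<subseteq> {(i, j). i \<le> j}" using lt by auto
  ultimately show ?thesis unfolding MH_coords_def by (subst card_Diff_subset) (simp_all add: card_le_pairs)
qed

lemma MH_conj_orbit_chart_at:
  fixes X :: "'n::{finite,linorder} sqmat"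
  assumes n: "CARD('n) > 1" and X: "X \<in> MH"
  obtains g D0 e where "g \<in> SO" "D0 \<in> Pi_plane" "D0 \<in> MH" "X = conj_by g D0" "orbit_chart_at D0 e"
proof -
  have "X \<in> MM" using X MH_subset_MM by blast
  then obtain g D0 where g: "g \<in> SO" "D0 \<in> Pi_plane" "X = conj_by g D0" by (rule MM_conj_Pi_plane[OF n])
  then have D0: "D0 \<in> MH" using X MH_conj_by by blast
  obtain e where "e > 0" "\<forall>a b. a \<noteq> b \<longrightarrow> {a, b} \<noteq> {idx1, idx2} \<longrightarrow> \<bar>D0 $ a $ a - D0 $ b $ b\<bar> \<ge> 6 * e"
    using MH_gap[OF n g(2) D0] by blast
  then have "orbit_chart_at D0 e" using n g(2) D0 by (intro orbit_chart_at.intro) auto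
  then show ?thesis using that g D0 by blast
qed

lemma smooth_submanifold_MH:
  assumes n: "CARD('n::{finite,linorder}) > 1"
  shows "smooth_submanifold (card (MH_coords :: ('n \<times> 'n) set)) (MH :: 'n sqmat set)"
  unfolding smooth_submanifold_iff
proof
  fix X :: "'n sqmat" assume "X \<in> MH"
  then obtain g D0 e where "g \<in> SO" "X = conj_by g D0" "orbit_chart_at D0 e"
    by (rule MH_conj_orbit_chart_at[OF n])
  then show "submanifold_at (card (MH_coords :: ('n \<times> 'n) set)) MH X"
    using orbit_chart_at.submanifold_at_MH by blast
qed

lemma smooth_submanifold_Orbit:
  fixes A :: "'n::{finite,linorder} sqmat"
  assumes n: "CARD('n) > 1" and A: "A \<in> MH"
  shows "smooth_submanifold (card (orbit_coords :: ('n \<times> 'n) set)) (Orbit A)"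
  unfolding smooth_submanifold_iff
proof
  fix X assume X: "X \<in> Orbit A"
  then have "X \<in> MH" using Orbit_subset_MH[OF A] by blast
  then obtain g D0 e where g: "g \<in> SO" "X = conj_by g D0" "orbit_chart_at D0 e"
    by (rule MH_conj_orbit_chart_at[OF n])
  have "Orbit A = Orbit D0" using Orbit_eq[OF X] Orbit_conj_by[OF g(1), of D0] g(2) by simp
  then show "submanifold_at (card (orbit_coords :: ('n \<times> 'n) set)) (Orbit A) X"
    using orbit_chart_at.submanifold_at_Orbit[OF g(3,1)] g(2) by simp
qed

subsection \<open>The local fibration\<close>

lemma subspace_Pi_plane:
  assumes "CARD('n::{finite,linorder}) > 1" shows "subspace (Pi_plane :: 'n sqmat set)"
  by (auto simp: subspace_def Pi_plane_iff[OF assms] Dg_def)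

context orbit_chart_at
begin

text \<open>The projection reads off the core in chart coordinates and forgets the rotation. Since
  the chart domain is a box, one trivialization serves all of U.\<close>

lemma local_fibration:
  "\<exists>U \<pi>. openin (top_of_set MH) U \<and> D0 \<in> U \<and> smooth_fibration \<pi> U (Pi_plane \<inter> U) \<and>
     (\<forall>D \<in> Pi_plane \<inter> U. \<pi> D = D \<and> {X \<in> U. \<pi> X = D} = U \<inter> Orbit D)"
proof -
  obtain U' V g where inv: "open U'" "z0 \<in> U'" "open V" "homeomorphism U' V orbit_chart g" "smooth_on_open g V"
    by (rule smooth_local_inverse[OF smooth_orbit_chart UNIV_I inj_orbit_chart_derivative]) blast
  have h: "\<And>z. z \<in> U' \<Longrightarrow> orbit_chart z \<in> V \<and> g (orbit_chart z) = z"
    "\<And>y. y \<in> V \<Longrightarrow> g y \<in> U' \<and> orbit_chart (g y) = y"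
    using inv(4) by (auto simp: homeomorphism_def)
  \<comment> \<open>Besides invertibility of the chart and validity of the equivalences, the third
    condition keeps the matrices themselves within 2 e of \<open>D0\<close>. Points of the plane in
    U can then be compared with cores by \<open>near_eq\<close>.\<close>
  define Q where "Q = U' \<inter> box_around z0 e \<inter> orbit_chart -` box_around D0 (2 * e)"
  have "open (orbit_chart -` box_around D0 (2 * e))"
    by (rule open_vimage[OF open_box_around smooth_on_open_continuous_on[OF smooth_orbit_chart]])
  then have "open Q" unfolding Q_def using inv(1) open_box_around by blast
  moreover have "z0 \<in> Q"
    using inv(2) e mem_box_around[OF e] mem_box_around[of "2 * e" D0] by (simp add: Q_def orbit_chart_diag_lift[OF D0(1)])
  ultimately obtain d where d: "d > 0" "box_around z0 d \<subseteq> Q" using box_around_subset_open by blast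
  define N where "N = box_around z0 d"
  have N: "z \<in> U'" "z \<in> box_around z0 e" "orbit_chart z \<in> box_around D0 (2 * e)" "orbit_chart z \<in> V" "g (orbit_chart z) = z"
    if "z \<in> N" for z
    using that d(2) h(1) by (auto simp: N_def Q_def)
  define V' where "V' = orbit_chart ` N"
  have "V' = V \<inter> g -` N" unfolding V'_def using N(4,5) h(2) by force
  then have V': "open V'"
    using continuous_open_preimage[OF smooth_on_open_continuous_on[OF inv(5)] inv(3) open_box_around] by (simp add: N_def)
  define U where "U = orbit_chart ` (N \<inter> L)"
  have U_MH: "U = MH \<inter> V'" unfolding U_def V'_def using orbit_chart_MH_iff N(2) by auto
  have Pi_U: "Pi_plane \<inter> U = Pi_plane \<inter> V'"
    unfolding U_def V'_def using orbit_chart_MM_iff N(2) Pi_plane_subset_MM[OF n] by auto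
  have U_V: "U \<subseteq> V" unfolding U_def using N(4) by blast
  define \<pi> where "\<pi> X = core (g X)" for X
  have \<pi>_chart: "\<pi> (orbit_chart z) = core z" if "z \<in> N" for z using N(5)[OF that] by (simp add: \<pi>_def)
  have near_core: "\<bar>core z $ a $ a - D0 $ a $ a\<bar> < 2 * e" if "z \<in> N" for z a
    using box_core_near(1)[OF N(2)[OF that]] .
  have near_U: "\<bar>X $ a $ a - D0 $ a $ a\<bar> < 2 * e" if "X \<in> U" for X a
    using that N(3) unfolding U_def box_around_def by auto
  have core_eq: "D = core z" if "D \<in> Pi_plane \<inter> U" "z \<in> N \<inter> L" "D \<in> Orbit (core z)" for D z
    using near_eq[of D "core z"] that core_Pi_plane near_core near_U by blast
  \<comment> \<open>Dropping the off-diagonal coordinates stays inside the box, so the core of every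
    point of U lies in U again.\<close>
  have lift_N: "diag_lift (core z) \<in> N" if "z \<in> N" for z
    unfolding N_def box_around_def
  proof (intro CollectI allI)
    fix i j
    have "diag_lift (core z) $ i $ j - z0 $ i $ j = (if i = j \<and> i \<noteq> idx2 then z $ i $ j - z0 $ i $ j else 0)"
      by (auto simp: diag_lift_def core_def)
    then show "\<bar>diag_lift (core z) $ i $ j - z0 $ i $ j\<bar> < d"
      using that d(1) by (auto simp: N_def box_around_def)
  qed
  have core_U: "core z \<in> Pi_plane \<inter> U" if z: "z \<in> N \<inter> L" for z
  proof -
    have "core z \<in> Pi_plane" using z core_Pi_plane by blast
    moreover have "orbit_chart (diag_lift (core z)) \<in> U" unfolding U_def using lift_N z diag_lift_L by blast
    ultimately show ?thesis by (simp add: orbit_chart_diag_lift)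
  qed
  have \<pi>_Pi: "\<pi> D = D" if D: "D \<in> Pi_plane \<inter> U" for D
  proof -
    obtain z where z: "z \<in> N \<inter> L" "D = orbit_chart z" using D by (auto simp: U_def)
    then have "D = core z" using core_eq[OF D z(1)] orbit_chart_Orbit_core by blast
    moreover have "\<pi> D = core z" unfolding z(2) using z(1) \<pi>_chart by blast
    ultimately show ?thesis by simp
  qed
  have fibre: "{X \<in> U. \<pi> X = D} = U \<inter> Orbit D" if D: "D \<in> Pi_plane \<inter> U" for D
  proof -
    have "\<pi> X = D \<longleftrightarrow> X \<in> Orbit D" if X: "X \<in> U" for X
    proof -
      obtain z where z: "z \<in> N \<inter> L" "X = orbit_chart z" using X by (auto simp: U_def)
      have O: "Orbit X = Orbit (core z)" using z orbit_chart_Orbit_core Orbit_eq by blast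
      have "\<pi> X = core z" using z \<pi>_chart by simp
      moreover have "core z = D \<longleftrightarrow> X \<in> Orbit D"
      proof
        show "X \<in> Orbit D" if "core z = D" using that O Orbit_refl[of X] by simp
        assume "X \<in> Orbit D"
        then have "D \<in> Orbit (core z)" using O Orbit_eq[of X D] Orbit_refl[of D] by simp
        then show "core z = D" using core_eq[OF D z(1)] by simp
      qed
      ultimately show ?thesis by simp
    qed
    then show ?thesis by blast
  qed
  \<comment> \<open>The typical fibre is the box of rotation coordinates. It is centred at 0 because
    \<open>z0\<close> has no off-diagonal entries.\<close>
  define F :: "'n sqmat set" where "F = coord_subspace orbit_coords \<inter> box_around 0 d"
  define \<phi> where "\<phi> X = (core (g X), off_diag (g X))" for X
  define \<psi> where "\<psi> p = orbit_chart (diag_lift (fst p) + snd p)" for p :: "'n sqmat \<times> 'n sqmat"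
  have sub: "\<exists>d. smooth_submanifold d U" "\<exists>d. smooth_submanifold d (Pi_plane \<inter> U)" "\<exists>d. smooth_submanifold d F"
  proof -
    show "\<exists>d. smooth_submanifold d U"
      using smooth_submanifold_openin[OF smooth_submanifold_MH[OF n], of U] V' U_MH by (auto simp: openin_open)
    show "\<exists>d. smooth_submanifold d (Pi_plane \<inter> U)"
      using smooth_submanifold_openin[OF smooth_submanifold_subspace[OF subspace_Pi_plane[OF n]], of "Pi_plane \<inter> U"]
        V' Pi_U by (auto simp: openin_open)
    show "\<exists>d. smooth_submanifold d F"
    proof -
      have "openin (top_of_set (coord_subspace orbit_coords)) F"
        unfolding F_def using open_box_around by (rule openin_open_Int)
      from smooth_submanifold_openin[OF smooth_submanifold_subspace[OF subspace_coord_subspace] this]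
      show ?thesis by blast
    qed
  qed
  have sm_core: "smooth_on_open (\<lambda>X. core (g X)) V"
    by (rule smooth_on_open_linear_compose[OF linear_imp_bounded[OF linear_core] inv(5)])
  have sm_\<phi>: "smooth_map_on \<phi> U"
  proof -
    have "smooth_on_open (\<lambda>X. (core (g X), off_diag (g X))) V"
      by (intro smooth_on_open_Pair sm_core
          smooth_on_open_linear_compose[OF linear_imp_bounded[OF linear_off_diag] inv(5)])
    then have "smooth_on_open \<phi> V" unfolding \<phi>_def[abs_def] .
    then show ?thesis using U_V by (rule smooth_map_on_if_smooth_on_open)
  qed
  have sm_\<psi>: "smooth_map_on \<psi> S" for S
  proof -
    have "smooth_on_open (\<lambda>p :: 'n sqmat \<times> 'n sqmat. diag_lift (fst p) + snd p) UNIV"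
      by (intro smooth_on_open_add smooth_on_open_linear_compose[OF linear_imp_bounded[OF linear_diag_lift]]
          smooth_on_open_linear bounded_linear_fst bounded_linear_snd) auto
    then have "smooth_on_open \<psi> UNIV"
      unfolding \<psi>_def[abs_def] by (rule smooth_on_open_compose[OF _ smooth_orbit_chart]) simp
    then show ?thesis by (rule smooth_map_on_if_smooth_on_open) simp
  qed
  have diffeo: "diffeomorphism_between \<phi> U ((Pi_plane \<inter> U) \<times> F)"
  proof (rule diffeomorphism_betweenI[where g = \<psi>])
    fix X assume "X \<in> U"
    then obtain z where z: "z \<in> N" "z \<in> L" "X = orbit_chart z" by (auto simp: U_def)
    have \<phi>: "\<phi> X = (core z, off_diag z)" using N(5)[OF z(1)] z(3) by (simp add: \<phi>_def)
    have "off_diag z \<in> F"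
    proof -
      have "off_diag z $ i $ j = 0" if "(i, j) \<notin> orbit_coords" for i j
      proof (cases "i = j")
        case False
        then have "(i, j) \<notin> MH_coords" using that by (auto simp: MH_coords_def orbit_coords_def)
        then show ?thesis using z(2) by (simp add: coord_subspace_def off_diag_def)
      qed (simp add: off_diag_def)
      moreover have "\<bar>off_diag z $ i $ j\<bar> < d" for i j
      proof (cases "i = j")
        case False
        then have "\<bar>z $ i $ j - z0 $ i $ j\<bar> < d" using z(1) by (simp add: N_def box_around_def)
        then show ?thesis using False by (simp add: off_diag_def diag_lift_def)
      qed (simp add: off_diag_def d(1))
      ultimately show ?thesis by (simp add: F_def coord_subspace_def box_around_def)
    qed
    moreover have "diag_lift (core z) + off_diag z = z"
    proof -
      have "z $ idx2 $ idx2 = 0" using z(2) L_iff by blast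
      then have "(diag_lift (core z) + off_diag z) $ i $ j = z $ i $ j" for i j
        by (cases "i = j") (simp_all add: diag_lift_def core_def off_diag_def)
      then show ?thesis by (simp add: vec_eq_iff)
    qed
    ultimately show "\<phi> X \<in> (Pi_plane \<inter> U) \<times> F \<and> \<psi> (\<phi> X) = X"
      using core_U[of z] z \<phi> by (simp add: \<psi>_def)
  next
    fix p assume "p \<in> (Pi_plane \<inter> U) \<times> F"
    then obtain D f where p: "p = (D, f)" "D \<in> Pi_plane \<inter> U" "f \<in> F" by blast
    obtain y where y: "y \<in> N" "y \<in> L" "D = orbit_chart y" using p(2) by (auto simp: U_def)
    have Dy: "D = core y" using core_eq[OF p(2)] y orbit_chart_Orbit_core by blast
    let ?z = "diag_lift D + f"
    have f: "f $ i $ j = 0" if "(i, j) \<notin> orbit_coords" for i j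
      using p(3) that by (simp add: F_def coord_subspace_def)
    have fd: "f $ i $ i = 0" for i using f[of i i] by (simp add: orbit_coords_def)
    have "?z \<in> N"
      unfolding N_def box_around_def
    proof (intro CollectI allI)
      fix i j
      have l: "\<bar>diag_lift D $ i $ j - z0 $ i $ j\<bar> < d"
        using lift_N[OF y(1)] unfolding Dy by (simp add: N_def box_around_def)
      show "\<bar>?z $ i $ j - z0 $ i $ j\<bar> < d"
      proof (cases "i = j")
        case True
        then show ?thesis using l fd by simp
      next
        case False
        moreover have "\<bar>f $ i $ j\<bar> < d" using p(3) by (simp add: F_def box_around_def)
        ultimately show ?thesis by (simp add: diag_lift_def)
      qed
    qed
    moreover have "f \<in> L"
    proof -
      have "orbit_coords \<subseteq> (MH_coords :: ('n \<times> 'n) set)" by (auto simp: MH_coords_def orbit_coords_def)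
      then show ?thesis using f unfolding coord_subspace_def by blast
    qed
    then have "?z \<in> L" by (intro subspace_add subspace_coord_subspace diag_lift_L)
    moreover have "core ?z = D"
    proof -
      have "core f = 0"
        using fd f[of idx1 idx2] by (simp add: vec_eq_iff core_def orbit_coords_def)
      then show ?thesis using core_diag_lift[of D] p(2) by (simp add: linear_add[OF linear_core])
    qed
    moreover have "off_diag ?z = f"
    proof -
      have "off_diag ?z $ i $ j = f $ i $ j" for i j
        by (cases "i = j") (simp_all add: off_diag_def diag_lift_def fd)
      then show ?thesis by (simp add: vec_eq_iff)
    qed
    ultimately show "\<psi> p \<in> U \<and> \<phi> (\<psi> p) = p"
      using N(5)[of ?z] p(1) by (auto simp: \<psi>_def \<phi>_def U_def)
  qed (rule sm_\<phi> sm_\<psi>)+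
  have \<pi>_image: "\<pi> ` U = Pi_plane \<inter> U"
  proof (intro equalityI subsetI)
    fix D assume "D \<in> \<pi> ` U"
    then obtain z where "z \<in> N" "z \<in> L" "D = \<pi> (orbit_chart z)" by (auto simp: U_def)
    then show "D \<in> Pi_plane \<inter> U" using \<pi>_chart core_U by simp
  next
    fix D assume "D \<in> Pi_plane \<inter> U"
    then show "D \<in> \<pi> ` U" using \<pi>_Pi[of D] by (intro image_eqI[of _ _ D]) auto
  qed
  have "smooth_map_on \<pi> U"
    using smooth_map_on_if_smooth_on_open[OF sm_core U_V] unfolding \<pi>_def[abs_def] .
  moreover have "\<exists>V (F :: 'n sqmat set) \<phi>. openin (top_of_set (Pi_plane \<inter> U)) V \<and> b \<in> V \<and>
      (\<exists>d. smooth_submanifold d F) \<and> diffeomorphism_between \<phi> {x \<in> U. \<pi> x \<in> V} (V \<times> F) \<and>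
      (\<forall>x \<in> U. \<pi> x \<in> V \<longrightarrow> fst (\<phi> x) = \<pi> x)" if b: "b \<in> Pi_plane \<inter> U" for b
  proof (intro exI conjI)
    have "{x \<in> U. \<pi> x \<in> Pi_plane \<inter> U} = U" using \<pi>_image by blast
    then show "diffeomorphism_between \<phi> {x \<in> U. \<pi> x \<in> Pi_plane \<inter> U} ((Pi_plane \<inter> U) \<times> F)" using diffeo by simp
    show "smooth_submanifold (SOME d. smooth_submanifold d F) F" using sub(3) by (rule someI_ex)
  qed (use b in \<open>auto simp: \<phi>_def \<pi>_def\<close>)
  ultimately have "smooth_fibration \<pi> U (Pi_plane \<inter> U)"
    unfolding smooth_fibration_def using sub(1,2) \<pi>_image by blast
  moreover have "openin (top_of_set MH) U" using V' U_MH by (auto simp: openin_open)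
  moreover have "D0 \<in> U"
    unfolding U_def using diag_lift_L[of D0] mem_box_around[OF d(1)] orbit_chart_diag_lift[OF D0(1)]
    by (intro image_eqI[of _ _ z0]) (auto simp: N_def)
  ultimately show ?thesis using \<pi>_Pi fibre by (intro exI[of _ U] exI[of _ \<pi>]) blast
qed

end

subsection \<open>Dimensions\<close>

lemma surface_dim_eqI:
  assumes "smooth_submanifold d M" "M \<noteq> {}" "M \<subseteq> S"
    and "\<And>k N. smooth_submanifold k N \<Longrightarrow> N \<noteq> {} \<Longrightarrow> N \<subseteq> S \<Longrightarrow> k \<le> d"
  shows "surface_dim S = d"
  unfolding surface_dim_def
proof (rule Greatest_equality)
  show "\<exists>N. N \<noteq> {} \<and> N \<subseteq> S \<and> smooth_submanifold d N" using assms by blast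
  show "k \<le> d" if "\<exists>N. N \<noteq> {} \<and> N \<subseteq> S \<and> smooth_submanifold k N" for k
    using that assms(4) by blast
qed

text \<open>The inverse of a single chart of \<open>M\<close> covers the smaller submanifold near
  \<open>p\<close> by the image of a piece of a d-dimensional subspace.\<close>

lemma smooth_submanifold_subset_dim_le:
  fixes M :: "'a::euclidean_space set"
  assumes M: "smooth_submanifold d M" and N: "smooth_submanifold k N" "N \<noteq> {}" "N \<subseteq> M"
  shows "k \<le> d"
proof -
  obtain p where p: "p \<in> N" using N(2) by blast
  then have "submanifold_at d M p" using M N(3) by (auto simp: smooth_submanifold_iff)
  then obtain W W' and \<phi> :: "'a \<Rightarrow> 'a" and L where *: "open W" "p \<in> W" "open W'" "diffeomorphism_between \<phi> W W'"
    "subspace L" "dim L = d" "\<phi> ` (W \<inter> M) = W' \<inter> L"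
    by (rule submanifold_atE)
  obtain g where g: "\<And>x. x \<in> W \<Longrightarrow> \<phi> x \<in> W' \<and> g (\<phi> x) = x" "\<And>y. y \<in> W' \<Longrightarrow> g y \<in> W \<and> \<phi> (g y) = y"
    "smooth_map_on \<phi> W" "smooth_map_on g W'"
    using diffeomorphism_betweenE[OF *(4)] by blast
  have diff: "g differentiable_on (W' \<inter> L)"
    unfolding differentiable_on_def
    using smooth_map_on_open_differentiable[OF g(4) *(3)] by (blast intro: differentiable_at_withinI)
  show ?thesis
  proof (rule submanifold_dim_le_if_covered[OF N(1) p *(1,2), of "{()}" "\<lambda>_. W' \<inter> L" "\<lambda>_. L" d "\<lambda>_. g"])
    show "N \<inter> W \<subseteq> (\<Union>i\<in>{()}. g ` (W' \<inter> L))"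
    proof
      fix x assume x: "x \<in> N \<inter> W"
      then have "\<phi> x \<in> W' \<inter> L" using *(7) N(3) by blast
      moreover have "x = g (\<phi> x)" using g(1) x by simp
      ultimately show "x \<in> (\<Union>i\<in>{()}. g ` (W' \<inter> L))" by blast
    qed
  qed (use diff *(5,6) in auto)
qed

text \<open>A symmetric matrix \<open>X\<close> with a two-dimensional \<open>c\<close>-eigenspace spanned by vectors \<open>v\<close>, \<open>w\<close>
  whose \<open>i\<close>-th and \<open>j\<close>-th coordinates are \<open>(1, 0)\<close> and \<open>(0, 1)\<close> is \<open>c E + T\<^sup>* C T\<close>, where
  \<open>T\<close> projects along \<open>v\<close>, \<open>w\<close> onto the remaining coordinates and \<open>C\<close> is the corresponding block of
  \<open>X - c E\<close>. This covers the singular part of \<open>\<M>\<close>, too. All data are stored in the upper triangle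
  of \<open>Z\<close>.\<close>

definition sym_entry :: "'n::{finite,linorder} sqmat \<Rightarrow> 'n \<Rightarrow> 'n \<Rightarrow> real" where
  "sym_entry Z k l = (if k \<le> l then Z $ k $ l else Z $ l $ k)"

definition proj_along :: "'n::{finite,linorder} \<Rightarrow> 'n \<Rightarrow> 'n sqmat \<Rightarrow> 'n sqmat" where
  "proj_along i j Z = (\<chi> k l. if k = i \<or> k = j then 0 else if l = i then - sym_entry Z k i
     else if l = j then - sym_entry Z k j else if l = k then 1 else 0)"

definition sym_block :: "'n::{finite,linorder} \<Rightarrow> 'n \<Rightarrow> 'n sqmat \<Rightarrow> 'n sqmat" where
  "sym_block i j Z = (\<chi> k l. if k = i \<or> k = j then 0 else if l = i \<or> l = j then 0 else sym_entry Z k l)"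

definition MM_param :: "'n::{finite,linorder} \<Rightarrow> 'n \<Rightarrow> 'n sqmat \<Rightarrow> 'n sqmat" where
  "MM_param i j Z = (Z $ i $ i) *\<^sub>R mat 1 + transpose (proj_along i j Z) ** sym_block i j Z ** proj_along i j Z"

lemma polynomial_function_MM_param: "polynomial_function (MM_param i j)"
proof (rule polynomial_function_matrix)
  fix a b
  have se: "real_polynomial_function (\<lambda>Z. sym_entry Z k l)" for k l
    unfolding sym_entry_def by (intro real_polynomial_function_if real_polynomial_function_nth)
  have T: "real_polynomial_function (\<lambda>Z. proj_along i j Z $ k $ l)" for k l
    unfolding proj_along_def vec_lambda_beta
    by (intro real_polynomial_function_if real_polynomial_function_minus se real_polynomial_function.intros(2))
  have C: "real_polynomial_function (\<lambda>Z. sym_block i j Z $ k $ l)" for k l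
    unfolding sym_block_def vec_lambda_beta
    by (intro real_polynomial_function_if se real_polynomial_function.intros(2))
  have T': "real_polynomial_function (\<lambda>Z. transpose (proj_along i j Z) $ k $ l)" for k l
    using T by (simp add: transpose_def)
  show "real_polynomial_function (\<lambda>Z. MM_param i j Z $ a $ b)"
    unfolding MM_param_def vector_add_component vector_scaleR_component real_scaleR_def
    by (intro real_polynomial_function.intros(2-4) real_polynomial_function_nth real_polynomial_function_matrix_mult T C T')
qed

lemma MM_param_cover:
  fixes X :: "'n::{finite,linorder} sqmat"
  assumes X: "X \<in> MM"
  shows "\<exists>i j. i < j \<and> X \<in> MM_param i j ` coord_subspace ({(k, l). k \<le> l} - {(i, j), (j, j)})"
proof -
  obtain c where c: "multiple_eigenvalue X c" and Xsym: "X \<in> Sym" using X MM_iff by blast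
  have "\<exists>i j v w. i < j \<and> v $ i = 1 \<and> v $ j = 0 \<and> w $ i = 0 \<and> w $ j = 1 \<and> X *v v = c *\<^sub>R v \<and> X *v w = c *\<^sub>R w"
  proof -
    obtain u where u: "u \<noteq> 0" "X *v u = c *\<^sub>R u" using c unfolding multiple_eigenvalue_def by blast
    then obtain i where i: "u $ i \<noteq> 0" by (auto simp: vec_eq_iff)
    obtain u' where u': "u' \<noteq> 0" "axis i 1 \<bullet> u' = 0" "X *v u' = c *\<^sub>R u'"
      using c unfolding multiple_eigenvalue_def by blast
    then have u'i: "u' $ i = 0" by (simp add: inner_axis')
    obtain j where j: "u' $ j \<noteq> 0" using u'(1) by (auto simp: vec_eq_iff)
    have ij: "i \<noteq> j" using u'i j by auto
    \<comment> \<open>Gaussian elimination: the second eigenvector already vanishes at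
      \<open>i\<close>; it is scaled at \<open>j\<close> and used to clear that coordinate of the
      first.\<close>
    define w where "w = (1 / u' $ j) *\<^sub>R u'"
    define v where "v = (1 / u $ i) *\<^sub>R (u - u $ j *\<^sub>R w)"
    have w: "w $ i = 0" "w $ j = 1" "X *v w = c *\<^sub>R w"
      using u'i j u'(3) by (simp_all add: w_def matrix_vector_mult_scaleR)
    have v: "v $ i = 1" "v $ j = 0" "X *v v = c *\<^sub>R v"
      using i w u(2) by (simp_all add: v_def matrix_vector_mult_scaleR matrix_vector_mult_diff_distrib scaleR_diff_right)
    show ?thesis
    proof (cases "i < j")
      case True
      then show ?thesis using v w by blast
    next
      case False
      then have "j < i" using ij by simp
      then show ?thesis using v w by blast
    qed
  qed
  then obtain i j v w where ij: "i < j" and v: "v $ i = 1" "v $ j = 0" "X *v v = c *\<^sub>R v"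
    and w: "w $ i = 0" "w $ j = 1" "X *v w = c *\<^sub>R w" by blast
  define Y where "Y = X - c *\<^sub>R mat 1"
  have Yv: "Y *v v = 0" "Y *v w = 0"
    using v(3) w(3) by (simp_all add: Y_def matrix_vector_mult_diff_rdistrib scaleR_matrix_vector_assoc[symmetric])
  have Ysym: "Y $ k $ l = Y $ l $ k" for k l
    using Sym_nth[OF Xsym, of k l] by (simp add: Y_def mat_def)
  \<comment> \<open>The free coordinates of the two eigenvectors occupy the rows and columns
    \<open>i\<close> and \<open>j\<close>. Of their four crossings only (i, i) carries data, namely
    \<open>c\<close>, so (i, j) and (j, j) are no parameters.\<close>
  define W where "W k l = (if (k = i \<or> k = j) \<and> (l = i \<or> l = j) then (if k = i \<and> l = i then c else 0)
    else if l = i then v $ k else if k = i then v $ l else if l = j then w $ k else if k = j then w $ l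
    else Y $ k $ l)" for k l
  define Z where "Z = (\<chi> k l. if k \<le> l then W k l else 0)"
  have Wsym: "W l k = W k l" for k l
    unfolding W_def using ij Ysym[of k l] by (cases "k = i"; cases "k = j"; cases "l = i"; cases "l = j") simp_all
  have se: "sym_entry Z k l = W k l" for k l
    using Wsym[of k l] by (cases "k \<le> l") (simp_all add: sym_entry_def Z_def)
  have Zij: "Z $ i $ i = c" "Z $ i $ j = 0" "Z $ j $ j = 0" using ij by (simp_all add: Z_def W_def)
  have Zmem: "Z \<in> coord_subspace ({(k, l). k \<le> l} - {(i, j), (j, j)})"
    using Zij unfolding coord_subspace_def by (auto simp: Z_def)
  let ?T = "proj_along i j Z"
  \<comment> \<open>T is the identity minus two rank-one matrices whose columns are multiples of
    \<open>v\<close> and \<open>w\<close>. \<open>Y\<close> annihilates both, hence Y T = Y.\<close>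
  have T_nth: "?T $ k $ l = (if k = l then 1 else 0) - v $ k * (if l = i then 1 else 0) - w $ k * (if l = j then 1 else 0)" for k l
    using ij v(1,2) w(1,2)
    by (cases "k = i"; cases "k = j"; cases "l = i"; cases "l = j"; cases "k = l") (simp_all add: proj_along_def se W_def)
  have YT: "Y ** ?T = Y"
  proof -
    have "(Y ** ?T) $ a $ b = Y $ a $ b" for a b
    proof -
      define r s :: real where "r = (if b = i then 1 else 0)" and "s = (if b = j then 1 else 0)"
      have "(Y ** ?T) $ a $ b = (\<Sum>k\<in>UNIV. (if k = b then Y $ a $ k else 0) - Y $ a $ k * v $ k * r - Y $ a $ k * w $ k * s)"
        unfolding matrix_matrix_mult_def vec_lambda_beta T_nth r_def[symmetric] s_def[symmetric]
        by (intro sum.cong refl) (simp add: algebra_simps)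
      also have "\<dots> = Y $ a $ b - (Y *v v) $ a * r - (Y *v w) $ a * s"
        by (simp add: sum_subtractf matrix_vector_mult_def sum_distrib_right)
      finally show ?thesis by (simp add: Yv)
    qed
    then show ?thesis by (simp add: vec_eq_iff)
  qed
  have "transpose Y = Y" using Ysym by (simp add: vec_eq_iff transpose_def)
  then have TY: "transpose ?T ** Y = Y"
    using arg_cong[OF YT, of transpose] by (simp add: matrix_transpose_mul)
  \<comment> \<open>The rows \<open>i\<close> and \<open>j\<close> of T vanish, so the entries where
    the block differs from \<open>Y\<close> never contribute.\<close>
  have "transpose ?T ** sym_block i j Z ** ?T = transpose ?T ** Y ** ?T"
  proof -
    have row0: "?T $ k $ a = 0" if "k = i \<or> k = j" for k a using that by (simp add: proj_along_def)
    have blk: "sym_block i j Z $ k $ l = Y $ k $ l" if "\<not> (k = i \<or> k = j)" "\<not> (l = i \<or> l = j)" for k l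
      using that by (simp add: sym_block_def se W_def)
    have "?T $ k $ a * sym_block i j Z $ k $ l * ?T $ l $ b = ?T $ k $ a * Y $ k $ l * ?T $ l $ b" for a b k l
      using row0[of k a] row0[of l b] blk[of k l] by (cases "k = i \<or> k = j"; cases "l = i \<or> l = j") simp_all
    note entries = this
    show ?thesis
      by (simp only: vec_eq_iff matrix_matrix_mult_def transpose_def vec_lambda_beta sum_distrib_right entries) simp
  qed
  then have "MM_param i j Z = X" unfolding MM_param_def Zij(1) TY YT by (simp add: TY YT Y_def)
  then show ?thesis using Zmem ij by blast
qed

lemma submanifold_of_MM_dim_le:
  assumes n: "CARD('n::{finite,linorder}) > 1"
    and N: "smooth_submanifold k N" "N \<noteq> {}" "N \<subseteq> (MM :: 'n sqmat set)"
  shows "k \<le> card (MH_coords :: ('n \<times> 'n) set)"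
proof -
  obtain p where p: "p \<in> N" using N(2) by blast
  let ?P = "\<lambda>(i, j). coord_subspace ({(k, l). k \<le> l} - {(i, j), (j, j)}) :: 'n sqmat set"
  show ?thesis
  proof (rule submanifold_dim_le_if_covered[OF N(1) p open_UNIV UNIV_I,
        of "{(i, j). i < j}" ?P ?P _ "\<lambda>(i, j). MM_param i j"])
    show "finite {(i :: 'n, j). i < j}" by (rule finite_subset[OF subset_UNIV]) simp
    fix q :: "'n \<times> 'n" assume "q \<in> {(i, j). i < j}"
    then obtain i j where q: "q = (i, j)" "i < j" by blast
    have "card ({(k, l). k \<le> l} - {(i, j), (j, j)}) = CARD('n) * (CARD('n) - 1) div 2 + CARD('n) - 2"
    proof -
      have "card {(i, j), (j, j)} = 2" using q(2) by simp
      moreover have "{(i, j), (j, j)} \<subseteq> {(k, l). k \<le> l}" using q(2) by auto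
      ultimately show ?thesis by (subst card_Diff_subset) (simp_all add: card_le_pairs)
    qed
    moreover have "MM_param i j differentiable_on S" for S
      unfolding differentiable_on_def
      by (intro ballI differentiable_at_polynomial_function polynomial_function_MM_param)
    ultimately show "?P q \<subseteq> ?P q \<and> subspace (?P q) \<and> dim (?P q) \<le> card (MH_coords :: ('n \<times> 'n) set) \<and>
        (case q of (i, j) \<Rightarrow> MM_param i j) differentiable_on (?P q)"
      by (simp add: q(1) subspace_coord_subspace dim_coord_subspace card_MH_coords[OF n])
  next
    show "N \<inter> UNIV \<subseteq> (\<Union>q\<in>{(i, j). i < j}. (case q of (i, j) \<Rightarrow> MM_param i j) ` ?P q)"
      using MM_param_cover N(3) by fastforce
  qed
qed

lemma MH_nonempty:
  assumes n: "CARD('n::{finite,linorder}) > 1" shows "(MH :: 'n sqmat set) \<noteq> {}"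
proof -
  \<comment> \<open>The diagonal 0, 0, 2, 3, ...: each index gets its position, except that
    \<open>idx2\<close> repeats the value of \<open>idx1\<close>.\<close>
  define d :: "'n \<Rightarrow> real" where "d i = (if i = idx2 then 0 else card {k. k < i})" for i
  define D :: "'n sqmat" where "D = (\<chi> i j. if i = j then d i else 0)"
  have lt: "idx1 < (idx2 :: 'n)" by (rule idx1_less_idx2[OF n])
  have mono: "card {k. k < a} < card {k. k < b}" if "a < b" for a b :: 'n
    using that by (intro psubset_card_mono) auto
  have D: "D \<in> Pi_plane"
    unfolding Pi_plane_iff[OF n] using lt card_less_idx1[where 'n = 'n] by (auto simp: D_def Dg_def d_def)
  have "{a, b} = {idx1, idx2}" if ab: "a \<noteq> b" "d a = d b" for a b
  proof -
    have inj: "a = b" if "card {k. k < a} = card {k. k < b}" for a b :: 'n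
      using that mono[of a b] mono[of b a] by (cases a b rule: linorder_cases) auto
    have zero: "a = idx1" if "a \<noteq> idx2" "d a = 0" for a
      using that inj[of a idx1] card_less_idx1[where 'n = 'n] by (simp add: d_def)
    consider "a = idx2" | "b = idx2" | "a \<noteq> idx2" "b \<noteq> idx2" by blast
    then show ?thesis
    proof cases
      case 1
      then have "b = idx1" using ab zero[of b] by (simp add: d_def[of idx2])
      then show ?thesis using 1 by blast
    next
      case 2
      then have "a = idx1" using ab zero[of a] by (simp add: d_def[of idx2])
      then show ?thesis using 2 by blast
    next
      case 3
      then show ?thesis using ab inj[of a b] by (simp add: d_def)
    qed
  qed
  then have "D \<in> MH" unfolding Pi_MH_iff[OF n D] by (simp add: D_def)
  then show ?thesis by blast
qed

lemma surface_dim_MM: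
  assumes n: "CARD('n::{finite,linorder}) > 1"
  shows "surface_dim (MM :: 'n sqmat set) = CARD('n) * (CARD('n) - 1) div 2 + CARD('n) - 2"
  unfolding card_MH_coords[OF n, symmetric]
  by (rule surface_dim_eqI[OF smooth_submanifold_MH[OF n] MH_nonempty[OF n] MH_subset_MM])
    (rule submanifold_of_MM_dim_le[OF n])

lemma surface_dim_Times_SO:
  "surface_dim (UNIV \<times> SO :: ('a::euclidean_space \<times> 'n::{finite,linorder} sqmat) set) =
    DIM('a) + CARD('n) * (CARD('n) - 1) div 2"
proof -
  have sub: "smooth_submanifold (DIM('a) + CARD('n) * (CARD('n) - 1) div 2) (UNIV \<times> SO :: ('a \<times> 'n sqmat) set)"
    using smooth_submanifold_Times[OF smooth_submanifold_subspace[OF subspace_UNIV, where 'a = 'a] smooth_submanifold_SO]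
    by simp
  have "(UNIV \<times> SO :: ('a \<times> 'n sqmat) set) \<noteq> {}" using SO_mat1 by auto
  from surface_dim_eqI[OF sub this subset_refl smooth_submanifold_subset_dim_le[OF sub]] show ?thesis .
qed

subsection \<open>Tangent vectors of orbits\<close>

lemma conj_by_mult:
  assumes "g \<in> SO" shows "conj_by g A ** conj_by g B = conj_by g (A ** B)"
proof -
  have "conj_by g A ** conj_by g B = g ** A ** (transpose g ** g) ** B ** transpose g"
    by (simp add: conj_by_def matrix_mul_assoc)
  also have "transpose g ** g = mat 1" using assms SO_iff by blast
  finally show ?thesis by (simp add: conj_by_def matrix_mul_assoc)
qed

lemma conj_by_diff_Scal:
  assumes "g \<in> SO" shows "conj_by g X - c *\<^sub>R mat 1 = conj_by g (X - c *\<^sub>R mat 1)"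
  using assms by (simp add: linear_diff[OF linear_conj_by] linear_scale[OF linear_conj_by] conj_by_def[of g "mat 1"] SO_iff)

text \<open>The value at \<open>X\<close> of the monic polynomial with roots \<open>cs\<close>, kept
  as a product so that conjugation passes through factor by factor.\<close>

definition root_product :: "real list \<Rightarrow> 'n::finite sqmat \<Rightarrow> 'n sqmat" where
  "root_product cs X = foldr (\<lambda>c M. (X - c *\<^sub>R mat 1) ** M) cs (mat 1)"

lemma root_product_conj_by: "g \<in> SO \<Longrightarrow> root_product cs (conj_by g X) = conj_by g (root_product cs X)"
  by (induction cs) (simp_all add: root_product_def conj_by_diff_Scal conj_by_mult conj_by_def[of g "mat 1"] SO_iff)

lemma continuous_root_product: "isCont f t \<Longrightarrow> isCont (\<lambda>t. root_product cs (f t)) t"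
proof (induction cs)
  case (Cons c cs)
  then show ?case
    by (simp add: root_product_def, intro bounded_bilinear.continuous[OF bounded_bilinear_matrix_mult] continuous_intros)
qed (simp add: root_product_def)

lemma Dg_mult_Dg:
  assumes "A \<in> Dg" "B \<in> Dg" shows "A ** B \<in> Dg" "(A ** B) $ i $ i = A $ i $ i * B $ i $ i"
proof -
  have "(A ** B) $ i $ j = A $ i $ i * B $ i $ j" for i j
  proof -
    have "(A ** B) $ i $ j = (A *v (\<chi> k. B $ k $ j)) $ i"
      by (simp add: matrix_matrix_mult_def matrix_vector_mult_def)
    then show ?thesis by (simp add: Dg_mult_vector[OF assms(1)])
  qed
  then show "A ** B \<in> Dg" "(A ** B) $ i $ i = A $ i $ i * B $ i $ i" using assms(2) by (auto simp: Dg_def)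
qed

lemma root_product_Dg:
  assumes "D \<in> Dg"
  shows "root_product cs D \<in> Dg \<and> root_product cs D $ i $ i = (\<Prod>c\<leftarrow>cs. D $ i $ i - c)"
proof (induction cs)
  case Nil
  then show ?case by (simp add: root_product_def Dg_def mat_def)
next
  case (Cons c cs)
  have "D - c *\<^sub>R mat 1 \<in> Dg" using assms by (auto simp: Dg_def mat_def)
  then show ?case using Dg_mult_Dg[of "D - c *\<^sub>R mat 1" "root_product cs D"] Cons.IH
    by (simp add: root_product_def mat_def)
qed

text \<open>Along an orbit \<open>(X - \<lambda> E) q(X) = 0\<close>, where \<open>q\<close> has the other eigenvalues as roots. Since the
  \<open>i\<close>-th row of \<open>D - \<lambda> E\<close> vanishes for \<open>\<lambda> = D\<^sub>i\<^sub>i\<close>, differentiating at \<open>D\<close> gives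
  \<open>v\<^sub>i\<^sub>i q(\<lambda>) = 0\<close>.\<close>

lemma tangent_space_Orbit_diagonal:
  fixes A :: "'n::finite sqmat"
  assumes D: "D \<in> Orbit A" "D \<in> Dg" and v: "v \<in> tangent_space (Orbit A) D"
  shows "v $ i $ i = 0"
proof -
  obtain \<gamma> e where e: "e > 0" and \<gamma>: "\<gamma> ` {- e <..< e} \<subseteq> Orbit A" "\<gamma> 0 = D" "(\<gamma> has_vector_derivative v) (at 0)"
    using v by (auto simp: tangent_space_def)
  define l where "l = D $ i $ i"
  obtain cs where cs: "set cs = range (\<lambda>i. D $ i $ i) - {l}"
    using finite_list[of "range (\<lambda>i. D $ i $ i) - {l}"] by auto
  define q :: "'n sqmat \<Rightarrow> 'n sqmat" where "q = root_product cs"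
  have q: "q D \<in> Dg" "q D $ k $ k = (\<Prod>c\<leftarrow>cs. D $ k $ k - c)" for k
    using root_product_Dg[OF D(2)] by (simp_all add: q_def)
  have qk: "q D $ k $ k = 0" if "D $ k $ k \<noteq> l" for k
  proof -
    have "D $ k $ k \<in> set cs" unfolding cs using that by blast
    then show ?thesis unfolding q(2) by (auto simp: prod_list_zero_iff)
  qed
  have ql: "q D $ i $ i \<noteq> 0"
  proof -
    have "l \<notin> set cs" unfolding cs by blast
    then show ?thesis unfolding q(2) l_def[symmetric] by (auto simp: prod_list_zero_iff)
  qed
  have zero_D: "(D - l *\<^sub>R mat 1) ** q D = 0"
  proof -
    have S: "D - l *\<^sub>R mat 1 \<in> Dg" using D(2) by (auto simp: Dg_def mat_def)
    have "((D - l *\<^sub>R mat 1) ** q D) $ k $ k = 0" for k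
      using Dg_mult_Dg(2)[OF S q(1)] qk[of k] by (cases "D $ k $ k = l") (simp_all add: mat_def)
    then have "((D - l *\<^sub>R mat 1) ** q D) $ k $ m = 0" for k m
      using Dg_mult_Dg(1)[OF S q(1)] by (cases "k = m") (auto simp: Dg_def)
    then show ?thesis by (simp add: vec_eq_iff)
  qed
  have zero: "(X - l *\<^sub>R mat 1) ** q X = 0" if "X \<in> Orbit A" for X
  proof -
    have "X \<in> Orbit D" using that Orbit_eq[OF D(1)] by simp
    then obtain g where g: "g \<in> SO" "X = conj_by g D" by (auto simp: Orbit_def)
    have "(X - l *\<^sub>R mat 1) ** q X = conj_by g ((D - l *\<^sub>R mat 1) ** q D)"
      using g by (simp add: q_def root_product_conj_by conj_by_diff_Scal conj_by_mult)
    then show ?thesis by (simp add: zero_D linear_0[OF linear_conj_by])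
  qed
  have D\<gamma>: "(\<gamma> has_derivative (\<lambda>h. h *\<^sub>R v)) (at 0)" using \<gamma>(3) by (simp add: has_vector_derivative_def)
  have D1: "((\<lambda>t. (\<gamma> t - l *\<^sub>R mat 1) $ i $ k) has_derivative (\<lambda>h. h * v $ i $ k)) (at 0)" for k
  proof -
    have "bounded_linear (\<lambda>X :: 'n sqmat. X $ i $ k)"
      by (rule bounded_linear_compose[OF bounded_linear_vec_nth bounded_linear_vec_nth])
    from bounded_linear.has_derivative[OF this has_derivative_diff[OF D\<gamma> has_derivative_const[of "l *\<^sub>R mat 1"]]]
    show ?thesis by simp
  qed
  have "isCont \<gamma> 0" using D\<gamma> has_derivative_continuous by blast
  then have cq: "isCont (\<lambda>t. q (\<gamma> t) $ k $ i) 0" for k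
    unfolding q_def using continuous_root_product[of 0 \<gamma> cs] by (intro continuous_intros)
  \<comment> \<open>The row \<open>i\<close> of D - l E is zero, so the product rule at a zero needs
    only continuity of \<open>q\<close> along the curve and no formula for its derivative.\<close>
  have "((\<lambda>t. (\<gamma> t - l *\<^sub>R mat 1) $ i $ k *\<^sub>R q (\<gamma> t) $ k $ i) has_derivative
      (\<lambda>h. (h * v $ i $ k) *\<^sub>R q (\<gamma> 0) $ k $ i)) (at 0)" for k
    by (rule has_derivative_mult_vanishing[OF D1 _ cq])
      (use D(2) in \<open>cases "i = k"; simp add: \<gamma>(2) l_def mat_def Dg_def\<close>)
  then have "((\<lambda>t. \<Sum>k\<in>UNIV. (\<gamma> t - l *\<^sub>R mat 1) $ i $ k *\<^sub>R q (\<gamma> t) $ k $ i) has_derivative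
      (\<lambda>h. \<Sum>k\<in>UNIV. (h * v $ i $ k) *\<^sub>R q (\<gamma> 0) $ k $ i)) (at 0)"
    by (intro has_derivative_sum)
  moreover have "(\<Sum>k\<in>UNIV. (\<gamma> t - l *\<^sub>R mat 1) $ i $ k *\<^sub>R q (\<gamma> t) $ k $ i) = 0" if "t \<in> {- e <..< e}" for t
  proof -
    have "\<gamma> t \<in> Orbit A" using \<gamma>(1) that by blast
    from zero[OF this] have "((\<gamma> t - l *\<^sub>R mat 1) ** q (\<gamma> t)) $ i $ i = 0" by simp
    then show ?thesis by (simp add: matrix_matrix_mult_def)
  qed
  ultimately have "((\<lambda>t :: real. 0 :: real) has_derivative (\<lambda>h. \<Sum>k\<in>UNIV. (h * v $ i $ k) *\<^sub>R q (\<gamma> 0) $ k $ i)) (at 0)"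
    using has_derivative_transform_within_open[of _ _ 0 UNIV "{- e <..< e}" "\<lambda>t. 0"] e by auto
  then have "(\<lambda>h. \<Sum>k\<in>UNIV. (h * v $ i $ k) *\<^sub>R q (\<gamma> 0) $ k $ i) = (\<lambda>h :: real. 0 :: real)"
    using has_derivative_unique has_derivative_const by blast
  from fun_cong[OF this, of 1] have "(\<Sum>k\<in>UNIV. v $ i $ k * q D $ k $ i) = 0" by (simp add: \<gamma>(2))
  also have "(\<Sum>k\<in>UNIV. v $ i $ k * q D $ k $ i) = (\<Sum>k\<in>{i}. v $ i $ k * q D $ k $ i)"
    by (rule sum.mono_neutral_right) (use q(1) in \<open>auto simp: Dg_def\<close>)
  finally show ?thesis using ql by simp
qed

lemma tangent_space_Orbit_orthogonal_Dg:
  fixes A :: "'n::finite sqmat"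
  assumes "D \<in> Orbit A \<inter> Dg" "v \<in> tangent_space (Orbit A) D" "w \<in> Dg"
  shows "orthogonal v w"
proof -
  have "v $ i $ j * w $ i $ j = 0" for i j
    using tangent_space_Orbit_diagonal[of D A v i] assms by (cases "i = j") (auto simp: Dg_def)
  then have "v $ i \<bullet> w $ i = 0" for i
    unfolding inner_vec_def by (intro sum.neutral) (simp del: mult_eq_0_iff)
  then show ?thesis by (simp add: orthogonal_def inner_vec_def[of v])
qed

section \<open>Conjugation as an isometry and the assembly of the theorem\<close>

lemma bij_betw_conj_by_Sym:
  assumes "g \<in> SO" shows "bij_betw (conj_by g) Sym Sym"
  by (rule bij_betw_byWitness[where f' = "conj_by (transpose g)"])
    (use conj_by_inverse[OF assms] conj_by_Sym in auto)

lemma conj_by_image_MH: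
  fixes g :: "'n::finite sqmat"
  assumes "g \<in> SO" shows "conj_by g ` MH = MH"
proof (intro equalityI subsetI)
  fix X :: "'n sqmat" assume "X \<in> MH"
  then show "X \<in> conj_by g ` MH"
    using MH_conj_by[OF SO_transpose[OF assms], of X] conj_by_inverse(2)[OF assms, of X]
    by (intro image_eqI[of _ _ "conj_by (transpose g) X"]) auto
qed (use MH_conj_by[OF assms] in auto)

lemma MH_local_fibration:
  fixes M :: "'n::{finite,linorder} sqmat"
  assumes n: "CARD('n) > 1" and M: "M \<in> MH"
  shows "\<exists>g \<in> SO. \<exists>D0 \<in> Pi_plane \<inter> MH. conj_by g M = D0 \<and>
    (\<exists>U \<pi>. openin (top_of_set MH) U \<and> D0 \<in> U \<and> smooth_fibration \<pi> U (Pi_plane \<inter> U) \<and>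
      (\<forall>D \<in> Pi_plane \<inter> U. \<pi> D = D \<and> {X \<in> U. \<pi> X = D} = U \<inter> Orbit D))"
proof -
  obtain g D0 e where g: "g \<in> SO" "D0 \<in> Pi_plane" "D0 \<in> MH" "M = conj_by g D0" "orbit_chart_at D0 e"
    by (rule MH_conj_orbit_chart_at[OF n M])
  have "conj_by (transpose g) M = D0" using conj_by_inverse(1)[OF g(1)] g(4) by simp
  then show ?thesis
    using orbit_chart_at.local_fibration[OF g(5)] SO_transpose[OF g(1)] g(2,3)
    by (intro bexI[of _ "transpose g"] bexI[of _ D0] conjI) auto
qed

theorem mainTheorem2:
  assumes n_gt_2: "CARD('n::{finite,linorder}) > 2"
    and card_m: "CARD('n) = CARD('m::{finite,linorder}) + 2"
  shows
    "irreducible_algebraic_set (MM :: 'n sqmat set) \<and>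

     (MM :: 'n sqmat set) = (\<Union>s. MM_level s) \<and>
     straight_cylinder_Scal (MM :: 'n sqmat set) (MM_level 0) \<and>

     (\<forall>A \<in> (MM :: 'n sqmat set). \<forall>B \<in> MM. Orbit A = Orbit B \<longleftrightarrow> spectrum A = spectrum B) \<and>
     (\<forall>A \<in> (MM :: 'n sqmat set). \<exists>!D. D \<in> Orbit A \<and> diagonal_ordered D) \<and>
     (\<forall>A \<in> (MM :: 'n sqmat set). \<forall>B \<in> MM. Orbit A = Orbit B \<longleftrightarrow>
        (THE D. D \<in> Orbit A \<and> diagonal_ordered D) = (THE D. D \<in> Orbit B \<and> diagonal_ordered D)) \<and>

     (\<exists>d. smooth_submanifold d (MH :: 'n sqmat set)) \<and>
     (\<forall>g \<in> (SO :: 'n sqmat set).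
        bij_betw (conj_by g) Sym Sym \<and>
        (\<forall>X \<in> Sym. \<forall>Y \<in> Sym. dist (conj_by g X) (conj_by g Y) = dist X Y) \<and>
        conj_by g ` MH = MH) \<and>
     (\<forall>M \<in> (MH :: 'n sqmat set). \<exists>g \<in> SO. \<exists>D\<^sub>0 \<in> Pi_plane \<inter> MH. conj_by g M = D\<^sub>0 \<and>
        (\<exists>U \<pi>. openin (top_of_set MH) U \<and> D\<^sub>0 \<in> U \<and>
           smooth_fibration \<pi> U (Pi_plane \<inter> U) \<and>
           (\<forall>D \<in> Pi_plane \<inter> U. \<pi> D = D \<and> {X \<in> U. \<pi> X = D} = U \<inter> Orbit D))) \<and>
     (\<forall>A \<in> (MH :: 'n sqmat set). \<forall>D \<in> Orbit A \<inter> Dg.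
        \<forall>v \<in> tangent_space (Orbit A) D. \<forall>w \<in> Dg. orthogonal v w) \<and>

     smooth_submanifold (CARD('n) * (CARD('n) - 1) div 2) (SO :: 'n sqmat set) \<and>
     (\<forall>A \<in> (MH :: 'n sqmat set).
        smooth_submanifold (CARD('n) * (CARD('n) - 1) div 2 - 1) (Orbit A) \<and>
        compact (Orbit A) \<and> algebraic_set (Orbit A) \<and> connected (Orbit A) \<and>
        (\<exists>H C r. hyperplane_orth_Scal H \<and> C \<in> H \<and> r > 0 \<and> Orbit A \<subseteq> H \<inter> sphere C r)) \<and>

     (DO :: 'm plane_coords \<times> 'n sqmat \<Rightarrow> 'n sqmat) ` (UNIV \<times> SO) = MM \<and>
     polynomial_function (DO :: 'm plane_coords \<times> 'n sqmat \<Rightarrow> 'n sqmat) \<and>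
     algebraic_set (UNIV \<times> SO :: ('m plane_coords \<times> 'n sqmat) set) \<and>
     surface_dim (UNIV \<times> SO :: ('m plane_coords \<times> 'n sqmat) set) =
       surface_dim (MM :: 'n sqmat set) + 1"
proof -
  have n: "CARD('n) > 1" using n_gt_2 by simp
  note Sym = MM_subset_Sym[THEN subsetD] and Sym' = MH_subset_Sym[THEN subsetD]
  have classified: "\<forall>A \<in> (MM :: 'n sqmat set). \<forall>B \<in> MM. Orbit A = Orbit B \<longleftrightarrow> spectrum A = spectrum B"
    using Orbit_eq_iff_spectrum Sym by blast
  have uniq: "\<exists>!D. D \<in> Orbit A \<and> diagonal_ordered D" if "A \<in> (MM :: 'n sqmat set)" for A
    by (rule Orbit_unique_diagonal_ordered[OF Sym[OF that]])
  have classified': "Orbit A = Orbit B \<longleftrightarrow>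
      (THE D. D \<in> Orbit A \<and> diagonal_ordered D) = (THE D. D \<in> Orbit B \<and> diagonal_ordered D)"
    if AB: "A \<in> (MM :: 'n sqmat set)" "B \<in> MM" for A B
  proof
    assume eq: "(THE D. D \<in> Orbit A \<and> diagonal_ordered D) = (THE D. D \<in> Orbit B \<and> diagonal_ordered D)"
    let ?a = "THE D. D \<in> Orbit A \<and> diagonal_ordered D" and ?b = "THE D. D \<in> Orbit B \<and> diagonal_ordered D"
    have "Orbit ?a = Orbit A" by (rule Orbit_eq[OF conjunct1[OF theI'[OF uniq[OF AB(1)]]]])
    moreover have "Orbit ?b = Orbit B" by (rule Orbit_eq[OF conjunct1[OF theI'[OF uniq[OF AB(2)]]]])
    ultimately show "Orbit A = Orbit B" unfolding eq by (rule trans[OF sym])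
  qed simp
  \<comment> \<open>The plane contributes 1 + (n - 2) = n - 1 dimensions, while \<open>MM\<close>
    has n - 2 more than \<open>SO\<close>.\<close>
  have dims: "surface_dim (UNIV \<times> SO :: ('m plane_coords \<times> 'n sqmat) set) =
      surface_dim (MM :: 'n sqmat set) + 1"
    unfolding surface_dim_Times_SO surface_dim_MM[OF n] using card_m by simp
  have orbits: "smooth_submanifold (CARD('n) * (CARD('n) - 1) div 2 - 1) (Orbit A) \<and>
      compact (Orbit A) \<and> algebraic_set (Orbit A) \<and> connected (Orbit A) \<and>
      (\<exists>H C r. hyperplane_orth_Scal H \<and> C \<in> H \<and> r > 0 \<and> Orbit A \<subseteq> H \<inter> sphere C r)"
    if A: "A \<in> (MH :: 'n sqmat set)" for A
    using smooth_submanifold_Orbit[OF n A] compact_Orbit[of A] algebraic_set_Orbit[OF Sym'[OF A]]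
      connected_Orbit[OF Sym'[OF A]] Orbit_in_sphere[OF n_gt_2 A]
    unfolding card_orbit_coords[OF n] by blast
  have levels: "(MM :: 'n sqmat set) = (\<Union>s. MM_level s)" by (auto simp: MM_level_def)
  have isometries: "bij_betw (conj_by g) Sym Sym \<and>
      (\<forall>X \<in> Sym. \<forall>Y \<in> Sym. dist (conj_by g X) (conj_by g Y) = dist X Y) \<and> conj_by g ` MH = MH"
    if "g \<in> SO" for g :: "'n sqmat"
    using bij_betw_conj_by_Sym[OF that] dist_conj_by[OF that] conj_by_image_MH[OF that] by blast
  show ?thesis
  proof (intro conjI)
    show "\<exists>d. smooth_submanifold d (MH :: 'n sqmat set)" using smooth_submanifold_MH[OF n] by blast
    show "\<forall>A \<in> (MM :: 'n sqmat set). \<exists>!D. D \<in> Orbit A \<and> diagonal_ordered D" using uniq by blast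
    show "\<forall>A \<in> (MM :: 'n sqmat set). \<forall>B \<in> MM. Orbit A = Orbit B \<longleftrightarrow>
        (THE D. D \<in> Orbit A \<and> diagonal_ordered D) = (THE D. D \<in> Orbit B \<and> diagonal_ordered D)"
      using classified' by blast
    show "\<forall>M \<in> (MH :: 'n sqmat set). \<exists>g \<in> SO. \<exists>D\<^sub>0 \<in> Pi_plane \<inter> MH. conj_by g M = D\<^sub>0 \<and>
        (\<exists>U \<pi>. openin (top_of_set MH) U \<and> D\<^sub>0 \<in> U \<and>
           smooth_fibration \<pi> U (Pi_plane \<inter> U) \<and>
           (\<forall>D \<in> Pi_plane \<inter> U. \<pi> D = D \<and> {X \<in> U. \<pi> X = D} = U \<inter> Orbit D))"
      by (intro ballI) (rule MH_local_fibration[OF n])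
    show "\<forall>A \<in> (MH :: 'n sqmat set). \<forall>D \<in> Orbit A \<inter> Dg. \<forall>v \<in> tangent_space (Orbit A) D. \<forall>w \<in> Dg. orthogonal v w"
      by (intro ballI) (rule tangent_space_Orbit_orthogonal_Dg)
    show "\<forall>A \<in> (MH :: 'n sqmat set).
        smooth_submanifold (CARD('n) * (CARD('n) - 1) div 2 - 1) (Orbit A) \<and>
        compact (Orbit A) \<and> algebraic_set (Orbit A) \<and> connected (Orbit A) \<and>
        (\<exists>H C r. hyperplane_orth_Scal H \<and> C \<in> H \<and> r > 0 \<and> Orbit A \<subseteq> H \<inter> sphere C r)"
      using orbits by blast
    show "\<forall>g \<in> (SO :: 'n sqmat set). bij_betw (conj_by g) Sym Sym \<and>
        (\<forall>X \<in> Sym. \<forall>Y \<in> Sym. dist (conj_by g X) (conj_by g Y) = dist X Y) \<and> conj_by g ` MH = MH"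
      using isometries by blast
  qed (rule irreducible_MM[OF n] levels straight_cylinder_MM classified smooth_submanifold_SO DO_image[OF n card_m]
      polynomial_function_DO[OF card_m] algebraic_set_Times_SO dims)+
qed

end
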